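(* Let $G$ be the dodecahedron graph and let $F$ be a circuit of $G$ of length five. Let $H$ be a cyclically five-connected cubic graph such that $F$ is a subgraph of $H$, and suppose that (i) $H$ $F$-contains no jump extension of $(G,F)$, and (ii) for every $X\subseteq V(H)\setminus V(F)$ with $|\delta_H(X)|=5$ and $X\ne V(H)\setminus V(F)$, there is no homeomorphic embedding $\eta$ of $G$ in $H$ fixing $F$ such that $\eta(v)\in X$ for all $v\in V(G)\setminus V(F)$. Then $H$ $F$-contains no hop extension of $(G,F)$.
   Context: All graphs finite and simple. $\delta_H(X)$ is the set of edges with exactly one end in $X$; a cubic graph is cyclically $k$-connected if it has girth $\ge k$ and $|\delta(X)|\ge k$ for all $X$ such that both $X$ and its complement contain the vertex set of a circuit. The dodecahedron graph is the 1-skeleton of the regular dodecahedron (cubic, planar, 20 vertices, 12 pentagonal faces); its planar embedding is unique, and its regions are these 12 faces. A homeomorphic embedding of $G$ in $H$ is a map $\eta$: injective on vertices; each edge $e=v_1v_2$ maps to a path $\eta(e)$ with ends $\eta(v_1),\eta(v_2)$; for distinct edges $e_1,e_2$ no edge or internal vertex of $\eta(e_1)$ lies in $\eta(e_2)$; $\eta(v)\in V(\eta(e))$ iff $v$ is an end of $e$. If $F$ is a subgraph of both $G'$ and $H$, $\eta$ fixes $F$ if $\eta(e)=e$, $\eta(v)=v$ for all $e\in E(F)$, $v\in V(F)$; $H$ $F$-contains $G'$ if some homeomorphic embedding of $G'$ in $H$ fixes $F$. For distinct edges $ab,cd$ of $G$, $G+(ab,cd)$ deletes $ab,cd$ and adds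 new vertices $x,y$ and edges $xa,xb,yc,yd,xy$. Edges $ab,cd$ are diverse in $G$ if $a,b,c,d$ are distinct and neither of $a,b$ is adjacent to $c$ or $d$. A hop extension of $(G,F)$ is $G+(e,f)$ where $e,f\in E(G)\setminus E(F)$, at most one of $e,f$ has an end in $V(F)$, and no region (face) of $G$ is incident with both $e$ and $f$; a jump extension is a hop extension with $e,f$ diverse in $G$. *)

theory Defs
  imports Main
begin

section \<open>Finite simple graphs\<close>

record 'a ugraph =
  verts :: "'a set"
  edges :: "'a set set"

definition simple_graph :: "'a ugraph \<Rightarrow> bool" where
  "simple_graph G \<longleftrightarrow> finite (verts G) \<and> (\<forall>e\<in>edges G. e \<subseteq> verts G \<and> card e = 2)"

definition subgraph :: "'a ugraph \<Rightarrow> 'a ugraph \<Rightarrow> bool" where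
  "subgraph F G \<longleftrightarrow> verts F \<subseteq> verts G \<and> edges F \<subseteq> edges G"

definition cubic :: "'a ugraph \<Rightarrow> bool" where
  "cubic G \<longleftrightarrow> (\<forall>v\<in>verts G. card {e \<in> edges G. v \<in> e} = 3)"

definition edge_cut :: "'a ugraph \<Rightarrow> 'a set \<Rightarrow> 'a set set" where
  "edge_cut G X = {e \<in> edges G. card (e \<inter> X) = 1}"

definition path_graph :: "'a list \<Rightarrow> 'a ugraph" where
  "path_graph vs = \<lparr>verts = set vs, edges = {{u, v} |u v. (u, v) \<in> set (zip vs (tl vs))}\<rparr>"

definition circuit_graph :: "'a list \<Rightarrow> 'a ugraph" where
  "circuit_graph vs = \<lparr>verts = set vs, edges = {{u, v} |u v. (u, v) \<in> set (zip vs (rotate1 vs))}\<rparr>"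

text \<open>Paths and circuits are graphs, without a chosen orientation or starting vertex.\<close>

definition path_between :: "'a ugraph \<Rightarrow> 'a \<Rightarrow> 'a \<Rightarrow> bool" where
  "path_between P u v \<longleftrightarrow>
     (\<exists>vs. vs \<noteq> [] \<and> distinct vs \<and> hd vs = u \<and> last vs = v \<and> P = path_graph vs)"

definition circuit_of_length :: "'a ugraph \<Rightarrow> nat \<Rightarrow> bool" where
  "circuit_of_length C n \<longleftrightarrow>
     (\<exists>vs. distinct vs \<and> length vs = n \<and> 3 \<le> n \<and> C = circuit_graph vs)"

definition circuit :: "'a ugraph \<Rightarrow> bool" where
  "circuit C \<longleftrightarrow> (\<exists>n. circuit_of_length C n)"

definition girth_at_least :: "nat \<Rightarrow> 'a ugraph \<Rightarrow> bool" where
  "girth_at_least k G \<longleftrightarrow> (\<forall>C n. circuit_of_length C n \<and> subgraph C G \<longrightarrow> k \<le> n)"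

definition cyclically_connected :: "nat \<Rightarrow> 'a ugraph \<Rightarrow> bool" where
  "cyclically_connected k G \<longleftrightarrow>
     girth_at_least k G \<and>
     (\<forall>X \<subseteq> verts G.
        (\<exists>C. circuit C \<and> subgraph C G \<and> verts C \<subseteq> X) \<and>
        (\<exists>C. circuit C \<and> subgraph C G \<and> verts C \<subseteq> verts G - X)
        \<longrightarrow> k \<le> card (edge_cut G X))"

definition graph_iso :: "('a \<Rightarrow> 'b) \<Rightarrow> 'a ugraph \<Rightarrow> 'b ugraph \<Rightarrow> bool" where
  "graph_iso \<phi> G H \<longleftrightarrow>
     bij_betw \<phi> (verts G) (verts H) \<and> edges H = (\<lambda>e. \<phi> ` e) ` edges G"


section \<open>Homeomorphic embeddings\<close>

text \<open>An embedding is a pair: \<open>\<eta>\<close> acts on vertices, \<open>\<pi>\<close> sends edges to paths.\<close>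

definition homeo_embedding ::
  "('a \<Rightarrow> 'b) \<Rightarrow> ('a set \<Rightarrow> 'b ugraph) \<Rightarrow> 'a ugraph \<Rightarrow> 'b ugraph \<Rightarrow> bool" where
  "homeo_embedding \<eta> \<pi> G H \<longleftrightarrow>
     \<eta> ` verts G \<subseteq> verts H \<and> inj_on \<eta> (verts G) \<and>
     (\<forall>u v. {u, v} \<in> edges G \<longrightarrow>
        subgraph (\<pi> {u, v}) H \<and> path_between (\<pi> {u, v}) (\<eta> u) (\<eta> v)) \<and>
     (\<forall>e1\<in>edges G. \<forall>e2\<in>edges G. e1 \<noteq> e2 \<longrightarrow>
        edges (\<pi> e1) \<inter> edges (\<pi> e2) = {} \<and>
        (verts (\<pi> e1) - \<eta> ` e1) \<inter> verts (\<pi> e2) = {}) \<and>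
     (\<forall>v\<in>verts G. \<forall>e\<in>edges G. \<eta> v \<in> verts (\<pi> e) \<longleftrightarrow> v \<in> e)"

definition fixes_subgraph ::
  "('a \<Rightarrow> 'a) \<Rightarrow> ('a set \<Rightarrow> 'a ugraph) \<Rightarrow> 'a ugraph \<Rightarrow> bool" where
  "fixes_subgraph \<eta> \<pi> F \<longleftrightarrow>
     (\<forall>v\<in>verts F. \<eta> v = v) \<and>
     (\<forall>e\<in>edges F. \<pi> e = \<lparr>verts = e, edges = {e}\<rparr>)"

text \<open>\<open>F_contains H F G'\<close> is meant for \<open>F\<close> a subgraph of both \<open>G'\<close> and \<open>H\<close>.\<close>

definition F_contains :: "'a ugraph \<Rightarrow> 'a ugraph \<Rightarrow> 'a ugraph \<Rightarrow> bool" where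
  "F_contains H F G' \<longleftrightarrow> (\<exists>\<eta> \<pi>. homeo_embedding \<eta> \<pi> G' H \<and> fixes_subgraph \<eta> \<pi> F)"


section \<open>The dodecahedron\<close>

text \<open>The twelve pentagons, as cyclic lists of vertices. The vertices lie on four rings
  \<open>0..4\<close>, \<open>5..9\<close>, \<open>10..14\<close>, \<open>15..19\<close> around the axis through the centres of two opposite
  faces: the top face, five faces below it, five more below those, and the bottom face.\<close>

definition dodecahedron_faces :: "nat list list" where
  "dodecahedron_faces =
    [[0, 1, 2, 3, 4],
     [0, 1, 6, 10, 5], [1, 2, 7, 11, 6], [2, 3, 8, 12, 7], [3, 4, 9, 13, 8], [4, 0, 5, 14, 9],
     [10, 6, 11, 16, 15], [11, 7, 12, 17, 16], [12, 8, 13, 18, 17], [13, 9, 14, 19, 18],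
       [14, 5, 10, 15, 19],
     [15, 16, 17, 18, 19]]"

definition dodecahedron :: "nat ugraph" where
  "dodecahedron =
     \<lparr>verts = {..<20}, edges = (\<Union>f\<in>set dodecahedron_faces. edges (circuit_graph f))\<rparr>"

definition dodecahedron_graph :: "'a ugraph \<Rightarrow> bool" where
  "dodecahedron_graph G \<longleftrightarrow> (\<exists>\<phi>. graph_iso \<phi> dodecahedron G)"

text \<open>A region is represented by the circuit bounding it, and is incident with the edges of
  that circuit. The choice of \<open>\<phi>\<close> does not matter, since the planar embedding is unique:
  all isomorphisms yield the same twelve circuits.\<close>

definition dodecahedron_regions :: "'a ugraph \<Rightarrow> 'a ugraph set" where
  "dodecahedron_regions G =
     {circuit_graph (map \<phi> f) |\<phi> f. graph_iso \<phi> dodecahedron G \<and> f \<in> set dodecahedron_faces}"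


section \<open>Hop and jump extensions\<close>

text \<open>The graph \<open>G + (e, f)\<close>, with the two new vertices \<open>x\<close> and \<open>y\<close> made explicit.\<close>

definition plus_edges :: "'a ugraph \<Rightarrow> 'a set \<Rightarrow> 'a set \<Rightarrow> 'a \<Rightarrow> 'a \<Rightarrow> 'a ugraph" where
  "plus_edges G e f x y =
     \<lparr>verts = verts G \<union> {x, y},
      edges = (edges G - {e, f}) \<union> {{x, v} |v. v \<in> e} \<union> {{y, v} |v. v \<in> f} \<union> {{x, y}}\<rparr>"

definition diverse :: "'a ugraph \<Rightarrow> 'a set \<Rightarrow> 'a set \<Rightarrow> bool" where
  "diverse G e f \<longleftrightarrow>
     (\<exists>a b c d. e = {a, b} \<and> f = {c, d} \<and> distinct [a, b, c, d] \<and>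
        {a, c} \<notin> edges G \<and> {a, d} \<notin> edges G \<and> {b, c} \<notin> edges G \<and> {b, d} \<notin> edges G)"

definition hop_pair :: "'a ugraph \<Rightarrow> 'a ugraph \<Rightarrow> 'a set \<Rightarrow> 'a set \<Rightarrow> bool" where
  "hop_pair G F e f \<longleftrightarrow>
     e \<in> edges G - edges F \<and> f \<in> edges G - edges F \<and> e \<noteq> f \<and>
     \<not> (e \<inter> verts F \<noteq> {} \<and> f \<inter> verts F \<noteq> {}) \<and>
     \<not> (\<exists>R\<in>dodecahedron_regions G. e \<in> edges R \<and> f \<in> edges R)"

text \<open>For \<open>G\<close> a dodecahedron graph. All choices of the new vertices are allowed. The vertex type
  is arbitrary; if it is too small to supply two new vertices, it has at most 21 elements and no
  graph over it contains any 22-vertex extension anyway.\<close>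

definition hop_extension :: "'a ugraph \<Rightarrow> 'a ugraph \<Rightarrow> 'a ugraph \<Rightarrow> bool" where
  "hop_extension G F G' \<longleftrightarrow>
     (\<exists>e f x y. hop_pair G F e f \<and>
        x \<notin> verts G \<and> y \<notin> verts G \<and> x \<noteq> y \<and> G' = plus_edges G e f x y)"

definition jump_extension :: "'a ugraph \<Rightarrow> 'a ugraph \<Rightarrow> 'a ugraph \<Rightarrow> bool" where
  "jump_extension G F G' \<longleftrightarrow>
     (\<exists>e f x y. hop_pair G F e f \<and> diverse G e f \<and>
        x \<notin> verts G \<and> y \<notin> verts G \<and> x \<noteq> y \<and> G' = plus_edges G e f x y)"

end

theory Submission
  imports Defs "HOL-Library.Multiset"
begin

text \<open>A hop extension that is not a jump extension comes from a path \<open>a b c d\<close> whose end edges are joined by a new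
  edge \<open>x y\<close>; it contains the four-cycle \<open>x b c y\<close>. By cyclic five-connectivity there is a way out of the
  image of this four-cycle in \<open>H\<close> besides its four legs. Take a connected piece \<open>B\<close> of \<open>H\<close> that contains the
  four-cycle and is attached to the image of the rest \<open>K\<close> of the dodecahedron by four disjoint legs, such that
  every further edge leaving \<open>B\<close> starts at the fifth leg of a pentagon in \<open>B\<close>, its other legs being the
  old ones in the old cyclic order. This property survives when \<open>B\<close> absorbs a neighbour or a
  stretch of one of its legs. So \<open>B\<close> can grow until an edge leads from it to \<open>K\<close>, necessarily to an
  inner vertex of the image of an edge of \<open>K\<close> outside \<open>F\<close>. All graphs on 24 vertices that arise in this way
  contain a jump extension, obtained by deleting one edge, which is checked by computation.\<close>

section \<open>Walks and pentagons with legs\<close>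

text \<open>The sides of the four-cycle may be long paths in \<open>H\<close>, so the girth bound
  does not exclude it; what is used is the cut bound, with the four-cycle on one side and
  \<open>F\<close> on the other. It applies because \<open>F\<close> misses \<open>b\<close> and
  \<open>c\<close>: the edges of a hop lie outside \<open>F\<close>, and at most one of them meets
  \<open>F\<close>. The cut yields a fifth way out but no control over where it leads. Hence the
  invariant speaks about every way out and remembers little: only the gap in the cyclic order of the
  four old legs where the fifth leg sits, and at the end the edge of \<open>K\<close> that is hit. A
  branch vertex of \<open>K\<close> cannot be hit, since its three neighbours are already accounted
  for. With 4 gaps and 25 edges of \<open>K\<close>, there remain 100 cubic graphs to inspect.
  Deleting an edge and suppressing its ends brings 24 vertices down to 22, the size of a jump
  extension. But the vertices and edges of \<open>F\<close> have to keep their places, so which edge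
  is deleted may depend on which face \<open>F\<close> is.\<close>

definition walk :: "'a ugraph \<Rightarrow> 'a list \<Rightarrow> bool" where
  "walk H = successively (\<lambda>u v. {u, v} \<in> edges H)"

lemma walk_simps [simp]:
  "walk H []" "walk H [u]" "walk H (u # v # vs) \<longleftrightarrow> {u, v} \<in> edges H \<and> walk H (v # vs)"
  by (auto simp: walk_def)

lemma walk_append:
  "walk H (us @ vs) \<longleftrightarrow> walk H us \<and> walk H vs \<and> (us = [] \<or> vs = [] \<or> {last us, hd vs} \<in> edges H)"
  by (auto simp: walk_def successively_append_iff)

lemma walk_Cons:
  "walk H (u # vs) \<longleftrightarrow> vs = [] \<or> {u, hd vs} \<in> edges H \<and> walk H vs"
  by (cases vs) auto

lemma walk_rev [simp]: "walk H (rev vs) \<longleftrightarrow> walk H vs"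
  by (simp add: walk_def successively_rev insert_commute)

lemma walk_join_hd: "walk H (xs @ [hd ys]) \<Longrightarrow> walk H ys \<Longrightarrow> walk H (xs @ ys)"
  by (cases ys) (auto simp: walk_append)

lemma walk_join_last: "walk H xs \<Longrightarrow> walk H (last xs # ys) \<Longrightarrow> xs \<noteq> [] \<Longrightarrow> walk H (xs @ ys)"
  by (auto simp: walk_append walk_Cons)

lemma walk_appendD: "walk H (xs @ ys) \<Longrightarrow> walk H xs" "walk H (xs @ ys) \<Longrightarrow> walk H ys"
  by (auto simp: walk_append)

text \<open>A subdivided pentagon with corners \<open>hd L1\<close>, ..., \<open>hd L5\<close>. The
  sides \<open>S1\<close>, ..., \<open>S5\<close> exclude the corners and the legs
  \<open>L1\<close>, ..., \<open>L5\<close> include them, so that one distinctness condition on ten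
  lists says everything. A leg may be a bare corner.\<close>

definition pent_on where
  "pent_on H S1 S2 S3 S4 S5 L1 L2 L3 L4 L5 \<longleftrightarrow>
     L1 \<noteq> [] \<and> L2 \<noteq> [] \<and> L3 \<noteq> [] \<and> L4 \<noteq> [] \<and> L5 \<noteq> [] \<and>
     walk H L1 \<and> walk H L2 \<and> walk H L3 \<and> walk H L4 \<and> walk H L5 \<and>
     walk H (hd L1 # S1 @ [hd L2]) \<and> walk H (hd L2 # S2 @ [hd L3]) \<and>
     walk H (hd L3 # S3 @ [hd L4]) \<and> walk H (hd L4 # S4 @ [hd L5]) \<and>
     walk H (hd L5 # S5 @ [hd L1]) \<and>
     distinct (S1 @ S2 @ S3 @ S4 @ S5 @ L1 @ L2 @ L3 @ L4 @ L5)"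

definition pent :: "'a ugraph \<Rightarrow> 'a set \<Rightarrow> 'a \<Rightarrow> 'a \<Rightarrow> 'a \<Rightarrow> 'a \<Rightarrow> 'a \<Rightarrow> bool" where
  "pent H B s1 s2 s3 s4 s5 \<longleftrightarrow> (\<exists>S1 S2 S3 S4 S5 L1 L2 L3 L4 L5.
     pent_on H S1 S2 S3 S4 S5 L1 L2 L3 L4 L5 \<and>
     last L1 = s1 \<and> last L2 = s2 \<and> last L3 = s3 \<and> last L4 = s4 \<and> last L5 = s5 \<and>
     set (S1 @ S2 @ S3 @ S4 @ S5 @ L1 @ L2 @ L3 @ L4 @ L5) \<subseteq> B)"

lemma pentI:
  assumes "pent_on H S1 S2 S3 S4 S5 L1 L2 L3 L4 L5"
    "last L1 = s1" "last L2 = s2" "last L3 = s3" "last L4 = s4" "last L5 = s5"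
    "set (S1 @ S2 @ S3 @ S4 @ S5 @ L1 @ L2 @ L3 @ L4 @ L5) \<subseteq> B"
  shows "pent H B s1 s2 s3 s4 s5"
  using assms unfolding pent_def by blast

lemma pentE:
  assumes "pent H B s1 s2 s3 s4 s5"
  obtains S1 S2 S3 S4 S5 L1 L2 L3 L4 L5 where
    "pent_on H S1 S2 S3 S4 S5 L1 L2 L3 L4 L5"
    "last L1 = s1" "last L2 = s2" "last L3 = s3" "last L4 = s4" "last L5 = s5"
    "set (S1 @ S2 @ S3 @ S4 @ S5 @ L1 @ L2 @ L3 @ L4 @ L5) \<subseteq> B"
  using assms unfolding pent_def by blast

lemma distinct_mset_cong: "mset xs = mset ys \<Longrightarrow> distinct ys \<Longrightarrow> distinct xs"
  using mset_eq_imp_distinct_iff by blast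

lemma walk_rev_ends: "walk H (v # rev xs @ [u]) \<longleftrightarrow> walk H (u # xs @ [v])"
  using walk_rev[of H "u # xs @ [v]"] by simp

lemma pent_rotate:
  assumes "pent H B s1 s2 s3 s4 s5"
  shows "pent H B s2 s3 s4 s5 s1"
  using assms
proof (rule pentE)
  fix S1 S2 S3 S4 S5 L1 L2 L3 L4 L5
  assume P: "pent_on H S1 S2 S3 S4 S5 L1 L2 L3 L4 L5"
    and l: "last L1 = s1" "last L2 = s2" "last L3 = s3" "last L4 = s4" "last L5 = s5"
    and sub: "set (S1 @ S2 @ S3 @ S4 @ S5 @ L1 @ L2 @ L3 @ L4 @ L5) \<subseteq> B"
  have m: "mset (S2 @ S3 @ S4 @ S5 @ S1 @ L2 @ L3 @ L4 @ L5 @ L1)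
    = mset (S1 @ S2 @ S3 @ S4 @ S5 @ L1 @ L2 @ L3 @ L4 @ L5)"
    by (simp add: ac_simps)
  show ?thesis
  proof (rule pentI)
    show "pent_on H S2 S3 S4 S5 S1 L2 L3 L4 L5 L1"
      using P distinct_mset_cong[OF m] unfolding pent_on_def by blast
  qed (use l sub mset_eq_setD[OF m] in blast)+
qed

text \<open>Together with rotation, this gives all dihedral readings of a pentagon. It reduces the
  swap of legs below to two relative positions of \<open>a\<close> and \<open>v\<close>.\<close>

lemma pent_reflect:
  assumes "pent H B s1 s2 s3 s4 s5"
  shows "pent H B s1 s5 s4 s3 s2"
  using assms
proof (rule pentE)
  fix S1 S2 S3 S4 S5 L1 L2 L3 L4 L5
  assume P: "pent_on H S1 S2 S3 S4 S5 L1 L2 L3 L4 L5"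
    and l: "last L1 = s1" "last L2 = s2" "last L3 = s3" "last L4 = s4" "last L5 = s5"
    and sub: "set (S1 @ S2 @ S3 @ S4 @ S5 @ L1 @ L2 @ L3 @ L4 @ L5) \<subseteq> B"
  have m: "mset (rev S5 @ rev S4 @ rev S3 @ rev S2 @ rev S1 @ L1 @ L5 @ L4 @ L3 @ L2)
    = mset (S1 @ S2 @ S3 @ S4 @ S5 @ L1 @ L2 @ L3 @ L4 @ L5)"
    by (simp add: ac_simps)
  show ?thesis
  proof (rule pentI)
    show "pent_on H (rev S5) (rev S4) (rev S3) (rev S2) (rev S1) L1 L5 L4 L3 L2"
      using P distinct_mset_cong[OF m] unfolding pent_on_def walk_rev_ends by blast
  qed (use l sub mset_eq_setD[OF m] in blast)+
qed

lemma pent_mono: "pent H B s1 s2 s3 s4 s5 \<Longrightarrow> B \<subseteq> B' \<Longrightarrow> pent H B' s1 s2 s3 s4 s5"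
  unfolding pent_def by (elim exE conjE) (intro exI conjI, assumption+, rule subset_trans)

lemma pent_distinct: "pent H B s1 s2 s3 s4 s5 \<Longrightarrow> distinct [s1, s2, s3, s4, s5]"
  by (erule pentE) (auto simp: pent_on_def dest!: last_in_set)

lemma pent_extend:
  assumes "pent H B s1 s2 s3 s4 s5" and R: "walk H (s1 # R)" "distinct R" "set R \<inter> B = {}"
  shows "pent H (B \<union> set R) (last (s1 # R)) s2 s3 s4 s5"
  using assms(1)
proof (rule pentE)
  fix S1 S2 S3 S4 S5 L1 L2 L3 L4 L5
  assume P: "pent_on H S1 S2 S3 S4 S5 L1 L2 L3 L4 L5"
    and l: "last L1 = s1" "last L2 = s2" "last L3 = s3" "last L4 = s4" "last L5 = s5"
    and sub: "set (S1 @ S2 @ S3 @ S4 @ S5 @ L1 @ L2 @ L3 @ L4 @ L5) \<subseteq> B"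
  let ?T = "S1 @ S2 @ S3 @ S4 @ S5 @ L1 @ L2 @ L3 @ L4 @ L5"
  have m: "mset (S1 @ S2 @ S3 @ S4 @ S5 @ (L1 @ R) @ L2 @ L3 @ L4 @ L5) = mset (?T @ R)"
    by (simp add: ac_simps)
  have "distinct ?T" using P by (simp only: pent_on_def)
  then have d: "distinct (?T @ R)"
    unfolding distinct_append[of ?T R] using R(2,3) sub by blast
  have L1: "L1 \<noteq> []" "walk H L1" using P by (simp_all add: pent_on_def)
  show ?thesis
  proof (rule pentI)
    have "walk H (L1 @ R)" "hd (L1 @ R) = hd L1" "L1 @ R \<noteq> []"
      using L1 R(1) l(1) by (auto simp: walk_append walk_Cons)
    then show "pent_on H S1 S2 S3 S4 S5 (L1 @ R) L2 L3 L4 L5"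
      using P distinct_mset_cong[OF m d] unfolding pent_on_def by argo
    show "last (L1 @ R) = last (s1 # R)" using L1 l by simp
    have "set ?T \<union> set R \<subseteq> B \<union> set R" using sub by blast
    then show "set (S1 @ S2 @ S3 @ S4 @ S5 @ (L1 @ R) @ L2 @ L3 @ L4 @ L5) \<subseteq> B \<union> set R"
      using mset_eq_setD[OF m] by simp
  qed (use l in blast)+
qed

text \<open>The leg ending in \<open>a\<close> is extended to \<open>u\<close>, and the leg ending in \<open>v\<close> is joined to \<open>u\<close> by an edge. To
  attach the inner vertex \<open>z\<close> of the extension, the pentagon is rerouted through the edge \<open>v u\<close>; the
  old pentagon segment that becomes superfluous depends on whether \<open>a\<close> is next to \<open>v\<close> in the cyclic order.\<close>

lemma pent_swap_adjacent:
  assumes "pent H B v b c d a" and w: "walk H (a # g1 @ z # g2 @ [u])" and vu: "{v, u} \<in> edges H"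
    and R: "distinct (g1 @ z # g2 @ [u])" "set (g1 @ z # g2 @ [u]) \<inter> B = {}"
  shows "pent H (B \<union> set (g1 @ z # g2 @ [u])) z u b c d"
  using assms(1)
proof (rule pentE)
  fix S1 S2 S3 S4 S5 L1 L2 L3 L4 L5
  assume P: "pent_on H S1 S2 S3 S4 S5 L1 L2 L3 L4 L5"
    and l: "last L1 = v" "last L2 = b" "last L3 = c" "last L4 = d" "last L5 = a"
    and sub: "set (S1 @ S2 @ S3 @ S4 @ S5 @ L1 @ L2 @ L3 @ L4 @ L5) \<subseteq> B"
  let ?T = "S1 @ S2 @ S3 @ S4 @ S5 @ L1 @ L2 @ L3 @ L4 @ L5" and ?R = "g1 @ z # g2 @ [u]"
  have m: "mset ((g2 @ (rev L1 @ S1) @ S2 @ S3 @ (S4 @ L5 @ g1) @ [z] @ [u] @ L2 @ L3 @ L4) @ S5) = mset (?T @ ?R)"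
    by (simp add: ac_simps)
  have "distinct ?T" using P by (simp only: pent_on_def)
  then have d: "distinct (?T @ ?R)"
    unfolding distinct_append[of ?T ?R] using R sub by blast
  have D: "distinct (g2 @ (rev L1 @ S1) @ S2 @ S3 @ (S4 @ L5 @ g1) @ [z] @ [u] @ L2 @ L3 @ L4)"
    using distinct_mset_cong[OF m d] unfolding distinct_append[of _ S5] by blast
  have n: "L1 \<noteq> []" "walk H L1" "walk H (hd L1 # S1 @ [hd L2])"
    "L5 \<noteq> []" "walk H L5" "walk H (hd L4 # S4 @ [hd L5])"
    using P by (simp_all add: pent_on_def)
  have "walk H (u # (rev L1 @ S1) @ [hd L2])"
    using n(1-3) l(1) vu by (simp add: walk_append walk_Cons insert_commute last_rev hd_rev)
  moreover have "walk H (hd L4 # (S4 @ L5 @ g1) @ [z])"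
  proof -
    have "walk H ((hd L4 # S4) @ L5)" using walk_join_hd[of H "hd L4 # S4" L5] n(5,6) by simp
    moreover have "walk H (last L5 # g1 @ [z])"
      using walk_appendD(1)[of H "a # g1 @ [z]" "g2 @ [u]"] w l(5) by simp
    ultimately show ?thesis using walk_join_last[of H "(hd L4 # S4) @ L5" "g1 @ [z]"] n(4) by simp
  qed
  moreover have "walk H (z # g2 @ [u])"
    using w by (simp add: walk_append walk_Cons)
  moreover have "[z] \<noteq> []" "[u] \<noteq> []" "walk H [z]" "walk H [u]" "hd [z] = z" "hd [u] = u" by simp_all
  \<comment> \<open>The new corners are \<open>z\<close>, \<open>u\<close>, \<open>hd L2\<close>,
    \<open>hd L3\<close>, \<open>hd L4\<close>. Leg \<open>L1\<close> is walked inwards as part of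
    the side from \<open>u\<close> to \<open>hd L2\<close>, and \<open>L5\<close> with
    \<open>g1\<close> becomes part of the side ending in \<open>z\<close>. The side
    \<open>S5\<close> between these two legs is dropped.\<close>
  ultimately have Q: "pent_on H g2 (rev L1 @ S1) S2 S3 (S4 @ L5 @ g1) [z] [u] L2 L3 L4"
    using P D unfolding pent_on_def by (simp only: list.sel list.distinct simp_thms)
  have "set ?T \<union> set ?R \<subseteq> B \<union> set ?R" using sub by blast
  then have "set (g2 @ (rev L1 @ S1) @ S2 @ S3 @ (S4 @ L5 @ g1) @ [z] @ [u] @ L2 @ L3 @ L4) \<subseteq> B \<union> set ?R"
    using mset_eq_setD[OF m] unfolding set_append[of ?T ?R] set_append[of _ S5] by blast
  then show ?thesis
    by (rule pentI[OF Q, rotated 5]) (use l in simp_all)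
qed

lemma pent_swap_opposite:
  assumes "pent H B v c d a b" and w: "walk H (a # g1 @ z # g2 @ [u])" and vu: "{v, u} \<in> edges H"
    and R: "distinct (g1 @ z # g2 @ [u])" "set (g1 @ z # g2 @ [u]) \<inter> B = {}"
  shows "pent H (B \<union> set (g1 @ z # g2 @ [u])) z u b c d"
  using assms(1)
proof (rule pentE)
  fix S1 S2 S3 S4 S5 L1 L2 L3 L4 L5
  assume P: "pent_on H S1 S2 S3 S4 S5 L1 L2 L3 L4 L5"
    and l: "last L1 = v" "last L2 = c" "last L3 = d" "last L4 = a" "last L5 = b"
    and sub: "set (S1 @ S2 @ S3 @ S4 @ S5 @ L1 @ L2 @ L3 @ L4 @ L5) \<subseteq> B"
  let ?T = "S1 @ S2 @ S3 @ S4 @ S5 @ L1 @ L2 @ L3 @ L4 @ L5" and ?R = "g1 @ z # g2 @ [u]"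
  have n: "L1 \<noteq> []" "walk H L1" "walk H (hd L3 # S3 @ [hd L4])"
    "L4 \<noteq> []" "walk H L4" "L5 \<noteq> []" "walk H L5" "walk H (hd L5 # S5 @ [hd L1])"
    using P by (simp_all add: pent_on_def)
  have L1: "L1 = hd L1 # tl L1" using n(1) by simp
  have "mset L1 = mset (rev (tl L1)) + mset [hd L1]" by (subst L1) simp
  then have m: "mset ((g2 @ rev (tl L1) @ S1 @ S2 @ (S3 @ L4 @ g1) @ [z] @ [u] @ (hd L1 # rev S5 @ L5) @ L2 @ L3) @ S4)
      = mset (?T @ ?R)"
    by (simp add: ac_simps)
  have "distinct ?T" using P by (simp only: pent_on_def)
  then have d: "distinct (?T @ ?R)"
    unfolding distinct_append[of ?T ?R] using R sub by blast
  have D: "distinct (g2 @ rev (tl L1) @ S1 @ S2 @ (S3 @ L4 @ g1) @ [z] @ [u] @ (hd L1 # rev S5 @ L5) @ L2 @ L3)"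
    using distinct_mset_cong[OF m d] unfolding distinct_append[of _ S4] by blast
  have "rev (tl L1) @ [hd L1] = rev L1" using n(1) by (cases L1) auto
  then have "walk H (u # rev (tl L1) @ [hd L1])"
    using n(1,2) l(1) vu by (simp add: walk_Cons insert_commute hd_rev)
  moreover have "walk H (hd L1 # rev S5 @ L5)"
    using walk_join_hd[of H "hd L1 # rev S5" L5] n(7,8) by (simp add: walk_rev_ends)
  moreover have "walk H (hd L3 # (S3 @ L4 @ g1) @ [z])"
  proof -
    have "walk H ((hd L3 # S3) @ L4)" using walk_join_hd[of H "hd L3 # S3" L4] n(3,5) by simp
    moreover have "walk H (last L4 # g1 @ [z])"
      using walk_appendD(1)[of H "a # g1 @ [z]" "g2 @ [u]"] w l(4) by simp
    ultimately show ?thesis using walk_join_last[of H "(hd L3 # S3) @ L4" "g1 @ [z]"] n(4) by simp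
  qed
  moreover have "walk H (z # g2 @ [u])"
    using w by (simp add: walk_append walk_Cons)
  moreover have "[z] \<noteq> []" "[u] \<noteq> []" "walk H [z]" "walk H [u]" "hd [z] = z" "hd [u] = u" by simp_all
  \<comment> \<open>Here \<open>hd L1\<close> stays a corner: \<open>L1\<close> is walked inwards as
    the side from \<open>u\<close>, and the new leg to \<open>b\<close> starts at
    \<open>hd L1\<close>, runs back along \<open>S5\<close> and then along \<open>L5\<close>. The
    side dropped is \<open>S4\<close>, between the legs to \<open>a\<close> and
    \<open>b\<close>.\<close>
  ultimately have Q: "pent_on H g2 (rev (tl L1)) S1 S2 (S3 @ L4 @ g1) [z] [u] (hd L1 # rev S5 @ L5) L2 L3"
    using P D unfolding pent_on_def by (simp only: list.sel list.distinct simp_thms)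
  have "set ?T \<union> set ?R \<subseteq> B \<union> set ?R" using sub by blast
  then have "set (g2 @ rev (tl L1) @ S1 @ S2 @ (S3 @ L4 @ g1) @ [z] @ [u] @ (hd L1 # rev S5 @ L5) @ L2 @ L3) \<subseteq> B \<union> set ?R"
    using mset_eq_setD[OF m] unfolding set_append[of ?T ?R] set_append[of _ S4] by blast
  then show ?thesis
    by (rule pentI[OF Q, rotated 5]) (use l n in simp_all)
qed

section \<open>Leaving a four-cycle\<close>

text \<open>The disjuncts are the four gaps of the cyclic order \<open>a b c d\<close> in which the
  fifth leg, ending in \<open>v\<close>, can sit.\<close>

definition pent_at :: "'a ugraph \<Rightarrow> 'a set \<Rightarrow> 'a \<Rightarrow> 'a \<Rightarrow> 'a \<Rightarrow> 'a \<Rightarrow> 'a \<Rightarrow> bool" where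
  "pent_at H B a b c d v \<longleftrightarrow>
     pent H B v a b c d \<or> pent H B v b c d a \<or> pent H B v c d a b \<or> pent H B v d a b c"

lemma pent_at_rotate: "pent_at H B a b c d v \<Longrightarrow> pent_at H B b c d a v"
  by (auto simp: pent_at_def)

lemma pent_at_mono: "pent_at H B a b c d v \<Longrightarrow> B \<subseteq> B' \<Longrightarrow> pent_at H B' a b c d v"
  unfolding pent_at_def using pent_mono[of H B _ _ _ _ _ B'] by blast

lemma pent_at_distinct: "pent_at H B a b c d v \<Longrightarrow> v \<notin> {a, b, c, d}"
  unfolding pent_at_def using pent_distinct[of H B] by fastforce

lemma pent_at_extend:
  assumes "pent_at H B a b c d v" and R: "walk H (a # R)" "distinct R" "set R \<inter> B = {}"
  shows "pent_at H (B \<union> set R) (last (a # R)) b c d v"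
proof -
  note ext = pent_extend[OF _ R] and rot = pent_rotate[of H "B \<union> set R"] and rot' = pent_rotate[of H B]
  from assms(1) consider "pent H B v a b c d" | "pent H B v b c d a" | "pent H B v c d a b" | "pent H B v d a b c"
    unfolding pent_at_def by blast
  then show ?thesis
  proof cases
    case 1
    then show ?thesis using rot[OF rot[OF rot[OF rot[OF ext[OF rot']]]]] unfolding pent_at_def by blast
  next
    case 2
    then show ?thesis using rot[OF ext[OF rot'[OF rot'[OF rot'[OF rot']]]]] unfolding pent_at_def by blast
  next
    case 3
    then show ?thesis using rot[OF rot[OF ext[OF rot'[OF rot'[OF rot']]]]] unfolding pent_at_def by blast
  next
    case 4
    then show ?thesis using rot[OF rot[OF rot[OF ext[OF rot'[OF rot']]]]] unfolding pent_at_def by blast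
  qed
qed

lemma pent_at_extend_source:
  assumes "pent_at H B a b c d v" "{v, u} \<in> edges H" "u \<notin> B"
  shows "pent_at H (insert u B) a b c d u"
  using assms pent_extend[of H B v _ _ _ _ "[u]"] unfolding pent_at_def by auto

text \<open>Whatever gap \<open>v\<close> was in, the new fifth leg \<open>z\<close> lands in one of
  the two gaps beside \<open>u\<close>, and \<open>u\<close> takes the place of \<open>a\<close>.
  Two of the four positions of \<open>v\<close> are mirror images of the other two.\<close>

lemma pent_at_swap:
  assumes "pent_at H B a b c d v" and R: "walk H (a # g1 @ z # g2 @ [u])" "{v, u} \<in> edges H"
    "distinct (g1 @ z # g2 @ [u])" "set (g1 @ z # g2 @ [u]) \<inter> B = {}"
  shows "pent_at H (B \<union> set (g1 @ z # g2 @ [u])) u b c d z"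
proof -
  from assms(1) consider "pent H B v a b c d" | "pent H B v b c d a" | "pent H B v c d a b" | "pent H B v d a b c"
    unfolding pent_at_def by blast
  then show ?thesis
  proof cases
    case 1
    then show ?thesis using pent_reflect[OF pent_swap_adjacent[OF pent_reflect[OF 1] R]] unfolding pent_at_def by blast
  next
    case 2
    then show ?thesis using pent_swap_adjacent[OF 2 R] unfolding pent_at_def by blast
  next
    case 3
    then show ?thesis using pent_swap_opposite[OF 3 R] unfolding pent_at_def by blast
  next
    case 4
    then show ?thesis using pent_reflect[OF pent_swap_opposite[OF pent_reflect[OF 4] R]] unfolding pent_at_def by blast
  qed
qed

lemma walk_last_edge: "walk H (a # R @ [k]) \<Longrightarrow> walk H (a # R) \<and> {last (a # R), k} \<in> edges H"
  using walk_append[of H "a # R" "[k]"] by simp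

lemma cubic_neighbours:
  assumes "cubic H" "u \<in> verts H" "{u, x} \<in> edges H" "{u, y} \<in> edges H" "{u, z} \<in> edges H"
    and "x \<noteq> y" "x \<noteq> z" "y \<noteq> z" and "{u, w} \<in> edges H"
  shows "w \<in> {x, y, z}"
proof -
  let ?E = "{e \<in> edges H. u \<in> e}"
  have "card ?E = 3" using assms(1,2) unfolding cubic_def by blast
  moreover have "card {{u, x}, {u, y}, {u, z}} = 3"
    using assms(6-8) by (auto simp: card_insert_if doubleton_eq_iff)
  moreover have "{{u, x}, {u, y}, {u, z}} \<subseteq> ?E" using assms(3-5) by auto
  moreover have "finite ?E" using \<open>card ?E = 3\<close> by (intro card_ge_0_finite) simp
  ultimately have eq: "{{u, x}, {u, y}, {u, z}} = ?E" by (intro card_subset_eq) simp_all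
  have "{u, w} \<in> {{u, x}, {u, y}, {u, z}}" unfolding eq using assms(9) by simp
  then show ?thesis by (auto simp: doubleton_eq_iff)
qed

section \<open>The growing piece and its invariant\<close>

text \<open>The edges by which the old legs leave the piece, written from the inside out. For an
  empty leg the step ends in the core at once.\<close>

definition first_steps where
  "first_steps a Ra ka b Rb kb c Rc kc d Rd kd =
     {(a, hd (Ra @ [ka])), (b, hd (Rb @ [kb])), (c, hd (Rc @ [kc])), (d, hd (Rd @ [kd]))}"

text \<open>Every way out of \<open>B\<close> has a pentagon of its own, because the cut argument
  cannot choose which edge it finds. During the growth the roots \<open>a\<close>, \<open>b\<close>,
  \<open>c\<close>, \<open>d\<close> of the legs move, while their ends \<open>ka\<close>,
  \<open>kb\<close>, \<open>kc\<close>, \<open>kd\<close> stay.\<close>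

definition blob where
  "blob H KV B a Ra ka b Rb kb c Rc kc d Rd kd \<longleftrightarrow>
     B \<subseteq> verts H - KV \<and> {a, b, c, d} \<subseteq> B \<and> {ka, kb, kc, kd} \<subseteq> KV \<and>
     set Ra \<union> set Rb \<union> set Rc \<union> set Rd \<subseteq> verts H - KV - B \<and> distinct (Ra @ Rb @ Rc @ Rd) \<and>
     walk H (a # Ra @ [ka]) \<and> walk H (b # Rb @ [kb]) \<and> walk H (c # Rc @ [kc]) \<and> walk H (d # Rd @ [kd]) \<and>
     (\<forall>v u. v \<in> B \<longrightarrow> u \<notin> B \<longrightarrow> {v, u} \<in> edges H \<longrightarrow>
        (v, u) \<notin> first_steps a Ra ka b Rb kb c Rc kc d Rd kd \<longrightarrow> pent_at H B a b c d v)"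

lemma blob_rotate:
  assumes "blob H KV B a Ra ka b Rb kb c Rc kc d Rd kd"
  shows "blob H KV B b Rb kb c Rc kc d Rd kd a Ra ka"
proof -
  have "first_steps b Rb kb c Rc kc d Rd kd a Ra ka = first_steps a Ra ka b Rb kb c Rc kc d Rd kd"
    by (auto simp: first_steps_def)
  moreover have "pent_at H B b c d a v = pent_at H B a b c d v" for v
    by (auto simp: pent_at_def)
  moreover have "distinct (Rb @ Rc @ Rd @ Ra) = distinct (Ra @ Rb @ Rc @ Rd)"
    by (rule mset_eq_imp_distinct_iff) (simp add: ac_simps)
  ultimately show ?thesis using assms unfolding blob_def by auto
qed

text \<open>For edges leaving from \<open>u\<close>, the pentagon is that of \<open>v\<close> with
  its fifth leg lengthened by \<open>u\<close>. Edges leaving from \<open>B\<close> keep their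
  pentagons.\<close>

lemma blob_absorb_vertex:
  assumes bl: "blob H KV B a Ra ka b Rb kb c Rc kc d Rd kd"
    and "v \<in> B" "u \<notin> B" "{v, u} \<in> edges H" "(v, u) \<notin> first_steps a Ra ka b Rb kb c Rc kc d Rd kd"
    and "u \<in> verts H - KV" "u \<notin> set Ra \<union> set Rb \<union> set Rc \<union> set Rd"
  shows "blob H KV (insert u B) a Ra ka b Rb kb c Rc kc d Rd kd"
proof -
  have g: "pent_at H B a b c d v" if "v \<in> B" "u \<notin> B" "{v, u} \<in> edges H"
    "(v, u) \<notin> first_steps a Ra ka b Rb kb c Rc kc d Rd kd" for v u
    using bl that unfolding blob_def by blast
  have "pent_at H (insert u B) a b c d v'"
    if "v' \<in> insert u B" "u' \<notin> insert u B" "{v', u'} \<in> edges H"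
      "(v', u') \<notin> first_steps a Ra ka b Rb kb c Rc kc d Rd kd" for v' u'
  proof (cases "v' = u")
    case True
    then show ?thesis using pent_at_extend_source[OF g assms(4,3)] assms(2-5) by blast
  next
    case False
    then show ?thesis using pent_at_mono[OF g[of v' u']] that by blast
  qed
  then show ?thesis using bl assms(6,7) unfolding blob_def by blast
qed

text \<open>The edge from \<open>v\<close> hits the leg of \<open>a\<close> at \<open>u\<close>, and
  the leg is re-rooted there. Ways out of the larger piece start at old vertices, whose leg to
  \<open>a\<close> is lengthened to \<open>u\<close>; at inner vertices of the swallowed stretch,
  which are served by the swap; but not at \<open>u\<close>, which has no spare edge.\<close>

lemma blob_absorb_leg:
  assumes H: "cubic H"
    and bl: "blob H KV B a Ra ka b Rb kb c Rc kc d Rd kd"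
    and vu: "v \<in> B" "u \<notin> B" "{v, u} \<in> edges H" "(v, u) \<notin> first_steps a Ra ka b Rb kb c Rc kc d Rd kd"
    and u: "u \<in> set Ra"
  shows "\<exists>B' Ra'. B \<subset> B' \<and> blob H KV B' u Ra' ka b Rb kb c Rc kc d Rd kd"
proof -
  obtain g h where Ra: "Ra = g @ u # h" using split_list[OF u] by blast
  let ?B = "B \<union> set (g @ [u])"
  have bl': "B \<subseteq> verts H - KV" "{a, b, c, d} \<subseteq> B" "{ka, kb, kc, kd} \<subseteq> KV"
    "set Ra \<union> set Rb \<union> set Rc \<union> set Rd \<subseteq> verts H - KV - B" "distinct (Ra @ Rb @ Rc @ Rd)"
    "walk H (a # Ra @ [ka])" "walk H (b # Rb @ [kb])" "walk H (c # Rc @ [kc])" "walk H (d # Rd @ [kd])"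
    using bl by (simp_all add: blob_def)
  have g: "pent_at H B a b c d v" if "v \<in> B" "u \<notin> B" "{v, u} \<in> edges H"
    "(v, u) \<notin> first_steps a Ra ka b Rb kb c Rc kc d Rd kd" for v u
    using bl that unfolding blob_def by blast
  have wg: "walk H (a # g @ [u])" and wh: "walk H (u # h @ [ka])"
    using bl'(6) walk_appendD(1)[of H "a # g @ [u]" "h @ [ka]"] walk_appendD(2)[of H "a # g" "u # h @ [ka]"]
    by (simp_all add: Ra)
  have dg: "distinct (g @ [u])" "set (g @ [u]) \<inter> B = {}"
    using bl'(4,5) by (auto simp: Ra)
  have old: "pent_at H ?B u b c d v'" if "v' \<in> B" "u' \<notin> ?B" "{v', u'} \<in> edges H"
      "(v', u') \<notin> first_steps u h ka b Rb kb c Rc kc d Rd kd" for v' u'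
  proof -
    \<comment> \<open>The first step of the old leg of \<open>a\<close> ends inside the larger
      piece, so it is not a way out of it.\<close>
    have "(v', u') \<noteq> (a, hd (Ra @ [ka]))" using that(2) by (cases g) (auto simp: Ra)
    then have "pent_at H B a b c d v'" using g[of v' u'] that by (auto simp: first_steps_def)
    from pent_at_extend[OF this wg dg] show ?thesis by simp
  qed
  have inner: "pent_at H ?B u b c d v'" if v': "v' \<in> set g" for v'
  proof -
    obtain g1 g2 where s: "g = g1 @ v' # g2" using split_list[OF v'] by blast
    show ?thesis
      using pent_at_swap[OF g[OF vu], of g1 v' g2 u] wg dg vu(3) by (simp add: s)
  qed
  \<comment> \<open>The three neighbours of \<open>u\<close> are \<open>v\<close> and its
    predecessor and successor on the leg. If the predecessor is \<open>a\<close> itself, it differs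
    from \<open>v\<close> because \<open>v u\<close> is not a first step.\<close>
  have at_u: "u' \<in> ?B \<or> u' = hd (h @ [ka])" if "{u, u'} \<in> edges H" for u'
  proof -
    let ?p = "last (a # g)" and ?s = "hd (h @ [ka])"
    have p: "{u, ?p} \<in> edges H" using walk_last_edge[OF wg] by (simp add: insert_commute del: last.simps)
    have s: "{u, ?s} \<in> edges H" using wh by (simp add: walk_Cons)
    have p_in: "?p \<in> insert a (set g)" using last_in_set[of "a # g"] by simp
    have "?s \<in> KV \<union> set h" using bl'(3) by (cases h) auto
    then have "?s \<notin> B" "?s \<notin> insert a (set g)"
      using bl'(1-5) unfolding Ra by auto
    then have "?s \<noteq> ?p" using p_in by metis
    moreover note \<open>?s \<notin> B\<close>
    moreover have "v \<noteq> ?p"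
    proof (cases g)
      case Nil
      then show ?thesis using vu(4) by (auto simp: first_steps_def Ra)
    next
      case (Cons x xs)
      then have "?p \<in> set g" by simp
      then show ?thesis using dg(2) vu(1) by auto
    qed
    moreover have "v \<noteq> ?s" using \<open>?s \<notin> B\<close> vu(1) by blast
    moreover have "u \<in> verts H" using bl'(4) u by blast
    moreover have "{u, v} \<in> edges H" using vu(3) by (simp add: insert_commute)
    ultimately have "u' \<in> {v, ?p, ?s}"
      using cubic_neighbours[OF H _ _ p s, of v u'] that by metis
    moreover have "?p \<in> ?B" using bl'(2) p_in by auto
    ultimately show ?thesis using vu(1) by blast
  qed
  have "blob H KV ?B u h ka b Rb kb c Rc kc d Rd kd"
    unfolding blob_def
  proof (intro conjI allI impI)
    show "?B \<subseteq> verts H - KV" using bl'(1,4) by (auto simp: Ra)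
    show "{u, b, c, d} \<subseteq> ?B" "{ka, kb, kc, kd} \<subseteq> KV" using bl'(2,3) by auto
    show "set h \<union> set Rb \<union> set Rc \<union> set Rd \<subseteq> verts H - KV - ?B"
      using bl'(4,5) by (auto simp: Ra)
    show "distinct (h @ Rb @ Rc @ Rd)" using bl'(5) by (auto simp: Ra)
    show "walk H (u # h @ [ka])" "walk H (b # Rb @ [kb])" "walk H (c # Rc @ [kc])" "walk H (d # Rd @ [kd])"
      using wh bl' by simp_all
    fix v' u'
    assume *: "v' \<in> ?B" "u' \<notin> ?B" "{v', u'} \<in> edges H"
      "(v', u') \<notin> first_steps u h ka b Rb kb c Rc kc d Rd kd"
    then have "v' \<noteq> u" using at_u[of u'] by (auto simp: first_steps_def)
    then consider "v' \<in> B" | "v' \<in> set g" using *(1) by auto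
    then show "pent_at H ?B u b c d v'" using old inner * by cases blast+
  qed
  moreover have "B \<subset> ?B" using vu(2) by auto
  ultimately show ?thesis by blast
qed

text \<open>At most four edges are first steps, so a cut of at least five edges contains another
  one.\<close>

lemma blob_free_edge:
  assumes H: "simple_graph H"
    and bl: "blob H KV B a Ra ka b Rb kb c Rc kc d Rd kd"
    and cut: "5 \<le> card (edge_cut H B)"
  obtains v u where "v \<in> B" "u \<notin> B" "{v, u} \<in> edges H"
    "(v, u) \<notin> first_steps a Ra ka b Rb kb c Rc kc d Rd kd"
proof -
  let ?fs = "first_steps a Ra ka b Rb kb c Rc kc d Rd kd"
  let ?L = "(\<lambda>(v, u). {v, u}) ` ?fs"
  have "finite ?fs" "card ?fs \<le> 4"
    by (simp_all add: first_steps_def card_insert_le_m1)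
  then have "finite ?L" "card ?L \<le> 4" using card_image_le order_trans by blast+
  then have "\<not> edge_cut H B \<subseteq> ?L" using cut card_mono[of ?L "edge_cut H B"] by linarith
  then obtain e where e: "e \<in> edges H" "card (e \<inter> B) = 1" "e \<notin> ?L"
    unfolding edge_cut_def by blast
  then have "card e = 2" using H unfolding simple_graph_def by blast
  then obtain x y where xy: "e = {x, y}" "x \<noteq> y" by (meson card_2_iff)
  from e(2) have "(x \<in> B \<and> y \<notin> B) \<or> (y \<in> B \<and> x \<notin> B)"
    using xy by (cases "x \<in> B"; cases "y \<in> B") auto
  moreover have "(x, y) \<notin> ?fs" "(y, x) \<notin> ?fs" using e(3) xy by (auto simp: image_iff insert_commute)
  ultimately show ?thesis using that e(1) xy by (metis insert_commute)
qed

text \<open>Used once an edge from \<open>v\<close> leads into the core: the four old legs are then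
  run to their ends, one after the other, each rotation bringing the next leg to the front.\<close>

lemma blob_exit:
  assumes bl: "blob H KV B a Ra ka b Rb kb c Rc kc d Rd kd"
    and g: "pent_at H B a b c d v"
  shows "\<exists>wa wb wc wd. {wa, ka} \<in> edges H \<and> {wb, kb} \<in> edges H \<and> {wc, kc} \<in> edges H \<and> {wd, kd} \<in> edges H \<and>
           pent_at H (verts H - KV) wa wb wc wd v"
proof -
  have bl': "B \<subseteq> verts H - KV"
    "set Ra \<union> set Rb \<union> set Rc \<union> set Rd \<subseteq> verts H - KV - B" "distinct (Ra @ Rb @ Rc @ Rd)"
    "walk H (a # Ra @ [ka])" "walk H (b # Rb @ [kb])" "walk H (c # Rc @ [kc])" "walk H (d # Rd @ [kd])"
    using bl by (simp_all add: blob_def)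
  note w = bl'(4-7)[THEN walk_last_edge]
  have 1: "pent_at H (B \<union> set Ra) b c d (last (a # Ra)) v"
    by (rule pent_at_rotate, rule pent_at_extend[OF g]) (use w bl' in auto)
  have 2: "pent_at H (B \<union> set Ra \<union> set Rb) c d (last (a # Ra)) (last (b # Rb)) v"
    by (rule pent_at_rotate, rule pent_at_extend[OF 1]) (use w bl' in auto)
  have 3: "pent_at H (B \<union> set Ra \<union> set Rb \<union> set Rc) d (last (a # Ra)) (last (b # Rb)) (last (c # Rc)) v"
    by (rule pent_at_rotate, rule pent_at_extend[OF 2]) (use w bl' in auto)
  have 4: "pent_at H (B \<union> set Ra \<union> set Rb \<union> set Rc \<union> set Rd)
      (last (a # Ra)) (last (b # Rb)) (last (c # Rc)) (last (d # Rd)) v"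
    by (rule pent_at_rotate, rule pent_at_extend[OF 3]) (use w bl' in auto)
  have "B \<union> set Ra \<union> set Rb \<union> set Rc \<union> set Rd \<subseteq> verts H - KV" using bl'(1,2) by blast
  from pent_at_mono[OF 4 this] w show ?thesis by blast
qed

text \<open>The cut bound holds for every intermediate piece containing \<open>C\<close>, so there
  is always a further edge. Unless it leads into \<open>KV\<close>, it enlarges \<open>B\<close>,
  which is possible only finitely often.\<close>

lemma blob_escape:
  assumes H: "simple_graph H" "cubic H"
    and cut: "\<And>X. C \<subseteq> X \<Longrightarrow> X \<subseteq> verts H - KV \<Longrightarrow> 5 \<le> card (edge_cut H X)"
    and "blob H KV B a Ra ka b Rb kb c Rc kc d Rd kd" "C \<subseteq> B"
  shows "\<exists>v u wa wb wc wd. u \<in> KV \<and> {v, u} \<in> edges H \<and>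
     {wa, ka} \<in> edges H \<and> {wb, kb} \<in> edges H \<and> {wc, kc} \<in> edges H \<and> {wd, kd} \<in> edges H \<and>
     pent_at H (verts H - KV) wa wb wc wd v"
  using assms(4,5)
proof (induction "card (verts H) - card B" arbitrary: B a Ra b Rb c Rc d Rd rule: less_induct)
  case less
  note bl = less.prems(1)
  have fin: "finite (verts H)" using H(1) by (simp add: simple_graph_def)
  have B: "B \<subseteq> verts H - KV" using bl by (simp add: blob_def)
  obtain v u where vu: "v \<in> B" "u \<notin> B" "{v, u} \<in> edges H"
    "(v, u) \<notin> first_steps a Ra ka b Rb kb c Rc kc d Rd kd"
    using blob_free_edge[OF H(1) bl cut[OF less.prems(2) B]] by blast
  have uV: "u \<in> verts H" using H(1) vu(3) by (auto simp: simple_graph_def)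
  have dec: "card (verts H) - card B' < card (verts H) - card B"
    if "B \<subset> B'" "blob H KV B' a' Ra' ka b Rb kb c Rc kc d Rd kd" for B' a' Ra' b Rb kb c Rc kc d Rd kd ka
  proof -
    have "B' \<subseteq> verts H" using that(2) by (auto simp: blob_def)
    then have "card B < card B'" "card B' \<le> card (verts H)"
      using that(1) fin by (meson psubset_card_mono finite_subset, meson card_mono)
    then show ?thesis by linarith
  qed
  have IH: "\<exists>v u wa wb wc wd. u \<in> KV \<and> {v, u} \<in> edges H \<and>
     {wa, ka} \<in> edges H \<and> {wb, kb} \<in> edges H \<and> {wc, kc} \<in> edges H \<and> {wd, kd} \<in> edges H \<and>
     pent_at H (verts H - KV) wa wb wc wd v"
    if "B \<subset> B'" "blob H KV B' a Ra ka b Rb kb c Rc kc d Rd kd" for B' a Ra b Rb c Rc d Rd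
    using less.hyps[OF dec[OF that] that(2)] that(1) less.prems(2) by blast
  consider "u \<in> KV" | "u \<notin> KV" "u \<notin> set Ra \<union> set Rb \<union> set Rc \<union> set Rd"
    | "u \<in> set Ra" | "u \<in> set Rb" | "u \<in> set Rc" | "u \<in> set Rd" by blast
  then show ?case
  proof cases
    case 1
    have "pent_at H B a b c d v" using bl vu unfolding blob_def by blast
    from blob_exit[OF bl this] show ?thesis using 1 vu(3) by blast
  next
    case 2
    have "blob H KV (insert u B) a Ra ka b Rb kb c Rc kc d Rd kd"
      using blob_absorb_vertex[OF bl vu] 2 uV by blast
    moreover have "B \<subset> insert u B" using vu(2) by blast
    ultimately show ?thesis using IH by blast
  next
    case 3
    obtain B' Ra' where "B \<subset> B'" "blob H KV B' u Ra' ka b Rb kb c Rc kc d Rd kd"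
      using blob_absorb_leg[OF H(2) bl vu 3] by blast
    then show ?thesis by (rule IH)
  next
    case 4
    note r = blob_rotate[OF bl]
    have "(v, u) \<notin> first_steps b Rb kb c Rc kc d Rd kd a Ra ka"
      using vu(4) by (auto simp: first_steps_def)
    then obtain B' Rb' where *: "B \<subset> B'" "blob H KV B' u Rb' kb c Rc kc d Rd kd a Ra ka"
      using blob_absorb_leg[OF H(2) r vu(1-3) _ 4] by blast
    \<comment> \<open>Further rotations restore the order \<open>ka\<close>, \<open>kb\<close>,
      \<open>kc\<close>, \<open>kd\<close> of the attachments, which the conclusion refers
      to.\<close>
    from blob_rotate[OF blob_rotate[OF blob_rotate[OF *(2)]]]
    show ?thesis by (rule IH[OF *(1)])
  next
    case 5
    note r = blob_rotate[OF blob_rotate[OF bl]]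
    have "(v, u) \<notin> first_steps c Rc kc d Rd kd a Ra ka b Rb kb"
      using vu(4) by (auto simp: first_steps_def)
    then obtain B' Rc' where *: "B \<subset> B'" "blob H KV B' u Rc' kc d Rd kd a Ra ka b Rb kb"
      using blob_absorb_leg[OF H(2) r vu(1-3) _ 5] by blast
    from blob_rotate[OF blob_rotate[OF *(2)]]
    show ?thesis by (rule IH[OF *(1)])
  next
    case 6
    note r = blob_rotate[OF blob_rotate[OF blob_rotate[OF bl]]]
    have "(v, u) \<notin> first_steps d Rd kd a Ra ka b Rb kb c Rc kc"
      using vu(4) by (auto simp: first_steps_def)
    then obtain B' Rd' where *: "B \<subset> B'" "blob H KV B' u Rd' kd a Ra ka b Rb kb c Rc kc"
      using blob_absorb_leg[OF H(2) r vu(1-3) _ 6] by blast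
    from blob_rotate[OF *(2)]
    show ?thesis by (rule IH[OF *(1)])
  qed
qed

section \<open>The image of the four-cycle as the initial piece\<close>

text \<open>\<open>Sa\<close> is the open side from \<open>a\<close> to \<open>b\<close>, and so on
  cyclically; \<open>Ra\<close> is the inside of the leg from \<open>a\<close> to
  \<open>ka\<close>.\<close>

definition four_cycle where
  "four_cycle H KV a Sa Ra ka b Sb Rb kb c Sc Rc kc d Sd Rd kd \<longleftrightarrow>
     distinct ((a # Sa) @ (b # Sb) @ (c # Sc) @ (d # Sd) @ Ra @ Rb @ Rc @ Rd) \<and>
     set ((a # Sa) @ (b # Sb) @ (c # Sc) @ (d # Sd) @ Ra @ Rb @ Rc @ Rd) \<subseteq> verts H - KV \<and>
     {ka, kb, kc, kd} \<subseteq> KV \<and>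
     walk H (a # Sa @ [b]) \<and> walk H (b # Sb @ [c]) \<and> walk H (c # Sc @ [d]) \<and> walk H (d # Sd @ [a]) \<and>
     walk H (a # Ra @ [ka]) \<and> walk H (b # Rb @ [kb]) \<and> walk H (c # Rc @ [kc]) \<and> walk H (d # Rd @ [kd])"

lemma four_cycle_rotate:
  assumes "four_cycle H KV a Sa Ra ka b Sb Rb kb c Sc Rc kc d Sd Rd kd"
  shows "four_cycle H KV b Sb Rb kb c Sc Rc kc d Sd Rd kd a Sa Ra ka"
proof -
  have m: "mset ((b # Sb) @ (c # Sc) @ (d # Sd) @ (a # Sa) @ Rb @ Rc @ Rd @ Ra) =
    mset ((a # Sa) @ (b # Sb) @ (c # Sc) @ (d # Sd) @ Ra @ Rb @ Rc @ Rd)"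
    by (simp add: ac_simps)
  have "{kb, kc, kd, ka} = {ka, kb, kc, kd}" by blast
  then show ?thesis
    using assms distinct_mset_cong[OF m] unfolding four_cycle_def mset_eq_setD[OF m] by presburger
qed

text \<open>The corner \<open>a\<close> already has three neighbours, two on the cycle and one on
  its leg, so a further edge starts inside the side. There \<open>v\<close> is the fifth corner of a
  pentagon whose legs are all bare corners.\<close>

lemma four_cycle_good:
  assumes H: "cubic H" and fc: "four_cycle H KV a Sa Ra ka b Sb Rb kb c Sc Rc kc d Sd Rd kd"
    and B: "B = set ((a # Sa) @ (b # Sb) @ (c # Sc) @ (d # Sd))"
    and v: "v \<in> set (a # Sa)" and u: "u \<notin> B" "{v, u} \<in> edges H" "(v, u) \<noteq> (a, hd (Ra @ [ka]))"
  shows "pent H B v b c d a"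
proof -
  have D: "distinct ((a # Sa) @ (b # Sb) @ (c # Sc) @ (d # Sd) @ Ra @ Rb @ Rc @ Rd)"
    and V: "set ((a # Sa) @ (b # Sb) @ (c # Sc) @ (d # Sd) @ Ra @ Rb @ Rc @ Rd) \<subseteq> verts H - KV" "ka \<in> KV"
    and W: "walk H (a # Sa @ [b])" "walk H (b # Sb @ [c])" "walk H (c # Sc @ [d])" "walk H (d # Sd @ [a])"
      "walk H (a # Ra @ [ka])"
    using fc by (simp_all add: four_cycle_def)
  have "v \<noteq> a"
  proof
    assume "v = a"
    let ?x = "hd (Sa @ [b])" and ?y = "last (d # Sd)" and ?z = "hd (Ra @ [ka])"
    have e: "{a, ?x} \<in> edges H" "{a, ?y} \<in> edges H" "{a, ?z} \<in> edges H"
      using W(1,5) walk_last_edge[OF W(4)] by (simp_all add: walk_Cons insert_commute)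
    have y: "?y \<in> set (d # Sd)" by (rule last_in_set) simp
    then have n: "?x \<noteq> ?y" "?x \<noteq> ?z" "?y \<noteq> ?z"
      using D V by (cases Sa; cases Ra; auto)+
    have "a \<in> verts H" using V by auto
    from cubic_neighbours[OF H this e n, of u] have "u \<in> {?x, ?y, ?z}" using u(2) \<open>v = a\<close> by simp
    moreover have "?x \<in> B" "?y \<in> B" using y unfolding B by (cases Sa; auto)+
    ultimately show False using u \<open>v = a\<close> by auto
  qed
  then obtain s1 s2 where s: "Sa = s1 @ v # s2" using v by (auto dest: split_list)
  have m: "mset ((a # Sa) @ (b # Sb) @ (c # Sc) @ (d # Sd)) =
      mset (s2 @ Sb @ Sc @ Sd @ s1 @ [v] @ [b] @ [c] @ [d] @ [a])"
    by (simp add: s ac_simps)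
  have "distinct ((a # Sa) @ (b # Sb) @ (c # Sc) @ (d # Sd))"
    using D distinct_append[of "(a # Sa) @ (b # Sb) @ (c # Sc) @ (d # Sd)" "Ra @ Rb @ Rc @ Rd"]
    unfolding append_assoc by blast
  then have "distinct (s2 @ Sb @ Sc @ Sd @ s1 @ [v] @ [b] @ [c] @ [d] @ [a])"
    using distinct_mset_cong[OF m[symmetric]] by blast
  moreover have "walk H (v # s2 @ [b])" "walk H (a # s1 @ [v])"
    using W(1) walk_appendD[of H "a # s1 @ [v]" "s2 @ [b]"] walk_appendD[of H "a # s1" "v # s2 @ [b]"]
    by (simp_all add: s)
  ultimately have "pent_on H s2 Sb Sc Sd s1 [v] [b] [c] [d] [a]"
    unfolding pent_on_def using W by simp
  then show ?thesis
    by (rule pentI) (use mset_eq_setD[OF m] B in auto)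
qed

lemma blob_of_four_cycle:
  assumes H: "cubic H" and fc: "four_cycle H KV a Sa Ra ka b Sb Rb kb c Sc Rc kc d Sd Rd kd"
  shows "blob H KV (set ((a # Sa) @ (b # Sb) @ (c # Sc) @ (d # Sd))) a Ra ka b Rb kb c Rc kc d Rd kd"
proof -
  let ?B = "set ((a # Sa) @ (b # Sb) @ (c # Sc) @ (d # Sd))"
  note fc1 = four_cycle_rotate[OF fc] and fc2 = four_cycle_rotate[OF four_cycle_rotate[OF fc]]
    and fc3 = four_cycle_rotate[OF four_cycle_rotate[OF four_cycle_rotate[OF fc]]]
  have "pent_at H ?B a b c d v"
    if vu: "v \<in> ?B" "u \<notin> ?B" "{v, u} \<in> edges H"
      "(v, u) \<notin> first_steps a Ra ka b Rb kb c Rc kc d Rd kd" for v u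
  proof -
    note f = vu(4)[unfolded first_steps_def insert_iff de_Morgan_disj]
    consider "v \<in> set (a # Sa)" | "v \<in> set (b # Sb)" | "v \<in> set (c # Sc)" | "v \<in> set (d # Sd)"
      using vu(1) by auto
    then show ?thesis
    proof cases
      case 1
      have "pent H ?B v b c d a" by (rule four_cycle_good[OF H fc refl 1 vu(2,3)]) (use f in blast)
      then show ?thesis by (simp add: pent_at_def)
    next
      case 2
      have "pent H ?B v c d a b" by (rule four_cycle_good[OF H fc1 _ 2 vu(2,3)]) (use f in auto)
      then show ?thesis by (simp add: pent_at_def)
    next
      case 3
      have "pent H ?B v d a b c" by (rule four_cycle_good[OF H fc2 _ 3 vu(2,3)]) (use f in auto)
      then show ?thesis by (simp add: pent_at_def)
    next
      case 4
      have "pent H ?B v a b c d" by (rule four_cycle_good[OF H fc3 _ 4 vu(2,3)]) (use f in auto)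
      then show ?thesis by (simp add: pent_at_def)
    qed
  qed
  moreover have D: "distinct (((a # Sa) @ (b # Sb) @ (c # Sc) @ (d # Sd)) @ Ra @ Rb @ Rc @ Rd)"
    and V: "set (((a # Sa) @ (b # Sb) @ (c # Sc) @ (d # Sd)) @ Ra @ Rb @ Rc @ Rd) \<subseteq> verts H - KV"
    using fc unfolding four_cycle_def append_assoc by blast+
  have "distinct (Ra @ Rb @ Rc @ Rd)" and "set (Ra @ Rb @ Rc @ Rd) \<inter> ?B = {}"
    using D[unfolded distinct_append[of _ "Ra @ Rb @ Rc @ Rd"]] by blast+
  moreover have "?B \<subseteq> verts H - KV" "set (Ra @ Rb @ Rc @ Rd) \<subseteq> verts H - KV"
    using V unfolding set_append[of _ "Ra @ Rb @ Rc @ Rd"] by blast+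
  moreover have "set Ra \<union> set Rb \<union> set Rc \<union> set Rd = set (Ra @ Rb @ Rc @ Rd)" "{a, b, c, d} \<subseteq> ?B"
    by auto
  moreover have "{ka, kb, kc, kd} \<subseteq> KV" "walk H (a # Ra @ [ka])" "walk H (b # Rb @ [kb])"
    "walk H (c # Rc @ [kc])" "walk H (d # Rd @ [kd])"
    using fc unfolding four_cycle_def by blast+
  ultimately show ?thesis
    unfolding blob_def by (intro conjI allI impI) blast+
qed

lemma four_cycle_escape:
  assumes H: "simple_graph H" "cubic H"
    and fc: "four_cycle H KV a Sa Ra ka b Sb Rb kb c Sc Rc kc d Sd Rd kd"
    and cut: "\<And>X. set ((a # Sa) @ (b # Sb) @ (c # Sc) @ (d # Sd)) \<subseteq> X \<Longrightarrow> X \<subseteq> verts H - KV \<Longrightarrow>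
      5 \<le> card (edge_cut H X)"
  shows "\<exists>v u wa wb wc wd. u \<in> KV \<and> {v, u} \<in> edges H \<and>
     {wa, ka} \<in> edges H \<and> {wb, kb} \<in> edges H \<and> {wc, kc} \<in> edges H \<and> {wd, kd} \<in> edges H \<and>
     pent_at H (verts H - KV) wa wb wc wd v"
  by (rule blob_escape[OF H cut blob_of_four_cycle[OF H(2) fc] subset_refl])

section \<open>Homeomorphic embeddings of labelled graphs\<close>

definition labelled_graph :: "(nat \<Rightarrow> 'a) \<Rightarrow> nat set \<Rightarrow> (nat \<times> nat) set \<Rightarrow> 'a ugraph" where
  "labelled_graph \<psi> V E = \<lparr>verts = \<psi> ` V, edges = (\<lambda>(i, j). {\<psi> i, \<psi> j}) ` E\<rparr>"

definition oriented :: "nat set \<Rightarrow> (nat \<times> nat) set \<Rightarrow> bool" where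
  "oriented V E \<longleftrightarrow> (\<forall>i j. (i, j) \<in> E \<longrightarrow> i \<in> V \<and> j \<in> V \<and> i \<noteq> j \<and> (j, i) \<notin> E)"

text \<open>Embeddings with the inner vertices \<open>I e\<close> of the path of an edge \<open>e\<close> listed in the direction of \<open>e\<close>; hence the
  edges need an orientation.\<close>

definition model :: "'a ugraph \<Rightarrow> nat set \<Rightarrow> (nat \<times> nat) set \<Rightarrow> (nat \<Rightarrow> 'a) \<Rightarrow> (nat \<times> nat \<Rightarrow> 'a list) \<Rightarrow> bool" where
  "model H V E \<eta> I \<longleftrightarrow> inj_on \<eta> V \<and> \<eta> ` V \<subseteq> verts H \<and>
     (\<forall>i j. (i, j) \<in> E \<longrightarrow> distinct (I (i, j)) \<and> set (I (i, j)) \<subseteq> verts H - \<eta> ` V \<and>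
        walk H (\<eta> i # I (i, j) @ [\<eta> j])) \<and>
     (\<forall>e\<in>E. \<forall>e'\<in>E. e \<noteq> e' \<longrightarrow> set (I e) \<inter> set (I e') = {})"

lemma edges_path_graph_Cons:
  "edges (path_graph (u # v # vs)) = insert {u, v} (edges (path_graph (v # vs)))"
  by (auto simp: path_graph_def)

lemma edges_path_graph_single [simp]: "edges (path_graph [u]) = {}" "edges (path_graph []) = {}"
  by (auto simp: path_graph_def)

lemma verts_path_graph [simp]: "verts (path_graph vs) = set vs"
  by (simp add: path_graph_def)

lemma walk_iff_edges: "walk H vs \<longleftrightarrow> edges (path_graph vs) \<subseteq> edges H"
  by (induction vs rule: induct_list012) (auto simp: edges_path_graph_Cons)

lemma edges_path_graph_snoc:
  "vs \<noteq> [] \<Longrightarrow> edges (path_graph (vs @ [v])) = insert {last vs, v} (edges (path_graph vs))"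
  by (induction vs rule: induct_list012) (auto simp: edges_path_graph_Cons)

lemma edges_path_graph_rev: "edges (path_graph (rev vs)) = edges (path_graph vs)"
proof (induction vs rule: induct_list012)
  case (3 x y zs)
  then show ?case
    using edges_path_graph_snoc[of "rev (y # zs)" x]
    by (simp add: edges_path_graph_Cons insert_commute)
qed simp_all

lemma path_graph_rev: "path_graph (rev vs) = path_graph vs"
proof -
  have "path_graph xs = \<lparr>verts = set xs, edges = edges (path_graph xs)\<rparr>" for xs :: "'a list"
    by (simp add: path_graph_def)
  then show ?thesis by (metis edges_path_graph_rev set_rev)
qed

lemma path_between_sym: "path_between P u v \<Longrightarrow> path_between P v u"
  unfolding path_between_def
  by (metis path_graph_rev rev_is_Nil_conv distinct_rev hd_rev last_rev)

lemma path_edge_distinct: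
  "e \<in> edges (path_graph vs) \<Longrightarrow> distinct vs \<Longrightarrow> \<exists>x y. e = {x, y} \<and> x \<noteq> y \<and> x \<in> set vs \<and> y \<in> set vs"
  by (induction vs rule: induct_list012) (auto simp: edges_path_graph_Cons)

lemma doubleton_inj_on:
  "inj_on \<psi> V \<Longrightarrow> i \<in> V \<Longrightarrow> j \<in> V \<Longrightarrow> k \<in> V \<Longrightarrow> l \<in> V \<Longrightarrow>
     {\<psi> i, \<psi> j} = {\<psi> k, \<psi> l} \<longleftrightarrow> (i = k \<and> j = l \<or> i = l \<and> j = k)"
  by (auto simp: doubleton_eq_iff inj_on_eq_iff)

lemma oriented_unique:
  assumes "oriented V E" "inj_on \<psi> V" "(i, j) \<in> E" "(k, l) \<in> E" "{\<psi> i, \<psi> j} = {\<psi> k, \<psi> l}"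
  shows "i = k \<and> j = l"
  using assms doubleton_inj_on[of \<psi> V i j k l] unfolding oriented_def by metis

text \<open>The inner vertices are what remains of a path list when its two ends are cut off. The
  second part of the conclusion serves to show later that paths of edges of \<open>F\<close> have no
  inner vertices.\<close>

lemma model_of_homeo:
  assumes H: "simple_graph H" and h: "homeo_embedding \<eta> \<pi> (labelled_graph \<psi> V E) H"
    and inj: "inj_on \<psi> V" and ori: "oriented V E"
  shows "\<exists>I. model H V E (\<eta> \<circ> \<psi>) I \<and>
    (\<forall>i j. (i, j) \<in> E \<longrightarrow> verts (\<pi> {\<psi> i, \<psi> j}) = {\<eta> (\<psi> i), \<eta> (\<psi> j)} \<union> set (I (i, j)))"
proof -
  have ed: "{\<psi> i, \<psi> j} \<in> edges (labelled_graph \<psi> V E)" if "(i, j) \<in> E" for i j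
    using that by (force simp: labelled_graph_def)
  have vt: "\<psi> i \<in> verts (labelled_graph \<psi> V E)" if "i \<in> V" for i using that by (simp add: labelled_graph_def)
  have h1: "\<eta> ` \<psi> ` V \<subseteq> verts H" "inj_on \<eta> (\<psi> ` V)"
    using h by (simp_all add: homeo_embedding_def labelled_graph_def)
  have h2: "subgraph (\<pi> {\<psi> i, \<psi> j}) H" "path_between (\<pi> {\<psi> i, \<psi> j}) (\<eta> (\<psi> i)) (\<eta> (\<psi> j))"
    if "(i, j) \<in> E" for i j
    using h ed[OF that] by (simp_all add: homeo_embedding_def)
  have h3: "(verts (\<pi> e1) - \<eta> ` e1) \<inter> verts (\<pi> e2) = {}"
    if "e1 \<in> edges (labelled_graph \<psi> V E)" "e2 \<in> edges (labelled_graph \<psi> V E)" "e1 \<noteq> e2" for e1 e2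
    using h that by (simp add: homeo_embedding_def)
  have h4: "\<eta> (\<psi> k) \<in> verts (\<pi> {\<psi> i, \<psi> j}) \<longleftrightarrow> \<psi> k \<in> {\<psi> i, \<psi> j}" if "k \<in> V" "(i, j) \<in> E" for i j k
    using h ed[OF that(2)] vt[OF that(1)] by (simp add: homeo_embedding_def)
  have inj': "inj_on (\<eta> \<circ> \<psi>) V" using inj h1(2) by (rule comp_inj_on)
  have V: "i \<in> V" "j \<in> V" "i \<noteq> j" if "(i, j) \<in> E" for i j using that ori by (auto simp: oriented_def)
  have "\<exists>xs. \<pi> {\<psi> (fst e), \<psi> (snd e)} = path_graph (\<eta> (\<psi> (fst e)) # xs @ [\<eta> (\<psi> (snd e))]) \<and>
      distinct (\<eta> (\<psi> (fst e)) # xs @ [\<eta> (\<psi> (snd e))])" if "e \<in> E" for e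
  proof -
    obtain i j where e: "e = (i, j)" by (cases e)
    then have ij: "(i, j) \<in> E" using that by simp
    obtain vs where vs: "vs \<noteq> []" "distinct vs" "hd vs = \<eta> (\<psi> i)" "last vs = \<eta> (\<psi> j)" "\<pi> {\<psi> i, \<psi> j} = path_graph vs"
      using h2(2)[OF ij] unfolding path_between_def by blast
    have "\<eta> (\<psi> i) \<noteq> \<eta> (\<psi> j)" using V[OF ij] inj' by (auto simp: inj_on_def)
    then have "tl vs \<noteq> []" using vs by (cases vs) auto
    then have vs': "hd vs # butlast (tl vs) @ [last vs] = vs" using vs(1) by (cases vs) auto
    show ?thesis
      unfolding e fst_conv snd_conv
      by (rule exI[of _ "butlast (tl vs)"]) (use vs vs'[unfolded vs(3,4)] in simp)
  qed
  then obtain I where I: "\<And>e. e \<in> E \<Longrightarrow> \<pi> {\<psi> (fst e), \<psi> (snd e)} = path_graph (\<eta> (\<psi> (fst e)) # I e @ [\<eta> (\<psi> (snd e))]) \<and>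
      distinct (\<eta> (\<psi> (fst e)) # I e @ [\<eta> (\<psi> (snd e))])" by metis
  have I1: "\<pi> {\<psi> i, \<psi> j} = path_graph (\<eta> (\<psi> i) # I (i, j) @ [\<eta> (\<psi> j)])"
    "distinct (\<eta> (\<psi> i) # I (i, j) @ [\<eta> (\<psi> j)])" if "(i, j) \<in> E" for i j
    using I[OF that] by simp_all
  have avoid: "x \<notin> \<eta> ` \<psi> ` V" if ij: "(i, j) \<in> E" and x: "x \<in> set (I (i, j))" for i j x
  proof
    assume "x \<in> \<eta> ` \<psi> ` V"
    then obtain k where k: "k \<in> V" "x = \<eta> (\<psi> k)" by blast
    then have "\<psi> k \<in> {\<psi> i, \<psi> j}" using h4[OF k(1) ij] x I1[OF ij] by simp
    then show False using k(2) I1(2)[OF ij] x by auto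
  qed
  have "model H V E (\<eta> \<circ> \<psi>) I"
    unfolding model_def
  proof (intro conjI allI impI ballI)
    show "inj_on (\<eta> \<circ> \<psi>) V" "(\<eta> \<circ> \<psi>) ` V \<subseteq> verts H" using inj' h1(1) by (simp_all add: image_comp)
  next
    fix i j assume ij: "(i, j) \<in> E"
    show "distinct (I (i, j))" using I1(2)[OF ij] by simp
    show "set (I (i, j)) \<subseteq> verts H - (\<eta> \<circ> \<psi>) ` V"
      using avoid[OF ij] h2(1)[OF ij] I1(1)[OF ij] by (auto simp: subgraph_def image_comp)
    show "walk H ((\<eta> \<circ> \<psi>) i # I (i, j) @ [(\<eta> \<circ> \<psi>) j])"
      using h2(1)[OF ij] I1(1)[OF ij] by (simp add: walk_iff_edges subgraph_def)
  next
    fix e e' assume e: "e \<in> E" "e' \<in> E" "e \<noteq> e'"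
    obtain i j k l where s: "e = (i, j)" "e' = (k, l)" by (cases e; cases e')
    have ne: "{\<psi> i, \<psi> j} \<noteq> {\<psi> k, \<psi> l}"
      using oriented_unique[OF ori inj, of i j k l] e s by auto
    have "{\<psi> i, \<psi> j} \<subseteq> \<psi> ` V" using V e s by blast
    then have "set (I e) \<inter> \<eta> ` {\<psi> i, \<psi> j} = {}" using avoid[of i j] e s by auto
    then show "set (I e) \<inter> set (I e') = {}"
      using h3[OF ed ed ne] e s I1(1)[of i j] I1(1)[of k l] by auto
  qed
  moreover have "verts (\<pi> {\<psi> i, \<psi> j}) = {\<eta> (\<psi> i), \<eta> (\<psi> j)} \<union> set (I (i, j))" if "(i, j) \<in> E" for i j
    using I1(1)[OF that] by auto
  ultimately show ?thesis by blast
qed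

lemma homeo_of_model:
  assumes m: "model H V E \<eta> I" and inj: "inj_on \<psi> V" and ori: "oriented V E"
  shows "\<exists>\<eta>' \<pi>. homeo_embedding \<eta>' \<pi> (labelled_graph \<psi> V E) H \<and> (\<forall>i\<in>V. \<eta>' (\<psi> i) = \<eta> i) \<and>
    (\<forall>i j. (i, j) \<in> E \<longrightarrow> \<pi> {\<psi> i, \<psi> j} = path_graph (\<eta> i # I (i, j) @ [\<eta> j]))"
proof -
  let ?P = "\<lambda>i j. path_graph (\<eta> i # I (i, j) @ [\<eta> j])"
  define \<eta>' where "\<eta>' = \<eta> \<circ> inv_into V \<psi>"
  \<comment> \<open>The choice by \<open>SOME\<close> is determined: by the orientation, an
    unordered edge comes from only one pair.\<close>
  define \<pi> where "\<pi> e = (let (i, j) = (SOME (i, j). (i, j) \<in> E \<and> e = {\<psi> i, \<psi> j}) in ?P i j)" for e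
  have m1: "inj_on \<eta> V" "\<eta> ` V \<subseteq> verts H" using m by (simp_all add: model_def)
  have m2: "distinct (I (i, j))" "set (I (i, j)) \<subseteq> verts H - \<eta> ` V" "walk H (\<eta> i # I (i, j) @ [\<eta> j])"
    if "(i, j) \<in> E" for i j using m that by (simp_all add: model_def)
  have m3: "set (I e) \<inter> set (I e') = {}" if "e \<in> E" "e' \<in> E" "e \<noteq> e'" for e e'
    using m that by (simp add: model_def)
  have V: "i \<in> V" "j \<in> V" "i \<noteq> j" if "(i, j) \<in> E" for i j using that ori by (auto simp: oriented_def)
  have \<eta>': "\<eta>' (\<psi> i) = \<eta> i" if "i \<in> V" for i using that inj by (simp add: \<eta>'_def)
  have \<pi>: "\<pi> {\<psi> i, \<psi> j} = ?P i j" if ij: "(i, j) \<in> E" for i j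
  proof -
    let ?Q = "\<lambda>(k, l). (k, l) \<in> E \<and> {\<psi> i, \<psi> j} = {\<psi> k, \<psi> l}"
    obtain k l where kl: "(SOME p. ?Q p) = (k, l)" by fastforce
    have "?Q (SOME p. ?Q p)" by (rule someI[of ?Q "(i, j)"]) (simp add: ij)
    then have "(k, l) \<in> E" "{\<psi> i, \<psi> j} = {\<psi> k, \<psi> l}" using kl by simp_all
    then have "i = k \<and> j = l" using oriented_unique[OF ori inj ij] by blast
    then show ?thesis using kl by (simp add: \<pi>_def Let_def)
  qed
  have dist: "distinct (\<eta> i # I (i, j) @ [\<eta> j])" if "(i, j) \<in> E" for i j
    using m2[OF that] V[OF that] m1(1) by (auto simp: inj_on_eq_iff)
  have E_cases: "\<exists>i j. (i, j) \<in> E \<and> e = {\<psi> i, \<psi> j}" if "e \<in> edges (labelled_graph \<psi> V E)" for e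
    using that by (auto simp: labelled_graph_def)
  have "homeo_embedding \<eta>' \<pi> (labelled_graph \<psi> V E) H"
    unfolding homeo_embedding_def
  proof (intro conjI allI impI ballI)
    show "\<eta>' ` verts (labelled_graph \<psi> V E) \<subseteq> verts H" using m1(2) \<eta>' by (auto simp: labelled_graph_def)
    show "inj_on \<eta>' (verts (labelled_graph \<psi> V E))"
      using m1(1) \<eta>' by (auto simp: labelled_graph_def inj_on_def)
  next
    fix u v assume "{u, v} \<in> edges (labelled_graph \<psi> V E)"
    then obtain i j where ij: "(i, j) \<in> E" "{u, v} = {\<psi> i, \<psi> j}" using E_cases by blast
    have "set (\<eta> i # I (i, j) @ [\<eta> j]) \<subseteq> verts H" using m2(2)[OF ij(1)] m1(2) V[OF ij(1)] by auto
    then show "subgraph (\<pi> {u, v}) H"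
      unfolding ij(2) \<pi>[OF ij(1)] using m2(3)[OF ij(1)] by (simp add: subgraph_def walk_iff_edges)
    have "path_between (?P i j) (\<eta> i) (\<eta> j)"
      using dist[OF ij(1)] unfolding path_between_def
      by (intro exI[of _ "\<eta> i # I (i, j) @ [\<eta> j]"]) simp
    then have "path_between (?P i j) (\<eta>' (\<psi> i)) (\<eta>' (\<psi> j))" using \<eta>' V[OF ij(1)] by simp
    then show "path_between (\<pi> {u, v}) (\<eta>' u) (\<eta>' v)"
      unfolding ij(2) \<pi>[OF ij(1)] using ij(2) path_between_sym by (auto simp: doubleton_eq_iff)
  next
    fix e1 e2 assume e: "e1 \<in> edges (labelled_graph \<psi> V E)" "e2 \<in> edges (labelled_graph \<psi> V E)" "e1 \<noteq> e2"
    obtain i j k l where ij: "(i, j) \<in> E" "e1 = {\<psi> i, \<psi> j}" and kl: "(k, l) \<in> E" "e2 = {\<psi> k, \<psi> l}"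
      using E_cases e by metis
    have "(i, j) \<noteq> (k, l)" using e(3) ij kl by auto
    then have d: "set (I (i, j)) \<inter> set (I (k, l)) = {}" using m3 ij kl by blast
    have v: "\<eta> i \<in> \<eta> ` V" "\<eta> j \<in> \<eta> ` V" "\<eta> k \<in> \<eta> ` V" "\<eta> l \<in> \<eta> ` V" using V ij kl by auto
    have e1: "\<eta>' ` e1 = {\<eta> i, \<eta> j}" using \<eta>' V[OF ij(1)] ij(2) by simp
    show "(verts (\<pi> e1) - \<eta>' ` e1) \<inter> verts (\<pi> e2) = {}"
      unfolding e1 unfolding ij(2) kl(2) \<pi>[OF ij(1)] \<pi>[OF kl(1)]
      using d v m2(2)[OF ij(1)] m2(2)[OF kl(1)] by auto
    \<comment> \<open>A common edge would have both its ends on both paths. Only branch vertices can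
      lie on two paths, so the two model edges would have the same pair of ends.\<close>
    show "edges (\<pi> e1) \<inter> edges (\<pi> e2) = {}"
    proof (rule ccontr)
      assume "edges (\<pi> e1) \<inter> edges (\<pi> e2) \<noteq> {}"
      then obtain f where f: "f \<in> edges (?P i j)" "f \<in> edges (?P k l)"
        unfolding ij(2) kl(2) \<pi>[OF ij(1)] \<pi>[OF kl(1)] by blast
      obtain x y where xy: "f = {x, y}" "x \<noteq> y" "x \<in> set (\<eta> i # I (i, j) @ [\<eta> j])" "y \<in> set (\<eta> i # I (i, j) @ [\<eta> j])"
        using path_edge_distinct[OF f(1) dist[OF ij(1)]] by blast
      have "f \<subseteq> set (\<eta> k # I (k, l) @ [\<eta> l])"
        using path_edge_distinct[OF f(2) dist[OF kl(1)]] by auto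
      then have "x \<in> set (\<eta> k # I (k, l) @ [\<eta> l])" "y \<in> set (\<eta> k # I (k, l) @ [\<eta> l])" using xy(1) by auto
      moreover have "z \<in> {\<eta> i, \<eta> j} \<inter> {\<eta> k, \<eta> l}"
        if "z \<in> set (\<eta> i # I (i, j) @ [\<eta> j])" "z \<in> set (\<eta> k # I (k, l) @ [\<eta> l])" for z
      proof -
        have "z \<in> set (I (i, j)) \<or> z \<in> {\<eta> i, \<eta> j}" "z \<in> set (I (k, l)) \<or> z \<in> {\<eta> k, \<eta> l}"
          using that by auto
        then show ?thesis using d v m2(2)[OF ij(1)] m2(2)[OF kl(1)] by blast
      qed
      ultimately have "x \<in> {\<eta> i, \<eta> j} \<inter> {\<eta> k, \<eta> l}" "y \<in> {\<eta> i, \<eta> j} \<inter> {\<eta> k, \<eta> l}"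
        using xy(3,4) by blast+
      then have "{\<eta> i, \<eta> j} = {\<eta> k, \<eta> l}" using xy(2) by auto
      then show False
        using oriented_unique[OF ori m1(1) ij(1) kl(1)] \<open>(i, j) \<noteq> (k, l)\<close> by blast
    qed
  next
    fix v e assume "v \<in> verts (labelled_graph \<psi> V E)" "e \<in> edges (labelled_graph \<psi> V E)"
    then obtain k i j where k: "k \<in> V" "v = \<psi> k" and ij: "(i, j) \<in> E" "e = {\<psi> i, \<psi> j}"
      using E_cases by (auto simp: labelled_graph_def)
    have "\<eta>' v \<in> verts (\<pi> e) \<longleftrightarrow> \<eta> k \<in> {\<eta> i, \<eta> j}"
      unfolding k(2) ij(2) \<eta>'[OF k(1)] \<pi>[OF ij(1)] using m2(2)[OF ij(1)] k(1) by auto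
    also have "\<dots> \<longleftrightarrow> v \<in> e"
      using k ij V[OF ij(1)] m1(1) inj by (auto simp: inj_on_eq_iff)
    finally show "\<eta>' v \<in> verts (\<pi> e) \<longleftrightarrow> v \<in> e" .
  qed
  then show ?thesis using \<eta>' \<pi> by blast
qed

section \<open>Composing models\<close>

definition adj :: "(nat \<times> nat) set \<Rightarrow> nat \<Rightarrow> nat \<Rightarrow> bool" where
  "adj E u v \<longleftrightarrow> (u, v) \<in> E \<or> (v, u) \<in> E"

definition seg :: "(nat \<times> nat) set \<Rightarrow> (nat \<times> nat \<Rightarrow> 'a list) \<Rightarrow> nat \<Rightarrow> nat \<Rightarrow> 'a list" where
  "seg E I u v = (if (u, v) \<in> E then I (u, v) else rev (I (v, u)))"

lemma model_seg:
  assumes m: "model H V E \<eta> I" and "adj E u v"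
  shows "distinct (seg E I u v)" "set (seg E I u v) \<subseteq> verts H - \<eta> ` V"
    "walk H (\<eta> u # seg E I u v @ [\<eta> v])"
proof -
  have m2: "distinct (I (i, j))" "set (I (i, j)) \<subseteq> verts H - \<eta> ` V" "walk H (\<eta> i # I (i, j) @ [\<eta> j])"
    if "(i, j) \<in> E" for i j using m that by (simp_all add: model_def)
  show "distinct (seg E I u v)" "set (seg E I u v) \<subseteq> verts H - \<eta> ` V"
    "walk H (\<eta> u # seg E I u v @ [\<eta> v])"
    using assms(2) m2[of u v] m2[of v u] by (auto simp: adj_def seg_def walk_rev_ends)
qed

lemma model_seg_disjoint:
  assumes m: "model H V E \<eta> I" and "adj E u v" "adj E u' v'" "{u, v} \<noteq> {u', v'}"
  shows "set (seg E I u v) \<inter> set (seg E I u' v') = {}"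
proof -
  have m3: "set (I e) \<inter> set (I e') = {}" if "e \<in> E" "e' \<in> E" "e \<noteq> e'" for e e'
    using m that by (simp add: model_def)
  obtain i j where ij: "(i, j) \<in> E" "{i, j} = {u, v}" "set (seg E I u v) = set (I (i, j))"
    using assms(2) unfolding adj_def seg_def by (cases "(u, v) \<in> E") auto
  obtain k l where kl: "(k, l) \<in> E" "{k, l} = {u', v'}" "set (seg E I u' v') = set (I (k, l))"
    using assms(3) unfolding adj_def seg_def by (cases "(u', v') \<in> E") auto
  have "(i, j) \<noteq> (k, l)" using ij kl assms(4) by auto
  then show ?thesis using m3[OF ij(1) kl(1)] ij kl by simp
qed

text \<open>\<open>P\<close> lists the interior vertex, if any, of the path that replaces an edge.\<close>

lemma model_compose:
  assumes m: "model H V E \<eta> I" and ori: "oriented V E"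
    and ori': "oriented V' E'" and inj: "inj_on \<mu> V'" and \<mu>: "\<mu> ` V' \<subseteq> V"
    and P0: "\<And>i k. (i, k) \<in> E' \<Longrightarrow> P (i, k) = None \<Longrightarrow> adj E (\<mu> i) (\<mu> k)"
    and P1: "\<And>i k p. (i, k) \<in> E' \<Longrightarrow> P (i, k) = Some p \<Longrightarrow> p \<in> V - \<mu> ` V' \<and> adj E (\<mu> i) p \<and> adj E p (\<mu> k)"
    and P2: "\<And>e e' p. e \<in> E' \<Longrightarrow> e' \<in> E' \<Longrightarrow> P e = Some p \<Longrightarrow> P e' = Some p \<Longrightarrow> e = e'"
  shows "\<exists>I'. model H V' E' (\<eta> \<circ> \<mu>) I' \<and>
    (\<forall>i k. (i, k) \<in> E' \<longrightarrow> P (i, k) = None \<longrightarrow> I' (i, k) = seg E I (\<mu> i) (\<mu> k))"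
proof -
  define I' where "I' e = (case P e of None \<Rightarrow> seg E I (\<mu> (fst e)) (\<mu> (snd e))
    | Some p \<Rightarrow> seg E I (\<mu> (fst e)) p @ \<eta> p # seg E I p (\<mu> (snd e)))" for e
  \<comment> \<open>The host edges, as unordered pairs, along which the path for \<open>e\<close>
    runs. Disjointness of the new paths reduces to disjointness of these sets and to the vertices
    \<open>p\<close> being different.\<close>
  define U where "U e = (case P e of None \<Rightarrow> {{\<mu> (fst e), \<mu> (snd e)}}
    | Some p \<Rightarrow> {{\<mu> (fst e), p}, {p, \<mu> (snd e)}})" for e
  note sg = model_seg[OF m]
  have m1: "inj_on \<eta> V" "\<eta> ` V \<subseteq> verts H" using m by (simp_all add: model_def)
  have VE: "i \<in> V'" "k \<in> V'" "i \<noteq> k" "\<mu> i \<noteq> \<mu> k" if "(i, k) \<in> E'" for i k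
    using that ori' inj by (auto simp: oriented_def inj_on_eq_iff)
  have sub: "(\<eta> \<circ> \<mu>) ` V' \<subseteq> \<eta> ` V" using \<mu> by auto
  have I'_set: "set (I' e) \<subseteq> (\<Union>{set (seg E I u v) |u v. adj E u v \<and> {u, v} \<in> U e}) \<union> \<eta> ` set_option (P e)"
    if "e \<in> E'" for e
  proof -
    obtain i k where e: "e = (i, k)" by (cases e)
    show ?thesis
    proof (cases "P e")
      case None
      then show ?thesis using P0[of i k] that unfolding e by (auto simp: I'_def U_def)
    next
      case (Some p)
      then have "adj E (\<mu> i) p" "adj E p (\<mu> k)" using P1[of i k p] that unfolding e by auto
      then show ?thesis using Some unfolding e by (auto simp: I'_def U_def)
    qed
  qed
  have U_disj: "U e \<inter> U e' = {}" if e: "e \<in> E'" "e' \<in> E'" "e \<noteq> e'" for e e'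
  proof -
    obtain i k j l where s: "e = (i, k)" "e' = (j, l)" by (cases e; cases e')
    have ne: "{\<mu> i, \<mu> k} \<noteq> {\<mu> j, \<mu> l}" using oriented_unique[OF ori' inj] e s by auto
    have vs: "\<mu> i \<in> \<mu> ` V'" "\<mu> k \<in> \<mu> ` V'" "\<mu> j \<in> \<mu> ` V'" "\<mu> l \<in> \<mu> ` V'" using VE e s by auto
    have p: "p \<notin> \<mu> ` V'" if "P e = Some p" for p using P1[of i k p] that e s by auto
    have q: "q \<notin> \<mu> ` V'" if "P e' = Some q" for q using P1[of j l q] that e s by auto
    show ?thesis
    proof (cases "P e")
      case None
      show ?thesis
      proof (cases "P e'")
        case None
        then show ?thesis using \<open>P e = None\<close> ne s by (simp add: U_def)
      next
        case (Some q)
        then show ?thesis using \<open>P e = None\<close> q[OF Some] vs s by (auto simp: U_def doubleton_eq_iff)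
      qed
    next
      case (Some p)
      show ?thesis
      proof (cases "P e'")
        case None
        then show ?thesis using \<open>P e = Some p\<close> p[OF Some] vs s by (auto simp: U_def doubleton_eq_iff)
      next
        case (Some q)
        have "p \<noteq> q" using P2[OF e(1,2)] \<open>P e = Some p\<close> Some e(3) by blast
        then show ?thesis using \<open>P e = Some p\<close> Some p[OF \<open>P e = Some p\<close>] q[OF Some] vs s
          by (auto simp: U_def doubleton_eq_iff)
      qed
    qed
  qed
  have "model H V' E' (\<eta> \<circ> \<mu>) I'"
    unfolding model_def
  proof (intro conjI allI impI ballI)
    show "inj_on (\<eta> \<circ> \<mu>) V'" using inj m1(1) \<mu> by (intro comp_inj_on) (auto intro: inj_on_subset)
    show "(\<eta> \<circ> \<mu>) ` V' \<subseteq> verts H" using sub m1(2) by blast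
  next
    fix i k assume ik: "(i, k) \<in> E'"
    show "distinct (I' (i, k)) "
    proof (cases "P (i, k)")
      case None
      then show ?thesis using sg(1)[OF P0[OF ik None]] by (simp add: I'_def)
    next
      case (Some p)
      note p = P1[OF ik Some]
      have "{\<mu> i, p} \<noteq> {p, \<mu> k}" using p VE[OF ik] by (auto simp: doubleton_eq_iff)
      then have "set (seg E I (\<mu> i) p) \<inter> set (seg E I p (\<mu> k)) = {}" using model_seg_disjoint[OF m] p by blast
      moreover have "\<eta> p \<notin> set (seg E I (\<mu> i) p)" "\<eta> p \<notin> set (seg E I p (\<mu> k))"
        using sg(2)[of "\<mu> i" p] sg(2)[of p "\<mu> k"] p by auto
      ultimately show ?thesis using Some sg(1) p by (auto simp: I'_def)
    qed
    show "set (I' (i, k)) \<subseteq> verts H - (\<eta> \<circ> \<mu>) ` V'"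
    proof (cases "P (i, k)")
      case None
      then have eq: "I' (i, k) = seg E I (\<mu> i) (\<mu> k)" by (simp add: I'_def)
      show ?thesis unfolding eq using sg(2)[OF P0[OF ik None]] sub by blast
    next
      case (Some p)
      note p = P1[OF ik Some]
      have eq: "set (I' (i, k)) = set (seg E I (\<mu> i) p) \<union> {\<eta> p} \<union> set (seg E I p (\<mu> k))"
        using Some by (simp add: I'_def)
      have "\<eta> p \<notin> (\<eta> \<circ> \<mu>) ` V'" using p m1(1) \<mu> by (auto simp: inj_on_eq_iff subset_iff)
      moreover have "\<eta> p \<in> verts H" using p m1(2) by blast
      moreover have "set (seg E I (\<mu> i) p) \<subseteq> verts H - (\<eta> \<circ> \<mu>) ` V'" "set (seg E I p (\<mu> k)) \<subseteq> verts H - (\<eta> \<circ> \<mu>) ` V'"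
        using sg(2)[of "\<mu> i" p] sg(2)[of p "\<mu> k"] p sub by blast+
      ultimately show ?thesis unfolding eq by (intro Un_least) simp_all
    qed
    show "walk H ((\<eta> \<circ> \<mu>) i # I' (i, k) @ [(\<eta> \<circ> \<mu>) k])"
    proof (cases "P (i, k)")
      case None
      then show ?thesis using sg(3)[OF P0[OF ik None]] by (simp add: I'_def)
    next
      case (Some p)
      note p = P1[OF ik Some]
      show ?thesis
        using walk_join_hd[of H "\<eta> (\<mu> i) # seg E I (\<mu> i) p" "\<eta> p # seg E I p (\<mu> k) @ [\<eta> (\<mu> k)]"]
          sg(3)[of "\<mu> i" p] sg(3)[of p "\<mu> k"] p Some by (simp add: I'_def)
    qed
  next
    fix e e' assume e: "e \<in> E'" "e' \<in> E'" "e \<noteq> e'"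
    have opt: "\<eta> ` set_option (P e) \<subseteq> \<eta> ` V" if "e \<in> E'" for e
      using P1[of "fst e" "snd e"] that by (cases "P e") auto
    have opt2: "\<eta> ` set_option (P e) \<inter> \<eta> ` set_option (P e') = {}"
    proof -
      have "p \<noteq> q" if "P e = Some p" "P e' = Some q" for p q using P2 e that by blast
      moreover have "p \<in> V" if "P e = Some p" for p using P1[of "fst e" "snd e" p] that e by simp
      moreover have "q \<in> V" if "P e' = Some q" for q using P1[of "fst e'" "snd e'" q] that e by simp
      ultimately show ?thesis using m1(1) by (auto simp: inj_on_eq_iff elem_set)
    qed
    have segs: "set (seg E I u v) \<inter> set (seg E I u' v') = {}"
      if "adj E u v" "{u, v} \<in> U e" "adj E u' v'" "{u', v'} \<in> U e'" for u v u' v'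
    proof (rule model_seg_disjoint[OF m that(1,3)])
      show "{u, v} \<noteq> {u', v'}" using U_disj[OF e] that(2,4) by (metis disjoint_iff)
    qed
    show "set (I' e) \<inter> set (I' e') = {}"
    proof (rule ccontr)
      assume "set (I' e) \<inter> set (I' e') \<noteq> {}"
      then obtain x where x: "x \<in> set (I' e)" "x \<in> set (I' e')" by blast
      have 1: "(\<exists>u v. adj E u v \<and> {u, v} \<in> U e \<and> x \<in> set (seg E I u v)) \<or> x \<in> \<eta> ` set_option (P e)"
        using I'_set[OF e(1)] x(1) by blast
      have 2: "(\<exists>u v. adj E u v \<and> {u, v} \<in> U e' \<and> x \<in> set (seg E I u v)) \<or> x \<in> \<eta> ` set_option (P e')"
        using I'_set[OF e(2)] x(2) by blast
      have 3: "x \<notin> \<eta> ` V" if "adj E u v" "x \<in> set (seg E I u v)" for u v using sg(2)[OF that(1)] that(2) by blast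
      from 1 show False
      proof (elim disjE exE conjE)
        fix u v assume uv: "adj E u v" "{u, v} \<in> U e" "x \<in> set (seg E I u v)"
        from 2 show False
        proof (elim disjE exE conjE)
          fix u' v' assume "adj E u' v'" "{u', v'} \<in> U e'" "x \<in> set (seg E I u' v')"
          then show False using segs[OF uv(1,2)] uv(3) by blast
        next
          assume "x \<in> \<eta> ` set_option (P e')"
          then show False using 3[OF uv(1,3)] subsetD[OF opt[OF e(2)]] by simp
        qed
      next
        assume xe: "x \<in> \<eta> ` set_option (P e)"
        from 2 show False
        proof (elim disjE exE conjE)
          fix u' v' assume "adj E u' v'" "{u', v'} \<in> U e'" "x \<in> set (seg E I u' v')"
          then show False using 3 subsetD[OF opt[OF e(1)] xe] by simp
        next
          assume "x \<in> \<eta> ` set_option (P e')"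
          then show False using opt2 xe by blast
        qed
      qed
    qed
  qed
  moreover have "I' (i, k) = seg E I (\<mu> i) (\<mu> k)" if "P (i, k) = None" for i k
    using that by (simp add: I'_def)
  ultimately show ?thesis by blast
qed

section \<open>Computations in the dodecahedron\<close>

definition dedges :: "(nat \<times> nat) list" where
  "dedges = [(0,1),(0,4),(0,5),(1,2),(1,6),(2,3),(2,7),(3,4),(3,8),(4,9),(5,10),(5,14),(6,10),(6,11),(7,11),(7,12),(8,12),(8,13),(9,13),(9,14),(10,15),(11,16),(12,17),(13,18),(14,19),(15,16),(15,19),(16,17),(17,18),(18,19)]"

definition nbs :: "nat \<Rightarrow> nat list" where
  "nbs v = [[1, 4, 5],[0, 2, 6],[1, 3, 7],[2, 4, 8],[0, 3, 9],[0, 10, 14],[1, 10, 11],[2, 11, 12],[3, 12, 13],[4, 13, 14],[5, 6, 15],[6, 7, 16],[7, 8, 17],[8, 9, 18],[5, 9, 19],[10, 16, 19],[11, 15, 17],[12, 16, 18],[13, 17, 19],[14, 15, 18]] ! v"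

text \<open>Value tables of three generators: the rotation of order five about the axis, the
  reflection fixing 0, 5, 12 and 17, and the rotation of order three about the vertex 0.\<close>

definition symmetries :: "nat list list" where
  "symmetries =
    [[1,2,3,4,0,6,7,8,9,5,11,12,13,14,10,16,17,18,19,15],
     [0,4,3,2,1,5,9,8,7,6,14,13,12,11,10,19,18,17,16,15],
     [0,4,9,14,5,1,3,13,19,10,2,8,18,15,6,7,12,17,16,11]]"

text \<open>The \<open>i\<close>-th word, read as a product of symmetries, maps the path \<open>5, 0, 1\<close> to the \<open>i\<close>-th entry of
  \<open>two_paths\<close>.\<close>

definition symmetry_words :: "nat list list" where
  "symmetry_words = [
    [2], [2,1], [1,2], [2,2], [], [1],
    [0,1,2], [0,2,2], [0,2], [1,2,0], [0,1], [0],
    [0,0,1,2], [0,0,2,2], [0,0,2], [0,1,2,0], [0,0,1], [0,0],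
    [1,0,0,2], [1,0,1,2,0], [0,0,0,2], [0,0,1,2,0], [1,0,0], [0,0,0],
    [1,0,1,2], [2,0,1,2], [2,0,1], [2,0], [1,0,1], [1,0],
    [2,2,0,1,2], [2,1,0,1,2], [2,1,0,1], [2,1,0], [2,2,0,1], [2,2,0],
    [2,2,0,0,0,2], [0,2,2,0,1,2], [0,2,2,0,1], [0,2,2,0], [2,2,0,0,0], [1,2,0,0],
    [0,2,2,0,0,0,2], [0,0,2,2,0,1,2], [0,0,2,2,0,1], [0,0,2,2,0], [0,2,2,0,0,0], [0,1,2,0,0],
    [0,0,2,2,0,0,0,2], [2,0,1,2,0,0,0,2], [2,0,1,2,0,0,0], [1,0,1,2,0,0], [0,0,2,2,0,0,0], [0,0,1,2,0,0],
    [2,0,0,2,2], [2,0,0,1,2], [2,0,0,1], [2,0,0], [2,0,0,2], [2,0,1,2,0],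
    [1,2,0,0,0,2], [2,2,0,0,2,2], [2,2,0,0,2], [2,2,0,1,2,0], [1,2,0,0,0], [2,2,0,0],
    [0,1,2,0,0,0,2], [0,2,2,0,0,2,2], [0,2,2,0,0,2], [0,2,2,0,1,2,0], [0,1,2,0,0,0], [0,2,2,0,0],
    [0,0,1,2,0,0,0,2], [0,0,2,2,0,0,2,2], [0,0,2,2,0,0,2], [0,0,2,2,0,1,2,0], [0,0,1,2,0,0,0], [0,0,2,2,0,0],
    [2,0,0,2,2,0,1], [2,0,0,2,2,0], [1,0,1,2,0,0,0,2], [2,0,0,2,2,0,1,2], [2,0,1,2,0,0], [1,0,1,2,0,0,0],
    [2,0,0,0,2], [2,0,0,1,2,0], [2,1,0,0,2], [2,1,0,1,2,0], [2,0,0,0], [2,1,0,0],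
    [2,2,0,0,2,2,0,1,2], [2,1,0,1,2,0,0,0,2], [2,1,0,1,2,0,0,0], [2,2,0,1,2,0,0], [2,2,0,0,2,2,0,1], [2,2,0,0,2,2,0],
    [2,2,0,0,2,2,0,0,2], [2,2,0,0,2,2,0,1,2,0], [0,2,2,0,0,2,2,0,1], [0,2,2,0,0,2,2,0], [2,2,0,0,2,2,0,0], [0,2,2,0,1,2,0,0],
    [2,0,0,2,2,0,0,2,2,0], [2,2,0,0,2,2,0,1,2,0,0], [2,0,0,2,2,0,1,2,0,0], [0,0,2,2,0,0,2,2,0], [0,2,2,0,0,2,2,0,0], [0,0,2,2,0,1,2,0,0],
    [2,0,0,2,2,0,0,2,2], [2,0,0,1,2,0,0,0,2], [2,0,0,1,2,0,0,0], [2,0,0,2,2,0,0], [2,0,0,2,2,0,0,2], [2,0,0,2,2,0,1,2,0],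
    [2,2,0,1,2,0,0,0,2], [2,0,0,2,2,0,0,0,2], [2,0,0,2,2,0,0,0], [2,0,0,1,2,0,0], [2,2,0,1,2,0,0,0], [2,1,0,1,2,0,0]]"

definition two_paths :: "(nat \<times> nat \<times> nat) list" where
  "two_paths = concat (map (\<lambda>b. concat (map (\<lambda>a. map (\<lambda>c. (a, b, c)) (filter (\<lambda>c. c \<noteq> a) (nbs b))) (nbs b))) [0..<20])"

definition act :: "nat list \<Rightarrow> nat \<Rightarrow> nat" where
  "act w v = foldr (\<lambda>g u. symmetries ! g ! u) w v"

text \<open>Transitivity on paths with two edges, of which there are 120. It allows any such path to
  be labelled \<open>5, 0, 1\<close>.\<close>

lemma symmetry_words_reach: "map (\<lambda>w. (act w 5, act w 0, act w 1)) symmetry_words = two_paths"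
  by code_simp

lemma symmetries_edges: "list_all (\<lambda>g. list_all (\<lambda>(i, j). g ! j \<in> set (nbs (g ! i))) dedges) symmetries"
  by code_simp

definition face_pairs :: "'a list \<Rightarrow> ('a \<times> 'a) list" where
  "face_pairs f = zip f (rotate1 f)"

definition same_circuit :: "nat list \<Rightarrow> nat list \<Rightarrow> bool" where
  "same_circuit f g \<longleftrightarrow> list_all (\<lambda>(u, v). (u, v) \<in> set (face_pairs g) \<or> (v, u) \<in> set (face_pairs g)) (face_pairs f) \<and>
     list_all (\<lambda>(u, v). (u, v) \<in> set (face_pairs f) \<or> (v, u) \<in> set (face_pairs f)) (face_pairs g)"

text \<open>An exhaustive search along neighbour lists: the dodecahedron has no five-cycle besides
  its faces. Hence \<open>F\<close> is a face, and all isomorphisms give the same regions.\<close>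

lemma pentagons_check:
  "list_all (\<lambda>a. list_all (\<lambda>b. list_all (\<lambda>c. list_all (\<lambda>d. list_all (\<lambda>e.
     a \<notin> set (nbs e) \<or> \<not> distinct [a, b, c, d, e] \<or> list_ex (same_circuit [a, b, c, d, e]) dodecahedron_faces)
     (nbs d)) (nbs c)) (nbs b)) (nbs a)) [0..<20]"
  by code_simp

subsection \<open>Certificates for jump extensions\<close>

text \<open>The hop extension is normalized to the edges \<open>{0, 5}\<close> and \<open>{1, 2}\<close>, subdivided by \<open>20\<close> and \<open>21\<close>, so that
  its four-cycle is \<open>0, 20, 21, 1\<close>, attached to \<open>4, 5, 2, 6\<close>. In \<open>pentagon_graph r f\<close> this four-cycle is replaced by a
  pentagon with the additional vertex \<open>22\<close> (its position is given by \<open>r\<close>), which is joined to a new vertex \<open>23\<close>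
  on the edge \<open>f\<close>. A certificate \<open>(e, f', p, ep, q, eq, ov)\<close> says that deleting the edge \<open>p q\<close> and
  suppressing its ends (which then lie inside the images of \<open>ep\<close> and \<open>eq\<close>) leaves the extension by \<open>e\<close> and \<open>f'\<close>;
  \<open>ov\<close> lists where the vertex map differs from the identity.\<close>

type_synonym cert =
  "(nat \<times> nat) \<times> (nat \<times> nat) \<times> nat \<times> (nat \<times> nat) \<times> nat \<times> (nat \<times> nat) \<times> (nat \<times> nat) list"

text \<open>The pairs in \<open>dedges\<close> are increasing, so \<open>1 < i\<close> drops exactly
  the edges at 0 or 1.\<close>

definition core_edges :: "(nat \<times> nat) list" where
  "core_edges = filter (\<lambda>(i, j). 1 < i) dedges"

definition attachment :: "nat \<Rightarrow> nat" where
  "attachment n = (if n = 0 then 4 else if n = 20 then 5 else if n = 21 then 2 else 6)"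

text \<open>The vertex 22 sits between 1 and 0 for \<open>r = 0\<close>, between 0 and 20 for
  \<open>r = 1\<close>, between 20 and 21 for \<open>r = 2\<close>, and between 21 and 1 for
  \<open>r = 3\<close>. These are the four gaps of \<open>pent_at\<close>, in the same
  order.\<close>

definition pentagon_part :: "nat \<Rightarrow> (nat \<times> nat) list" where
  "pentagon_part r = (let ns = rotate r [0, 20, 21, 1] in
     zip (22 # ns) (ns @ [22]) @ (22, 23) # map (\<lambda>n. (n, attachment n)) ns)"

definition pentagon_graph :: "nat \<Rightarrow> nat \<times> nat \<Rightarrow> (nat \<times> nat) list" where
  "pentagon_graph r f = filter (\<lambda>e. e \<noteq> f) core_edges @ [(fst f, 23), (23, snd f)] @ pentagon_part r"

definition plus_list :: "nat \<times> nat \<Rightarrow> nat \<times> nat \<Rightarrow> (nat \<times> nat) list" where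
  "plus_list e f = filter (\<lambda>x. x \<noteq> e \<and> x \<noteq> f) dedges @
     [(fst e, 20), (20, snd e), (fst f, 21), (21, snd f), (20, 21)]"

definition linked :: "(nat \<times> nat) list \<Rightarrow> nat \<Rightarrow> nat \<Rightarrow> bool" where
  "linked L u v \<longleftrightarrow> list_ex (\<lambda>(i, j). i = u \<and> j = v \<or> i = v \<and> j = u) L"

definition relabel :: "(nat \<times> nat) list \<Rightarrow> nat \<Rightarrow> nat" where
  "relabel ov i = (case map_of ov i of None \<Rightarrow> i | Some j \<Rightarrow> j)"

definition on_face :: "nat \<times> nat \<Rightarrow> nat list \<Rightarrow> bool" where
  "on_face e g \<longleftrightarrow> e \<in> set (face_pairs g) \<or> (snd e, fst e) \<in> set (face_pairs g)"

fun cert_embeds :: "(nat \<times> nat) list \<Rightarrow> cert \<Rightarrow> bool" where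
  "cert_embeds L (e, f, p, ep, q, eq, ov) \<longleftrightarrow>
     e \<in> set dedges \<and> f \<in> set dedges \<and> e \<noteq> f \<and>
     distinct (map (relabel ov) [0..<22] @ [p, q]) \<and>
     list_all (\<lambda>v. v < 24) (map (relabel ov) [0..<22] @ [p, q]) \<and>
     list_all (\<lambda>x. let u = relabel ov (fst x); v = relabel ov (snd x) in
       if x = ep then linked L u p \<and> linked L p v
       else if x = eq then linked L u q \<and> linked L q v
       else linked L u v) (plus_list e f)"

fun cert_jumps :: "cert \<Rightarrow> bool" where
  "cert_jumps (e, f, p, ep, q, eq, ov) \<longleftrightarrow>
     list_all (\<lambda>g. \<not> (on_face e g \<and> on_face f g)) dodecahedron_faces \<and>
     list_all (\<lambda>a. list_all (\<lambda>b. a \<noteq> b \<and> b \<notin> set (nbs a)) [fst f, snd f]) [fst e, snd e]"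

text \<open>The edges \<open>ep\<close> and \<open>eq\<close> have to stay off the face just like
  \<open>e\<close> and \<open>f\<close>: their images receive an inner vertex, whereas an edge of
  \<open>F\<close> must remain a single edge.\<close>

fun cert_fixes :: "nat list \<Rightarrow> cert \<Rightarrow> bool" where
  "cert_fixes g (e, f, p, ep, q, eq, ov) \<longleftrightarrow>
     list_all (\<lambda>i. relabel ov i = i) g \<and> \<not> on_face e g \<and> \<not> on_face f g \<and> \<not> on_face ep g \<and> \<not> on_face eq g \<and>
     \<not> ((fst e \<in> set g \<or> snd e \<in> set g) \<and> (fst f \<in> set g \<or> snd f \<in> set g))"

text \<open>Here 22 subdivides \<open>(0,1)\<close>. Most rows delete \<open>20 21\<close> and keep
  \<open>22 23\<close> as the jump from \<open>(0,1)\<close> to \<open>f\<close>. The eight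
  exceptions are the edges \<open>f\<close> with an end in 2, 4, 5 or 6, the neighbours of 0 and 1,
  for which \<open>(0,1)\<close> and \<open>f\<close> are not diverse.\<close>

definition certs0 :: "((nat \<times> nat) \<times> cert list) list" where
  "certs0 = [
    ((2,3),[((0,5),(2,7),1,(1,6),21,(20,21),[(1,22),(2,23),(21,2)])]),
    ((2,7),[((0,5),(2,3),1,(1,6),21,(20,21),[(1,22),(2,23),(21,2)])]),
    ((3,4),[((1,6),(3,4),0,(0,4),22,(20,21),[(0,20),(1,21),(20,1),(21,23)])]),
    ((3,8),[((0,1),(3,8),20,(0,5),21,(1,2),[(20,22),(21,23)])]),
    ((4,9),[((1,6),(4,9),0,(0,4),22,(20,21),[(0,20),(1,21),(20,1),(21,23)])]),
    ((5,10),[((1,2),(5,14),0,(0,4),20,(20,21),[(0,22),(5,23),(20,21),(21,5)])]),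
    ((5,14),[((1,2),(5,10),0,(0,4),20,(20,21),[(0,22),(5,23),(20,21),(21,5)])]),
    ((6,10),[((0,4),(6,10),1,(1,6),22,(20,21),[(0,20),(1,21),(20,0),(21,23)])]),
    ((6,11),[((0,4),(6,11),1,(1,6),22,(20,21),[(0,20),(1,21),(20,0),(21,23)])]),
    ((7,11),[((0,1),(7,11),20,(0,5),21,(1,2),[(20,22),(21,23)])]),
    ((7,12),[((0,1),(7,12),20,(0,5),21,(1,2),[(20,22),(21,23)])]),
    ((8,12),[((0,1),(8,12),20,(0,5),21,(1,2),[(20,22),(21,23)])]),
    ((8,13),[((0,1),(8,13),20,(0,5),21,(1,2),[(20,22),(21,23)])]),
    ((9,13),[((0,1),(9,13),20,(0,5),21,(1,2),[(20,22),(21,23)])]),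
    ((9,14),[((0,1),(9,14),20,(0,5),21,(1,2),[(20,22),(21,23)])]),
    ((10,15),[((0,1),(10,15),20,(0,5),21,(1,2),[(20,22),(21,23)])]),
    ((11,16),[((0,1),(11,16),20,(0,5),21,(1,2),[(20,22),(21,23)])]),
    ((12,17),[((0,1),(12,17),20,(0,5),21,(1,2),[(20,22),(21,23)])]),
    ((13,18),[((0,1),(13,18),20,(0,5),21,(1,2),[(20,22),(21,23)])]),
    ((14,19),[((0,1),(14,19),20,(0,5),21,(1,2),[(20,22),(21,23)])]),
    ((15,16),[((0,1),(15,16),20,(0,5),21,(1,2),[(20,22),(21,23)])]),
    ((15,19),[((0,1),(15,19),20,(0,5),21,(1,2),[(20,22),(21,23)])]),
    ((16,17),[((0,1),(16,17),20,(0,5),21,(1,2),[(20,22),(21,23)])]),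
    ((17,18),[((0,1),(17,18),20,(0,5),21,(1,2),[(20,22),(21,23)])]),
    ((18,19),[((0,1),(18,19),20,(0,5),21,(1,2),[(20,22),(21,23)])])]"

text \<open>The row of \<open>(9,14)\<close> has two certificates. The first moves 5 and 14 and
  fails if \<open>F\<close> is the face \<open>14, 5, 10, 15, 19\<close>; the second moves 4 and 9
  and fails if \<open>F\<close> is the face \<open>3, 4, 9, 13, 8\<close>.\<close>

definition certs1 :: "((nat \<times> nat) \<times> cert list) list" where
  "certs1 = [
    ((2,3),[((0,5),(2,3),20,(20,5),21,(1,2),[(20,22),(21,23)])]),
    ((2,7),[((0,5),(2,7),20,(20,5),21,(1,2),[(20,22),(21,23)])]),
    ((3,4),[((1,6),(4,9),0,(20,21),22,(0,4),[(0,20),(1,21),(4,23),(20,1),(21,4)])]),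
    ((3,8),[((0,5),(3,8),20,(20,5),21,(1,2),[(20,22),(21,23)])]),
    ((4,9),[((1,6),(3,4),0,(20,21),22,(0,4),[(0,20),(1,21),(4,23),(20,1),(21,4)])]),
    ((5,10),[((1,2),(5,14),20,(20,21),22,(0,5),[(5,23),(20,21),(21,5)])]),
    ((5,14),[((1,2),(5,10),20,(20,21),22,(0,5),[(5,23),(20,21),(21,5)])]),
    ((6,10),[((0,4),(6,10),0,(20,4),1,(1,6),[(0,20),(1,21),(20,22),(21,23)])]),
    ((6,11),[((0,5),(6,11),20,(20,5),21,(1,2),[(20,22),(21,23)])]),
    ((7,11),[((0,5),(7,11),20,(20,5),21,(1,2),[(20,22),(21,23)])]),
    ((7,12),[((0,5),(7,12),20,(20,5),21,(1,2),[(20,22),(21,23)])]),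
    ((8,12),[((0,5),(8,12),20,(20,5),21,(1,2),[(20,22),(21,23)])]),
    ((8,13),[((0,5),(8,13),20,(20,5),21,(1,2),[(20,22),(21,23)])]),
    ((9,13),[((0,5),(9,13),20,(20,5),21,(1,2),[(20,22),(21,23)])]),
    ((9,14),[((1,2),(5,10),5,(21,10),14,(14,19),[(5,22),(14,23),(20,21),(21,20)]), ((1,6),(3,4),4,(3,21),9,(9,13),[(0,20),(1,21),(4,22),(9,23),(20,1),(21,0)])]),
    ((10,15),[((0,4),(10,15),0,(20,4),1,(1,6),[(0,20),(1,21),(20,22),(21,23)])]),
    ((11,16),[((0,5),(11,16),20,(20,5),21,(1,2),[(20,22),(21,23)])]),
    ((12,17),[((0,5),(12,17),20,(20,5),21,(1,2),[(20,22),(21,23)])]),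
    ((13,18),[((0,5),(13,18),20,(20,5),21,(1,2),[(20,22),(21,23)])]),
    ((14,19),[((0,4),(14,19),0,(20,4),1,(1,6),[(0,20),(1,21),(20,22),(21,23)])]),
    ((15,16),[((0,4),(15,16),0,(20,4),1,(1,6),[(0,20),(1,21),(20,22),(21,23)])]),
    ((15,19),[((0,5),(15,19),20,(20,5),21,(1,2),[(20,22),(21,23)])]),
    ((16,17),[((0,5),(16,17),20,(20,5),21,(1,2),[(20,22),(21,23)])]),
    ((17,18),[((0,5),(17,18),20,(20,5),21,(1,2),[(20,22),(21,23)])]),
    ((18,19),[((0,4),(18,19),0,(20,4),1,(1,6),[(0,20),(1,21),(20,22),(21,23)])])]"

definition certs2 :: "((nat \<times> nat) \<times> cert list) list" where
  "certs2 = [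
    ((2,3),[((0,5),(2,3),21,(1,2),22,(20,21),[(21,23)])]),
    ((2,7),[((0,5),(2,7),21,(1,2),22,(20,21),[(21,23)])]),
    ((3,4),[((1,6),(4,9),0,(20,21),20,(0,5),[(0,22),(1,21),(4,23),(20,1),(21,4)])]),
    ((3,8),[((0,5),(3,8),21,(1,2),22,(20,21),[(21,23)])]),
    ((4,9),[((1,2),(4,9),20,(0,5),22,(20,21),[(20,21),(21,23)])]),
    ((5,10),[((1,2),(5,10),20,(0,5),22,(20,21),[(20,21),(21,23)])]),
    ((5,14),[((1,2),(5,14),20,(0,5),22,(20,21),[(20,21),(21,23)])]),
    ((6,10),[((0,4),(6,11),1,(20,21),21,(1,2),[(0,20),(1,22),(6,23),(20,0),(21,6)])]),
    ((6,11),[((0,5),(6,11),21,(1,2),22,(20,21),[(21,23)])]),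
    ((7,11),[((0,5),(7,11),21,(1,2),22,(20,21),[(21,23)])]),
    ((7,12),[((0,5),(7,12),21,(1,2),22,(20,21),[(21,23)])]),
    ((8,12),[((0,5),(8,12),21,(1,2),22,(20,21),[(21,23)])]),
    ((8,13),[((0,5),(8,13),21,(1,2),22,(20,21),[(21,23)])]),
    ((9,13),[((0,5),(9,13),21,(1,2),22,(20,21),[(21,23)])]),
    ((9,14),[((1,2),(9,14),20,(0,5),22,(20,21),[(20,21),(21,23)])]),
    ((10,15),[((1,2),(10,15),20,(0,5),22,(20,21),[(20,21),(21,23)])]),
    ((11,16),[((0,5),(11,16),21,(1,2),22,(20,21),[(21,23)])]),
    ((12,17),[((0,5),(12,17),21,(1,2),22,(20,21),[(21,23)])]),
    ((13,18),[((0,5),(13,18),21,(1,2),22,(20,21),[(21,23)])]),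
    ((14,19),[((1,2),(14,19),20,(0,5),22,(20,21),[(20,21),(21,23)])]),
    ((15,16),[((1,2),(15,16),20,(0,5),22,(20,21),[(20,21),(21,23)])]),
    ((15,19),[((0,5),(15,19),21,(1,2),22,(20,21),[(21,23)])]),
    ((16,17),[((0,5),(16,17),21,(1,2),22,(20,21),[(21,23)])]),
    ((17,18),[((0,5),(17,18),21,(1,2),22,(20,21),[(21,23)])]),
    ((18,19),[((1,2),(18,19),20,(0,5),22,(20,21),[(20,21),(21,23)])])]"

text \<open>The row of \<open>(7,11)\<close> has two certificates. The first moves 2 and 7 and fails
  if \<open>F\<close> is the face \<open>2, 3, 8, 12, 7\<close>; the second moves 6 and 11 and fails
  if \<open>F\<close> is the face \<open>10, 6, 11, 16, 15\<close>.\<close>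

definition certs3 :: "((nat \<times> nat) \<times> cert list) list" where
  "certs3 = [
    ((2,3),[((0,5),(2,7),2,(21,7),23,(2,3),[(2,22)])]),
    ((2,7),[((0,5),(2,3),2,(21,3),23,(2,7),[(2,22)])]),
    ((3,4),[((1,6),(3,4),0,(0,4),1,(20,6),[(0,20),(1,21),(20,22),(21,23)])]),
    ((3,8),[((0,5),(2,7),2,(21,7),3,(3,4),[(2,22),(3,23)])]),
    ((4,9),[((1,2),(4,9),20,(0,5),21,(20,2),[(20,22),(21,23)])]),
    ((5,10),[((1,2),(5,10),20,(0,5),21,(20,2),[(20,22),(21,23)])]),
    ((5,14),[((1,2),(5,14),20,(0,5),21,(20,2),[(20,22),(21,23)])]),
    ((6,10),[((0,4),(6,11),1,(20,21),22,(1,6),[(0,20),(1,21),(6,23),(20,0),(21,6)])]),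
    ((6,11),[((0,4),(6,10),1,(20,21),22,(1,6),[(0,20),(1,21),(6,23),(20,0),(21,6)])]),
    ((7,11),[((0,5),(2,3),2,(21,3),7,(7,12),[(2,22),(7,23)]), ((0,4),(6,10),6,(21,10),11,(11,16),[(0,20),(1,21),(6,22),(11,23),(20,0),(21,1)])]),
    ((7,12),[((0,5),(2,3),2,(21,3),7,(7,11),[(2,22),(7,23)])]),
    ((8,12),[((1,2),(8,12),20,(0,5),21,(20,2),[(20,22),(21,23)])]),
    ((8,13),[((1,6),(8,13),0,(0,4),1,(20,6),[(0,20),(1,21),(20,22),(21,23)])]),
    ((9,13),[((1,2),(9,13),20,(0,5),21,(20,2),[(20,22),(21,23)])]),
    ((9,14),[((1,2),(9,14),20,(0,5),21,(20,2),[(20,22),(21,23)])]),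
    ((10,15),[((1,2),(10,15),20,(0,5),21,(20,2),[(20,22),(21,23)])]),
    ((11,16),[((1,2),(11,16),20,(0,5),21,(20,2),[(20,22),(21,23)])]),
    ((12,17),[((1,6),(12,17),0,(0,4),1,(20,6),[(0,20),(1,21),(20,22),(21,23)])]),
    ((13,18),[((1,2),(13,18),20,(0,5),21,(20,2),[(20,22),(21,23)])]),
    ((14,19),[((1,2),(14,19),20,(0,5),21,(20,2),[(20,22),(21,23)])]),
    ((15,16),[((1,2),(15,16),20,(0,5),21,(20,2),[(20,22),(21,23)])]),
    ((15,19),[((1,2),(15,19),20,(0,5),21,(20,2),[(20,22),(21,23)])]),
    ((16,17),[((1,2),(16,17),20,(0,5),21,(20,2),[(20,22),(21,23)])]),
    ((17,18),[((1,2),(17,18),20,(0,5),21,(20,2),[(20,22),(21,23)])]),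
    ((18,19),[((1,2),(18,19),20,(0,5),21,(20,2),[(20,22),(21,23)])])]"

text \<open>Comparing the first components with \<open>core_edges\<close> ensures that no edge
  \<open>f\<close> is forgotten. Faces through 0 or 1 are exempt because \<open>F\<close> avoids
  these vertices, and faces containing \<open>f\<close> because the path of an edge of
  \<open>F\<close> has no inner vertex that could be hit.\<close>

definition certs_ok :: "nat \<Rightarrow> ((nat \<times> nat) \<times> cert list) list \<Rightarrow> bool" where
  "certs_ok r rows \<longleftrightarrow> map fst rows = core_edges \<and>
     list_all (\<lambda>(f, cs). list_all (\<lambda>c. cert_embeds (pentagon_graph r f) c \<and> cert_jumps c) cs \<and>
       list_all (\<lambda>g. 0 \<in> set g \<or> 1 \<in> set g \<or> on_face f g \<or> list_ex (cert_fixes g) cs) dodecahedron_faces) rows"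

lemma certs_check: "certs_ok 0 certs0" "certs_ok 1 certs1" "certs_ok 2 certs2" "certs_ok 3 certs3"
  by code_simp+

section \<open>Modifying embeddings\<close>

lemma model_mono:
  assumes "model H V E \<eta> I" "V' \<subseteq> V" "E' \<subseteq> E"
  shows "model H V' E' \<eta> I"
proof -
  have "inj_on \<eta> V'" using assms by (auto simp: model_def intro: inj_on_subset)
  moreover have "\<eta> ` V' \<subseteq> \<eta> ` V" using assms(2) by blast
  ultimately show ?thesis using assms(1,3) unfolding model_def by (meson Diff_mono order_trans subsetD order_refl)
qed

lemma model_avoid: "model H V E \<eta> I \<Longrightarrow> e \<in> E \<Longrightarrow> i \<in> V \<Longrightarrow> \<eta> i \<notin> set (I e)"
  unfolding model_def by (cases e) blast

lemma distinct_concat_disjoint: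
  assumes "distinct (concat (map I es))" "e \<in> set es"
  shows "distinct (I e)" and "e' \<in> set es \<Longrightarrow> e \<noteq> e' \<Longrightarrow> set (I e) \<inter> set (I e') = {}"
  using assms by (induction es) auto

lemma distinct_concat_if:
  "distinct es \<Longrightarrow> (\<And>e. e \<in> set es \<Longrightarrow> distinct (I e)) \<Longrightarrow>
   (\<And>e e'. e \<in> set es \<Longrightarrow> e' \<in> set es \<Longrightarrow> e \<noteq> e' \<Longrightarrow> set (I e) \<inter> set (I e') = {}) \<Longrightarrow>
   distinct (concat (map I es))"
proof (induction es)
  case (Cons e es)
  have "set (I e) \<inter> set (I e') = {}" if "e' \<in> set es" for e'
    using Cons.prems(3)[of e e'] Cons.prems(1) that by (metis distinct.simps(2) list.set_intros)
  then have "set (I e) \<inter> (\<Union>e'\<in>set es. set (I e')) = {}" by blast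
  then show ?case using Cons by simp
qed simp

lemma model_distinct:
  assumes m: "model H V E \<eta> I" and "distinct vs" "set vs \<subseteq> V" "distinct es" "set es \<subseteq> E"
  shows "distinct (map \<eta> vs @ concat (map I es))"
proof -
  have "inj_on \<eta> (set vs)" using m assms(3) by (auto simp: model_def intro: inj_on_subset)
  then have "distinct (map \<eta> vs)" using assms(2) by (simp add: distinct_map)
  moreover have "distinct (concat (map I es))"
  proof (rule distinct_concat_if[OF assms(4)])
    show "distinct (I e)" if "e \<in> set es" for e
      using m that assms(5) by (cases e) (auto simp: model_def)
    show "set (I e) \<inter> set (I e') = {}" if "e \<in> set es" "e' \<in> set es" "e \<noteq> e'" for e e'
      using m that assms(5) unfolding model_def by blast
  qed
  moreover have "set (map \<eta> vs) \<inter> set (concat (map I es)) = {}"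
    using model_avoid[OF m] assms(3,5) by fastforce
  ultimately show ?thesis by simp
qed

lemma model_cong:
  assumes "model H V E \<eta> I" "oriented V E" "\<And>i. i \<in> V \<Longrightarrow> \<eta>' i = \<eta> i" "\<And>e. e \<in> E \<Longrightarrow> I' e = I e"
  shows "model H V E \<eta>' I'"
proof -
  have "\<eta>' ` V = \<eta> ` V" "inj_on \<eta>' V = inj_on \<eta> V"
    using assms(3) by (auto cong: inj_on_cong image_cong)
  moreover have "i \<in> V" "j \<in> V" if "(i, j) \<in> E" for i j using assms(2) that by (auto simp: oriented_def)
  ultimately show ?thesis using assms(1,3,4) unfolding model_def by simp
qed

definition image_of :: "nat set \<Rightarrow> (nat \<times> nat) set \<Rightarrow> (nat \<Rightarrow> 'a) \<Rightarrow> (nat \<times> nat \<Rightarrow> 'a list) \<Rightarrow> 'a set" where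
  "image_of V E \<eta> I = \<eta> ` V \<union> (\<Union>e\<in>E. set (I e))"

text \<open>An inner vertex of a path is promoted to a branch vertex. In this way the core edge that
  is hit acquires the vertex 23.\<close>

lemma model_subdivide:
  assumes m: "model H V E \<eta> I" and ori: "oriented V E" and f: "(i, j) \<in> E" and x: "x \<notin> V"
    and I: "I (i, j) = I1 @ u # I2"
  shows "model H (insert x V) ((E - {(i, j)}) \<union> {(i, x), (x, j)}) (\<eta>(x := u)) (I((i, x) := I1, (x, j) := I2))"
    (is "model H ?V ?E ?\<eta> ?I")
proof -
  have m1: "inj_on \<eta> V" "\<eta> ` V \<subseteq> verts H" using m by (simp_all add: model_def)
  have m2: "distinct (I (i, j))" "set (I (i, j)) \<subseteq> verts H - \<eta> ` V" "walk H (\<eta> i # I (i, j) @ [\<eta> j])"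
    if "(i, j) \<in> E" for i j using m that by (simp_all add: model_def)
  have m3: "set (I e) \<inter> set (I e') = {}" if "e \<in> E" "e' \<in> E" "e \<noteq> e'" for e e'
    using m that by (simp add: model_def)
  have V: "i \<in> V" "j \<in> V" "i \<noteq> j" "x \<noteq> i" "x \<noteq> j" if "(i, j) \<in> E" for i j
    using that ori x by (auto simp: oriented_def)
  note ij = V[OF f] m2[OF f, unfolded I]
  have old: "?I e = I e" if "e \<in> E" for e using V[of "fst e" "snd e"] that by (cases e) auto
  have new: "?I (i, x) = I1" "?I (x, j) = I2" using ij by auto
  have \<eta>: "?\<eta> k = \<eta> k" if "k \<in> V" for k using that x by auto
  have imgV: "?\<eta> ` V = \<eta> ` V" by (rule image_cong[OF refl \<eta>])
  then have img: "?\<eta> ` ?V = insert u (\<eta> ` V)" by (simp only: image_insert fun_upd_same)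
  have w: "walk H (\<eta> i # I1 @ [u])" "walk H (u # I2 @ [\<eta> j])"
    using walk_appendD(1)[of H "\<eta> i # I1 @ [u]" "I2 @ [\<eta> j]"] walk_appendD(2)[of H "\<eta> i # I1" "u # I2 @ [\<eta> j]"] ij
    by simp_all
  have out: "set (I e) \<inter> set (I1 @ u # I2) = {}" if "e \<in> E" "e \<noteq> (i, j)" for e
    using m3[OF that(1) f that(2)] by (simp add: I)
  show ?thesis
    unfolding model_def
  proof (intro conjI allI impI ballI)
    show "inj_on ?\<eta> ?V" 
    proof -
      have "inj_on ?\<eta> V = inj_on \<eta> V" by (rule inj_on_cong) (rule \<eta>)
      then have "inj_on ?\<eta> V" using m1(1) by (simp only:)
      moreover have "u \<notin> ?\<eta> ` V" unfolding imgV using ij(7) by auto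
      then have "?\<eta> x \<notin> ?\<eta> ` (V - {x})" unfolding fun_upd_same by blast
      ultimately show ?thesis by (simp only: inj_on_insert simp_thms)
    qed
    show "?\<eta> ` ?V \<subseteq> verts H" unfolding img using m1(2) ij(7) by auto
  next
    fix k l assume "(k, l) \<in> ?E"
    then consider "(k, l) \<in> E" "(k, l) \<noteq> (i, j)" | "k = i" "l = x" | "k = x" "l = j" by blast
    then have "distinct (?I (k, l)) \<and> set (?I (k, l)) \<subseteq> verts H - insert u (\<eta> ` V) \<and>
      walk H (?\<eta> k # ?I (k, l) @ [?\<eta> l])"
    proof cases
      case 1
      have "u \<notin> set (I (k, l))" using out[OF 1] by auto
      then have "set (I (k, l)) \<subseteq> verts H - insert u (\<eta> ` V)" using m2(2)[OF 1(1)] by blast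
      moreover have "?\<eta> k = \<eta> k" "?\<eta> l = \<eta> l" using V[OF 1(1)] by simp_all
      ultimately show ?thesis using m2(1,3)[OF 1(1)] unfolding old[OF 1(1)] by metis
    next
      case 2
      have "set I1 \<subseteq> verts H - insert u (\<eta> ` V)" "distinct I1" using ij(6,7) by auto
      moreover have "?\<eta> i = \<eta> i" "?\<eta> x = u" using ij by simp_all
      ultimately show ?thesis using w(1) unfolding 2 new by metis
    next
      case 3
      have "set I2 \<subseteq> verts H - insert u (\<eta> ` V)" "distinct I2" using ij(6,7) by auto
      moreover have "?\<eta> j = \<eta> j" "?\<eta> x = u" using ij by simp_all
      ultimately show ?thesis using w(2) unfolding 3 new by metis
    qed
    then show "distinct (?I (k, l))" "set (?I (k, l)) \<subseteq> verts H - ?\<eta> ` ?V" "walk H (?\<eta> k # ?I (k, l) @ [?\<eta> l])"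
      unfolding img by blast+
  next
    fix e e' assume e: "e \<in> ?E" "e' \<in> ?E" "e \<noteq> e'"
    have sub: "set I1 \<subseteq> set (I1 @ u # I2)" "set I2 \<subseteq> set (I1 @ u # I2)" by auto
    have d: "set I1 \<inter> set I2 = {}" "set I2 \<inter> set I1 = {}" using ij(6) by auto
    have o: "set (I e) \<inter> set I1 = {}" "set (I e) \<inter> set I2 = {}" "set I1 \<inter> set (I e) = {}" "set I2 \<inter> set (I e) = {}"
      if "e \<in> E" "e \<noteq> (i, j)" for e using out[OF that] sub by blast+
    from e(1,2) have "e = (i, x) \<or> e = (x, j) \<or> e \<in> E \<and> e \<noteq> (i, j)" "e' = (i, x) \<or> e' = (x, j) \<or> e' \<in> E \<and> e' \<noteq> (i, j)"
      by auto
    then show "set (?I e) \<inter> set (?I e') = {}"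
      using e(3) by (elim disjE conjE) (simp_all add: new old d o m3 del: fun_upd_apply)
  qed
qed

definition override :: "('b \<Rightarrow> 'c) \<Rightarrow> 'b list \<Rightarrow> 'c list \<Rightarrow> 'b \<Rightarrow> 'c" where
  "override g xs ys x = (case map_of (zip xs ys) x of None \<Rightarrow> g x | Some y \<Rightarrow> y)"

lemma override_simps [simp]:
  "override g [] ys x = g x"
  "override g (a # xs) (b # ys) x = (if x = a then b else override g xs ys x)"
  by (simp_all add: override_def)

lemma override_other: "x \<notin> set xs \<Longrightarrow> override g xs ys x = g x"
  by (induction xs ys rule: list_induct2') (simp_all add: override_def)

lemma map_override: "length xs = length ys \<Longrightarrow> distinct xs \<Longrightarrow> map (override g xs ys) xs = ys"
proof (induction xs ys rule: list_induct2)
  case (Cons x xs y ys)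
  then have "map (override g (x # xs) (y # ys)) xs = map (override g xs ys) xs" by (intro map_cong) auto
  also have "\<dots> = ys" using Cons by simp
  finally have "map (override g (x # xs) (y # ys)) xs = ys" .
  moreover have "override g (x # xs) (y # ys) x = y" by simp
  ultimately show ?case by (simp only: list.map)
qed simp

text \<open>Everything new is mapped outside a set \<open>M\<close> that covers the old image, so
  old and new parts cannot meet. What remains is distinctness among the new vertices and paths,
  collected in one list.\<close>

lemma model_extend:
  assumes m: "model H V E \<eta> I" and ori: "oriented V E" and M: "image_of V E \<eta> I \<subseteq> M"
    and vs: "distinct vs" "set vs \<inter> V = {}" "length ps = length vs"
    and es: "distinct es" "set es \<inter> E = {}" "length ls = length es"
    and new: "distinct (ps @ concat ls)" "set (ps @ concat ls) \<subseteq> verts H - M"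
    and w: "\<And>i j. (i, j) \<in> set es \<Longrightarrow>
      walk H (override \<eta> vs ps i # override I es ls (i, j) @ [override \<eta> vs ps j])"
  shows "model H (V \<union> set vs) (E \<union> set es) (override \<eta> vs ps) (override I es ls)"
proof -
  let ?\<eta> = "override \<eta> vs ps" and ?I = "override I es ls"
  have old: "?\<eta> i = \<eta> i" if "i \<in> V" for i using that vs(2) by (intro override_other) blast
  have oldI: "?I e = I e" if "e \<in> E" for e using that es(2) by (intro override_other) blast
  have m': "model H V E ?\<eta> ?I" by (rule model_cong[OF m ori old oldI])
  have img: "?\<eta> ` V \<subseteq> M" "\<And>e. e \<in> E \<Longrightarrow> set (?I e) \<subseteq> M"
    using M old oldI unfolding image_of_def by (simp_all add: UN_subset_iff)
  have mv: "map ?\<eta> vs = ps" and me: "map ?I es = ls" using map_override vs es by metis+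
  have d: "distinct (map ?\<eta> vs)" "distinct (concat (map ?I es))" "set (map ?\<eta> vs) \<inter> set (concat (map ?I es)) = {}"
    using new(1) unfolding mv me by simp_all
  have n: "?\<eta> ` set vs \<subseteq> verts H - M" "\<And>e. e \<in> set es \<Longrightarrow> set (?I e) \<subseteq> verts H - M"
    using new(2) mv me by (metis Un_subset_iff set_append set_map, metis UN_subset_iff Un_subset_iff set_append set_concat set_map image_eqI)
  have m1: "inj_on ?\<eta> V" "?\<eta> ` V \<subseteq> verts H" using m' by (simp_all add: model_def)
  have m2: "distinct (?I (i, j))" "set (?I (i, j)) \<subseteq> verts H - ?\<eta> ` V" "walk H (?\<eta> i # ?I (i, j) @ [?\<eta> j])"
    if "(i, j) \<in> E" for i j using m' that by (simp_all add: model_def)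
  show ?thesis
    unfolding model_def
  proof (intro conjI allI impI ballI)
    have "?\<eta> ` V \<inter> ?\<eta> ` set vs = {}" using img(1) n(1) by blast
    then show "inj_on ?\<eta> (V \<union> set vs)"
      using m1(1) d(1) by (auto simp: inj_on_Un distinct_map)
    show "?\<eta> ` (V \<union> set vs) \<subseteq> verts H" using m1(2) n(1) by blast
  next
    fix i j assume "(i, j) \<in> E \<union> set es"
    then consider "(i, j) \<in> E" | "(i, j) \<in> set es" by blast
    then have "distinct (?I (i, j)) \<and> set (?I (i, j)) \<subseteq> verts H - ?\<eta> ` (V \<union> set vs) \<and>
      walk H (?\<eta> i # ?I (i, j) @ [?\<eta> j])"
    proof cases
      case 1
      have "set (?I (i, j)) \<inter> ?\<eta> ` set vs = {}" using img(2)[OF 1] n(1) by blast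
      then show ?thesis using m2[OF 1] by blast
    next
      case 2
      have "set (?I (i, j)) \<inter> ?\<eta> ` set vs = {}" using d(3) 2 by fastforce
      moreover have "set (?I (i, j)) \<subseteq> verts H - ?\<eta> ` V" using n(2)[OF 2] img(1) by blast
      ultimately show ?thesis using distinct_concat_disjoint(1)[OF d(2) 2] w[OF 2] by blast
    qed
    then show "distinct (?I (i, j))" "set (?I (i, j)) \<subseteq> verts H - ?\<eta> ` (V \<union> set vs)"
      "walk H (?\<eta> i # ?I (i, j) @ [?\<eta> j])" by blast+
  next
    fix e e' assume e: "e \<in> E \<union> set es" "e' \<in> E \<union> set es" "e \<noteq> e'"
    then consider "e \<in> E" "e' \<in> E" | "e \<in> set es" "e' \<in> set es" | "e \<in> E" "e' \<in> set es" | "e \<in> set es" "e' \<in> E"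
      by blast
    then show "set (?I e) \<inter> set (?I e') = {}"
    proof cases
      case 1
      then show ?thesis using m' e(3) by (simp add: model_def)
    next
      case 2
      then show ?thesis using distinct_concat_disjoint(2)[OF d(2)] e(3) by blast
    next
      case 3
      then show ?thesis using img(2)[of e] n(2)[of e'] by blast
    next
      case 4
      then show ?thesis using img(2)[of e'] n(2)[of e] by blast
    qed
  qed
qed

lemma adj_sym: "adj E u v \<Longrightarrow> adj E v u" by (auto simp: adj_def)

text \<open>The paths of the three model edges at \<open>i\<close> begin with three different
  neighbours of \<open>\<eta> i\<close>, and in a cubic graph there is no fourth.\<close>

lemma model_neighbour:
  assumes "cubic H" and m: "model H V E \<eta> I" and ori: "oriented V E"
    and a: "adj E i j" "adj E i k" "adj E i l" "j \<noteq> k" "j \<noteq> l" "k \<noteq> l"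
    and w: "{\<eta> i, w} \<in> edges H"
  shows "\<exists>h\<in>{j, k, l}. w = hd (seg E I i h @ [\<eta> h])"
proof -
  let ?s = "\<lambda>h. hd (seg E I i h @ [\<eta> h])"
  have V: "i \<in> V \<and> h \<in> V" if "adj E i h" for h using that ori by (auto simp: adj_def oriented_def)
  have inj: "inj_on \<eta> V" "\<eta> ` V \<subseteq> verts H" using m by (simp_all add: model_def)
  have e: "{\<eta> i, ?s h} \<in> edges H" if "adj E i h" for h
    using model_seg(3)[OF m that] by (simp add: walk_Cons)
  have cases: "?s h \<in> set (seg E I i h) \<or> ?s h = \<eta> h \<and> seg E I i h = []" for h
    by (cases "seg E I i h") auto
  have ne: "?s h \<noteq> ?s h'" if h: "adj E i h" "adj E i h'" "h \<noteq> h'" for h h'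
  proof -
    have "{i, h} \<noteq> {i, h'}" using h(3) by (auto simp: doubleton_eq_iff)
    then have "set (seg E I i h) \<inter> set (seg E I i h') = {}" using model_seg_disjoint[OF m h(1,2)] by blast
    moreover have "\<eta> h \<noteq> \<eta> h'" using inj(1) V h by (meson inj_onD)
    moreover have "\<eta> h \<notin> set (seg E I i h')" "\<eta> h' \<notin> set (seg E I i h)"
      using model_seg(2)[OF m h(1)] model_seg(2)[OF m h(2)] V h by blast+
    ultimately show ?thesis using cases[of h] cases[of h'] by (metis disjoint_iff)
  qed
  have "\<eta> i \<in> verts H" using inj(2) V[OF a(1)] by blast
  from cubic_neighbours[OF assms(1) this e[OF a(1)] e[OF a(2)] e[OF a(3)] ne[OF a(1,2,4)] ne[OF a(1,3,5)] ne[OF a(2,3,6)] w]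
  show ?thesis by blast
qed

lemma dedges_bounds: "(i, j) \<in> set dedges \<Longrightarrow> i < j \<and> j < 20"
proof -
  have "list_all (\<lambda>(i, j). i < j \<and> j < 20) dedges" by code_simp
  then show "(i, j) \<in> set dedges \<Longrightarrow> i < j \<and> j < 20" by (auto simp: list_all_iff)
qed

lemma core_edges_bounds: "(i, j) \<in> set core_edges \<longleftrightarrow> (i, j) \<in> set dedges \<and> 1 < i"
  by (auto simp: core_edges_def)

lemma oriented_plus_list:
  assumes "e \<in> set dedges" "f \<in> set dedges"
  shows "oriented {..<22} (set (plus_list e f))"
proof -
  obtain a b c d where ef: "e = (a, b)" "f = (c, d)" by (cases e; cases f)
  have bounds: "a < 20" "b < 20" "c < 20" "d < 20" "a \<noteq> b" "b \<noteq> a" "c \<noteq> d" "d \<noteq> c"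
    using assms dedges_bounds[of a b] dedges_bounds[of c d] unfolding ef by auto
  have mem: "(i, j) \<in> set (plus_list e f) \<longleftrightarrow>
      (i, j) \<in> set dedges \<and> (i, j) \<noteq> e \<and> (i, j) \<noteq> f \<or> (i, j) \<in> {(a, 20), (20, b), (c, 21), (21, d), (20, 21)}" for i j
    by (auto simp: plus_list_def ef)
  show ?thesis
    unfolding oriented_def
  proof (intro allI impI)
    fix i j assume "(i, j) \<in> set (plus_list e f)"
    then consider "(i, j) \<in> set dedges" | "(i, j) \<in> {(a, 20), (20, b), (c, 21), (21, d), (20, 21)}"
      unfolding mem by blast
    then show "i \<in> {..<22} \<and> j \<in> {..<22} \<and> i \<noteq> j \<and> (j, i) \<notin> set (plus_list e f)"
    proof cases
      case 1
      then have "i < j" "j < 20" "(j, i) \<notin> set dedges" using dedges_bounds[of i j] dedges_bounds[of j i] by auto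
      then show ?thesis unfolding mem by simp
    next
      case 2
      then have "20 \<le> i \<or> 20 \<le> j" by auto
      then have "(j, i) \<notin> set dedges" using dedges_bounds[of j i] by auto
      then show ?thesis unfolding mem using 2 bounds by (elim insertE emptyE) simp_all
    qed
  qed
qed

lemma rotate_cases:
  assumes "r < 4"
  obtains "r = 0" "rotate r [0, 20, 21, 1 :: nat] = [0, 20, 21, 1]"
  | "r = 1" "rotate r [0, 20, 21, 1 :: nat] = [20, 21, 1, 0]"
  | "r = 2" "rotate r [0, 20, 21, 1 :: nat] = [21, 1, 0, 20]"
  | "r = 3" "rotate r [0, 20, 21, 1 :: nat] = [1, 0, 20, 21]"
proof -
  have "r = 0 \<or> r = 1 \<or> r = 2 \<or> r = 3" using assms by auto
  then show ?thesis using that by (elim disjE) (simp_all add: numeral_2_eq_2 numeral_3_eq_3)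
qed

lemma set_pentagon_graph: "set (pentagon_graph r f) = ((set core_edges - {f}) \<union> {(fst f, 23), (23, snd f)}) \<union> set (pentagon_part r)"
  by (auto simp: pentagon_graph_def)

lemma oriented_core_edges_split:
  assumes "f \<in> set core_edges"
  shows "oriented (insert 23 {2..<20}) ((set core_edges - {f}) \<union> {(fst f, 23), (23, snd f)})"
proof -
  have "2 \<le> i \<and> i < j \<and> j < 20" if "(i, j) \<in> set core_edges" for i j
    using that dedges_bounds[of i j] by (auto simp: core_edges_bounds)
  then have kb: "2 \<le> i" "i < j" "j < 20" if "(i, j) \<in> set core_edges" for i j using that by blast+
  obtain a b where f: "f = (a, b)" by (cases f)
  have ab: "2 \<le> a" "a < b" "b < 20" using kb assms f by blast+
  show ?thesis
    unfolding oriented_def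
  proof (intro allI impI)
    fix i j assume "(i, j) \<in> (set core_edges - {f}) \<union> {(fst f, 23), (23, snd f)}"
    then consider "(i, j) \<in> set core_edges" | "i = a" "j = 23" | "i = 23" "j = b" by (auto simp: f)
    then show "i \<in> insert 23 {2..<20} \<and> j \<in> insert 23 {2..<20} \<and> i \<noteq> j \<and>
      (j, i) \<notin> (set core_edges - {f}) \<union> {(fst f, 23), (23, snd f)}"
    proof cases
      case 1
      then have "(j, i) \<notin> set core_edges" using kb(2)[of i j] kb(2)[of j i] by linarith
      then show ?thesis using kb[OF 1] by (simp add: f)
    next
      case 2
      then have "(j, i) \<notin> set core_edges" using kb(2)[of j i] ab by auto
      then show ?thesis using 2 ab by (simp add: f)
    next
      case 3
      then have "(j, i) \<notin> set core_edges" using kb(3)[of j i] by auto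
      then show ?thesis using 3 ab by (simp add: f)
    qed
  qed
qed

lemma oriented_pentagon_graph:
  assumes "r < 4" "f \<in> set core_edges"
  shows "oriented {..<24} (set (pentagon_graph r f))"
proof -
  have o: "oriented (insert 23 {2..<20}) ((set core_edges - {f}) \<union> {(fst f, 23), (23, snd f)})" (is "oriented ?V ?E")
    by (rule oriented_core_edges_split[OF assms(2)])
  have "\<forall>(i, j) \<in> set (pentagon_part r). i \<notin> ?V \<and> i < 24 \<and> j < 24 \<and> i \<noteq> j \<and> (j, i) \<notin> set (pentagon_part r)"
    using assms(1) by (cases rule: rotate_cases) (simp_all add: pentagon_part_def attachment_def)
  then have n: "i \<notin> ?V \<and> i < 24 \<and> j < 24 \<and> i \<noteq> j \<and> (j, i) \<notin> set (pentagon_part r)"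
    if "(i, j) \<in> set (pentagon_part r)" for i j using that by fast
  have "?V \<subseteq> {..<24}" by auto
  show ?thesis
    unfolding set_pentagon_graph
  proof -
    have 1: "i \<in> {..<24} \<and> j \<in> {..<24} \<and> i \<noteq> j \<and> (j, i) \<notin> ?E \<union> set (pentagon_part r)" if "(i, j) \<in> ?E" for i j
    proof -
      have "j \<in> ?V" using o that unfolding oriented_def by blast
      then have "(j, i) \<notin> set (pentagon_part r)" using n[of j i] by blast
      then show ?thesis using o that \<open>?V \<subseteq> {..<24}\<close> unfolding oriented_def by blast
    qed
    have 2: "i \<in> {..<24} \<and> j \<in> {..<24} \<and> i \<noteq> j \<and> (j, i) \<notin> ?E \<union> set (pentagon_part r)" if "(i, j) \<in> set (pentagon_part r)" for i j
    proof -
      have *: "i \<notin> ?V" "i < 24" "j < 24" "i \<noteq> j" "(j, i) \<notin> set (pentagon_part r)" using n[OF that] by blast+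
      then have "(j, i) \<notin> ?E" using o unfolding oriented_def by blast
      then show ?thesis using * by blast
    qed
    show "oriented {..<24} (?E \<union> set (pentagon_part r))"
      unfolding oriented_def using 1 2 by blast
  qed
qed

lemma core_edges_sub: "set core_edges \<subseteq> set (plus_list (0, 5) (1, 2))"
  by (auto simp: core_edges_def plus_list_def)

lemma model_outside:
  assumes m: "model H V E \<eta> I" and "V' \<subseteq> V" "E' \<subseteq> E"
    and "set vs \<subseteq> V - V'" "set es \<subseteq> E - E'"
  shows "set (map \<eta> vs @ concat (map I es)) \<subseteq> verts H - image_of V' E' \<eta> I"
proof
  fix x assume "x \<in> set (map \<eta> vs @ concat (map I es))"
  then consider i where "i \<in> set vs" "x = \<eta> i" | e where "e \<in> set es" "x \<in> set (I e)" by auto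
  then show "x \<in> verts H - image_of V' E' \<eta> I"
  proof cases
    case 1
    have i: "i \<in> V" "i \<notin> V'" using 1 assms(4) by blast+
    have "\<eta> i \<notin> \<eta> ` V'" using m i assms(2) unfolding model_def by (meson inj_on_image_mem_iff)
    moreover have "\<eta> i \<notin> set (I e)" if "e \<in> E'" for e using model_avoid[OF m _ i(1)] that assms(3) by blast
    moreover have "\<eta> i \<in> verts H" using m i unfolding model_def by blast
    ultimately show ?thesis unfolding 1 image_of_def by blast
  next
    case 2
    have e: "e \<in> E" "e \<notin> E'" using 2 assms(5) by blast+
    have "x \<notin> \<eta> ` V'" using model_avoid[OF m e(1)] 2(2) assms(2) by blast
    moreover have "x \<notin> set (I e')" if "e' \<in> E'" for e'
      using m e that assms(3) 2(2) unfolding model_def by (metis disjoint_iff subsetD)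
    moreover have "x \<in> verts H" using m e 2(2) unfolding model_def by (cases e) blast
    ultimately show ?thesis unfolding image_of_def by blast
  qed
qed

abbreviation core :: "(nat \<Rightarrow> 'a) \<Rightarrow> (nat \<times> nat \<Rightarrow> 'a list) \<Rightarrow> 'a set" where
  "core \<eta> I \<equiv> image_of {2..<20} (set core_edges) \<eta> I"

text \<open>The cycle is run through as 0, 20, 21, 1. Since model edges are stored in one direction,
  the paths of \<open>(1, 21)\<close> and \<open>(0, 1)\<close> are read backwards.\<close>

lemma four_cycle_of_model:
  assumes m: "model H {..<22} (set (plus_list (0, 5) (1, 2))) \<eta> I"
  shows "four_cycle H (core \<eta> I) (\<eta> 0) (I (0, 20)) (I (0, 4)) (\<eta> 4) (\<eta> 20) (I (20, 21)) (I (20, 5)) (\<eta> 5)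
    (\<eta> 21) (rev (I (1, 21))) (I (21, 2)) (\<eta> 2) (\<eta> 1) (rev (I (0, 1))) (I (1, 6)) (\<eta> 6)"
proof -
  let ?E = "set (plus_list (0, 5) (1, 2))"
  let ?vs = "[0, 20, 21, 1] :: nat list"
    and ?es = "[(0, 20), (20, 21), (1, 21), (0, 1), (0, 4), (20, 5), (21, 2), (1, 6)] :: (nat \<times> nat) list"
  have es: "set ?es \<subseteq> ?E - set core_edges"
    by (simp add: plus_list_def dedges_def core_edges_def)
  have w: "walk H (\<eta> i # I (i, j) @ [\<eta> j])" if "(i, j) \<in> set ?es" for i j
    using m es that unfolding model_def by blast
  have mset: "mset ((\<eta> 0 # I (0, 20)) @ (\<eta> 20 # I (20, 21)) @ (\<eta> 21 # rev (I (1, 21))) @ (\<eta> 1 # rev (I (0, 1))) @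
      I (0, 4) @ I (20, 5) @ I (21, 2) @ I (1, 6)) = mset (map \<eta> ?vs @ concat (map I ?es))"
    by (simp add: ac_simps)
  have "distinct (map \<eta> ?vs @ concat (map I ?es))"
    by (rule model_distinct[OF m]) (use es in auto)
  moreover have "set (map \<eta> ?vs @ concat (map I ?es)) \<subseteq> verts H - core \<eta> I"
    by (rule model_outside[OF m _ core_edges_sub]) (use es in auto)
  moreover have "{\<eta> 4, \<eta> 5, \<eta> 2, \<eta> 6} \<subseteq> core \<eta> I" by (auto simp: image_of_def)
  ultimately show ?thesis
    unfolding four_cycle_def mset_eq_setD[OF mset] using distinct_mset_cong[OF mset] w by (simp add: walk_rev_ends)
qed

text \<open>The corners of the pentagon become 22, \<open>n1\<close>, \<open>n2\<close>,
  \<open>n3\<close>, \<open>n4\<close>, and \<open>u\<close> becomes 23. A leg without its corner is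
  the inside of a path: \<open>tl L1\<close> leads to \<open>u\<close>, the other four to the
  attachments.\<close>

lemma model_pentagon_graph:
  assumes m: "model H {..<22} (set (plus_list (0, 5) (1, 2))) \<eta> I"
    and f: "f \<in> set core_edges" "u \<in> set (I f)" and vu: "{v, u} \<in> edges H"
    and p: "pent H (verts H - core \<eta> I) v w1 w2 w3 w4"
    and w: "{w1, \<eta> (attachment n1)} \<in> edges H" "{w2, \<eta> (attachment n2)} \<in> edges H" "{w3, \<eta> (attachment n3)} \<in> edges H" "{w4, \<eta> (attachment n4)} \<in> edges H"
    and r: "r < 4" "rotate r [0, 20, 21, 1] = [n1, n2, n3, n4]"
  shows "\<exists>\<eta>' I'. model H {..<24} (set (pentagon_graph r f)) \<eta>' I' \<and> (\<forall>i\<in>{2..<20}. \<eta>' i = \<eta> i) \<and>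
    (\<forall>e\<in>set core_edges - {f}. I' e = I e)"
  using p
proof (rule pentE)
  fix S1 S2 S3 S4 S5 L1 L2 L3 L4 L5
  assume P: "pent_on H S1 S2 S3 S4 S5 L1 L2 L3 L4 L5"
    and l: "last L1 = v" "last L2 = w1" "last L3 = w2" "last L4 = w3" "last L5 = w4"
    and sub: "set (S1 @ S2 @ S3 @ S4 @ S5 @ L1 @ L2 @ L3 @ L4 @ L5) \<subseteq> verts H - core \<eta> I"
  obtain i j where ij: "f = (i, j)" by (cases f)
  obtain I1 I2 where I12: "I (i, j) = I1 @ u # I2" using split_list[OF f(2)[unfolded ij]] by blast
  define \<eta>1 where "\<eta>1 = \<eta>(23 := u)"
  define J where "J = I((i, 23) := I1, (23, j) := I2)"
  let ?V = "insert 23 {2..<20} :: nat set" and ?E = "(set core_edges - {f}) \<union> {(fst f, 23), (23, snd f)}"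
  have kb: "2 \<le> i \<and> i < j \<and> j < 20" if "(i, j) \<in> set core_edges" for i j
    using that dedges_bounds[of i j] by (auto simp: core_edges_bounds)
  have ok: "oriented {2..<20} (set core_edges)"
    unfolding oriented_def
  proof (intro allI impI)
    fix i j assume "(i, j) \<in> set core_edges"
    then show "i \<in> {2..<20} \<and> j \<in> {2..<20} \<and> i \<noteq> j \<and> (j, i) \<notin> set core_edges"
      using kb[of i j] kb[of j i] by auto
  qed
  have mk: "model H {2..<20} (set core_edges) \<eta> I"
    by (rule model_mono[OF m _ core_edges_sub]) auto
  have m1: "model H ?V ?E \<eta>1 J"
    using model_subdivide[OF mk ok f(1)[unfolded ij], of 23 I1 u I2] I12 by (simp add: \<eta>1_def J_def ij)
  have o1: "oriented ?V ?E" by (rule oriented_core_edges_split[OF f(1)])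
  have \<eta>1: "\<eta>1 k = \<eta> k" if "k \<in> {2..<20}" for k using that by (auto simp: \<eta>1_def)
  have J: "J e = I e" if "e \<in> set core_edges" for e using kb[of "fst e" "snd e"] that by (cases e) (auto simp: J_def)
  have Jn: "J (i, 23) = I1" "J (23, j) = I2" using kb[of i j] f(1) ij by (auto simp: J_def)
  \<comment> \<open>Subdividing \<open>f\<close> adds no vertex of \<open>H\<close> to the image, so
    the pentagon, which avoids the old core, avoids the new image too.\<close>
  have img: "image_of ?V ?E \<eta>1 J \<subseteq> core \<eta> I"
  proof -
    have c: "\<eta> ` {2..<20} \<subseteq> core \<eta> I" "(\<Union>e\<in>set core_edges. set (I e)) \<subseteq> core \<eta> I"
      by (simp_all add: image_of_def)
    then have "set (I f) \<subseteq> core \<eta> I" using f(1) by blast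
    then have new: "u \<in> core \<eta> I" "set I1 \<subseteq> core \<eta> I" "set I2 \<subseteq> core \<eta> I" unfolding ij I12 by simp_all
    have "\<eta>1 ` ?V = insert u (\<eta> ` {2..<20})"
    proof -
      have "\<eta>1 ` {2..<20} = \<eta> ` {2..<20}" by (rule image_cong[OF refl \<eta>1])
      moreover have "\<eta>1 23 = u" by (simp add: \<eta>1_def)
      ultimately show ?thesis by (simp only: image_insert)
    qed
    moreover have "set (J e) \<subseteq> core \<eta> I" if "e \<in> ?E" for e
    proof -
      from that consider "e \<in> set core_edges" | "e = (i, 23)" | "e = (23, j)" unfolding ij by auto
      then show ?thesis
      proof cases
        case 1
        then show ?thesis using J[OF 1] c(2) by auto
      qed (use Jn new in auto)
    qed
    ultimately show ?thesis unfolding image_of_def[of ?V] using c(1) new(1) by auto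
  qed
  let ?vs = "[22, n1, n2, n3, n4]" and ?ps = "[hd L1, hd L2, hd L3, hd L4, hd L5]"
  let ?es = "[(22, n1), (n1, n2), (n2, n3), (n3, n4), (n4, 22), (22, 23), (n1, attachment n1), (n2, attachment n2), (n3, attachment n3), (n4, attachment n4)]"
    and ?ls = "[S1, S2, S3, S4, S5, tl L1, tl L2, tl L3, tl L4, tl L5]"
  have L: "L1 \<noteq> []" "L2 \<noteq> []" "L3 \<noteq> []" "L4 \<noteq> []" "L5 \<noteq> []" "walk H L1" "walk H L2" "walk H L3" "walk H L4" "walk H L5"
    and S: "walk H (hd L1 # S1 @ [hd L2])" "walk H (hd L2 # S2 @ [hd L3])"
     "walk H (hd L3 # S3 @ [hd L4])" "walk H (hd L4 # S4 @ [hd L5])" "walk H (hd L5 # S5 @ [hd L1])"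
    and D: "distinct (S1 @ S2 @ S3 @ S4 @ S5 @ L1 @ L2 @ L3 @ L4 @ L5)"
    using P unfolding pent_on_def by blast+
  have hdtl: "mset xs = add_mset (hd xs) (mset (tl xs))" if "xs \<noteq> []" for xs :: "'a list"
    using that by (cases xs) auto
  have mset: "mset (?ps @ concat ?ls) = mset (S1 @ S2 @ S3 @ S4 @ S5 @ L1 @ L2 @ L3 @ L4 @ L5)"
    using L(1-5)[THEN hdtl] by (simp add: ac_simps)
  have leg: "walk H (hd xs # tl xs @ [y])" if "xs \<noteq> []" "walk H xs" "{last xs, y} \<in> edges H" for xs y
    using walk_join_last[of H xs "[y]"] that by (cases xs) auto
  note legs = leg[OF L(1,6), unfolded l, OF vu] leg[OF L(2,7), unfolded l, OF w(1)] leg[OF L(3,8), unfolded l, OF w(2)]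
    leg[OF L(4,9), unfolded l, OF w(3)] leg[OF L(5,10), unfolded l, OF w(4)]
  have r': "(n1, n2, n3, n4) \<in> {(0, 20, 21, 1), (20, 21, 1, 0), (21, 1, 0, 20), (1, 0, 20, 21)}"
    using r by (cases rule: rotate_cases) auto
  have e: "model H (?V \<union> set ?vs) (?E \<union> set ?es) (override \<eta>1 ?vs ?ps) (override J ?es ?ls)"
  proof (rule model_extend[OF m1 o1 img])
    show "distinct ?vs" "set ?vs \<inter> ?V = {}" "distinct ?es"
      using r' by (elim insertE emptyE; simp add: attachment_def)+
    show "set ?es \<inter> ?E = {}"
    proof -
      have 1: "a \<in> ?V" if "(a, b) \<in> ?E" for a b using o1 that unfolding oriented_def by blast
      have "n1 \<notin> ?V" "n2 \<notin> ?V" "n3 \<notin> ?V" "n4 \<notin> ?V" "22 \<notin> ?V"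
        using r' by (elim insertE emptyE; simp)+
      then have 2: "a \<notin> ?V" if "(a, b) \<in> set ?es" for a b using that by auto
      have "A \<inter> B = {}" if "\<And>a b. (a, b) \<in> A \<Longrightarrow> (a, b) \<notin> B" for A B :: "(nat \<times> nat) set"
        using that by auto
      from this[of "set ?es" ?E] show ?thesis using 1 2 by metis
    qed
    show "distinct (?ps @ concat ?ls)" using distinct_mset_cong[OF mset D] .
    show "set (?ps @ concat ?ls) \<subseteq> verts H - core \<eta> I" using mset_eq_setD[OF mset] sub by metis
    have u: "\<eta>1 23 = u" "\<eta>1 4 = \<eta> 4" "\<eta>1 5 = \<eta> 5" "\<eta>1 2 = \<eta> 2" "\<eta>1 6 = \<eta> 6" by (simp_all add: \<eta>1_def)
    have O: "override \<eta>1 ?vs ?ps 22 = hd L1" "override \<eta>1 ?vs ?ps n1 = hd L2" "override \<eta>1 ?vs ?ps n2 = hd L3"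
      "override \<eta>1 ?vs ?ps n3 = hd L4" "override \<eta>1 ?vs ?ps n4 = hd L5" "override \<eta>1 ?vs ?ps 23 = u"
      "override \<eta>1 ?vs ?ps (attachment n1) = \<eta> (attachment n1)" "override \<eta>1 ?vs ?ps (attachment n2) = \<eta> (attachment n2)"
      "override \<eta>1 ?vs ?ps (attachment n3) = \<eta> (attachment n3)" "override \<eta>1 ?vs ?ps (attachment n4) = \<eta> (attachment n4)"
      using r' by (elim insertE emptyE; simp add: attachment_def u)+
    have OJ: "override J ?es ?ls (22, n1) = S1" "override J ?es ?ls (n1, n2) = S2" "override J ?es ?ls (n2, n3) = S3"
      "override J ?es ?ls (n3, n4) = S4" "override J ?es ?ls (n4, 22) = S5" "override J ?es ?ls (22, 23) = tl L1"
      "override J ?es ?ls (n1, attachment n1) = tl L2" "override J ?es ?ls (n2, attachment n2) = tl L3"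
      "override J ?es ?ls (n3, attachment n3) = tl L4" "override J ?es ?ls (n4, attachment n4) = tl L5"
      using r' by (elim insertE emptyE; simp add: attachment_def)+
    let ?W = "\<lambda>a b. walk H (override \<eta>1 ?vs ?ps a # override J ?es ?ls (a, b) @ [override \<eta>1 ?vs ?ps b])"
    have W: "?W 22 n1" "?W n1 n2" "?W n2 n3" "?W n3 n4" "?W n4 22" "?W 22 23"
      "?W n1 (attachment n1)" "?W n2 (attachment n2)" "?W n3 (attachment n3)" "?W n4 (attachment n4)"
      unfolding O OJ by (fact S legs)+
    fix a b assume "(a, b) \<in> set ?es"
    then have "a = 22 \<and> b = n1 \<or> a = n1 \<and> b = n2 \<or> a = n2 \<and> b = n3 \<or> a = n3 \<and> b = n4 \<or> a = n4 \<and> b = 22 \<or>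
      a = 22 \<and> b = 23 \<or> a = n1 \<and> b = attachment n1 \<or> a = n2 \<and> b = attachment n2 \<or> a = n3 \<and> b = attachment n3 \<or> a = n4 \<and> b = attachment n4"
      by (simp only: list.set insert_iff empty_iff prod.inject simp_thms)
    then show "?W a b"
      using W by (elim disjE conjE) (simp_all only:)
  qed simp_all
  have "?V \<union> {22, 0, 1, 20, 21} = {..<24}" by auto
  moreover have "set ?vs = {22, 0, 1, 20, 21}" using r' by (elim insertE emptyE; simp; blast)
  ultimately have V: "?V \<union> set ?vs = {..<24}" by (simp only:)
  have E: "?E \<union> set ?es = set (pentagon_graph r f)"
    unfolding set_pentagon_graph pentagon_part_def Let_def r(2) by (simp add: insert_commute)
  have "override \<eta>1 ?vs ?ps k = \<eta> k" if "k \<in> {2..<20}" for k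
    using that r' \<eta>1[OF that] by (subst override_other) auto
  moreover have "override J ?es ?ls e = I e" if "e \<in> set core_edges - {f}" for e
    using that r' J[of e] kb[of "fst e" "snd e"] by (subst override_other) (cases e; auto)+
  ultimately show ?thesis using e unfolding V E by blast
qed

section \<open>Regions and symmetries of the dodecahedron\<close>

lemma circuit_graph_alt:
  "circuit_graph f = \<lparr>verts = set f, edges = (\<lambda>(u, v). {u, v}) ` set (face_pairs f)\<rparr>"
  by (auto simp: circuit_graph_def face_pairs_def)

lemma set_face_pairs: "fst ` set (face_pairs f) = set f" "snd ` set (face_pairs f) = set f"
proof -
  have "map fst (face_pairs f) = f" "map snd (face_pairs f) = rotate1 f" by (simp_all add: face_pairs_def)
  then show "fst ` set (face_pairs f) = set f" "snd ` set (face_pairs f) = set f"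
    by (metis set_map, metis set_map set_rotate1)
qed

lemma face_pairs_map: "face_pairs (map \<phi> f) = map (map_prod \<phi> \<phi>) (face_pairs f)"
  by (simp add: face_pairs_def rotate1_map zip_map_map map_prod_def)

lemma verts_circuit_graph: "verts (circuit_graph f) = \<Union> (edges (circuit_graph f))"
proof -
  have "\<Union> ((\<lambda>(u, v). {u, v}) ` set (face_pairs f)) = fst ` set (face_pairs f) \<union> snd ` set (face_pairs f)"
    by force
  also have "\<dots> = set f" by (simp add: set_face_pairs)
  finally show ?thesis unfolding circuit_graph_alt by simp
qed

lemma edges_circuit_graph_map:
  "edges (circuit_graph (map \<phi> f)) = (\<lambda>(u, v). {\<phi> u, \<phi> v}) ` set (face_pairs f)"
  unfolding circuit_graph_alt face_pairs_map by (force simp: image_image map_prod_def case_prod_beta)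

lemma same_circuit_sound:
  assumes "same_circuit f g"
  shows "circuit_graph (map \<phi> f) = circuit_graph (map \<phi> g)"
proof -
  have sub: "edges (circuit_graph (map \<phi> f)) \<subseteq> edges (circuit_graph (map \<phi> g))"
    if *: "list_all (\<lambda>(u, v). (u, v) \<in> set (face_pairs g) \<or> (v, u) \<in> set (face_pairs g)) (face_pairs f)" for f g
  proof
    fix e assume "e \<in> edges (circuit_graph (map \<phi> f))"
    then obtain u v where "(u, v) \<in> set (face_pairs f)" "e = {\<phi> u, \<phi> v}"
      unfolding edges_circuit_graph_map by auto
    moreover from this(1) * have "(u, v) \<in> set (face_pairs g) \<or> (v, u) \<in> set (face_pairs g)"
      by (auto simp: list_all_iff)
    ultimately show "e \<in> edges (circuit_graph (map \<phi> g))"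
      unfolding edges_circuit_graph_map by (auto simp: image_iff insert_commute intro: bexI[of _ "(u, v)"] bexI[of _ "(v, u)"])
  qed
  have "edges (circuit_graph (map \<phi> f)) = edges (circuit_graph (map \<phi> g))"
    using assms sub[of f g] sub[of g f] unfolding same_circuit_def by blast
  then show ?thesis using verts_circuit_graph[of "map \<phi> f"] verts_circuit_graph[of "map \<phi> g"] by simp
qed

lemma nbs_iff: "v < 20 \<Longrightarrow> w \<in> set (nbs v) \<longleftrightarrow> adj (set dedges) v w"
proof -
  have 1: "list_all (\<lambda>v. list_all (\<lambda>w. (v, w) \<in> set dedges \<or> (w, v) \<in> set dedges) (nbs v)) [0..<20]"
    and 2: "list_all (\<lambda>(v, w). w \<in> set (nbs v) \<and> v \<in> set (nbs w)) dedges"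
    by code_simp+
  show "v < 20 \<Longrightarrow> w \<in> set (nbs v) \<longleftrightarrow> adj (set dedges) v w"
    using 1 2 by (auto simp: list_all_iff adj_def)
qed

lemma face_pairs_dedges:
  assumes "g \<in> set dodecahedron_faces" "(u, v) \<in> set (face_pairs g)"
  shows "adj (set dedges) u v"
proof -
  have "list_all (\<lambda>g. list_all (\<lambda>(u, v). (u, v) \<in> set dedges \<or> (v, u) \<in> set dedges) (face_pairs g)) dodecahedron_faces"
    by code_simp
  then show ?thesis using assms by (auto simp: list_all_iff adj_def)
qed

lemma dodecahedron_gr: "dodecahedron = labelled_graph id {..<20} (set dedges)"
proof -
  have "list_all (\<lambda>e. list_ex (on_face e) dodecahedron_faces) dedges" by code_simp
  then have *: "\<exists>g\<in>set dodecahedron_faces. on_face e g" if "e \<in> set dedges" for e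
    using that by (auto simp: list_all_iff list_ex_iff)
  have "(\<Union>f\<in>set dodecahedron_faces. edges (circuit_graph f)) = (\<lambda>(i, j). {i, j}) ` set dedges" (is "?L = ?R")
  proof
    show "?L \<subseteq> ?R"
    proof
      fix e assume "e \<in> ?L"
      then obtain g u v where g: "g \<in> set dodecahedron_faces" "(u, v) \<in> set (face_pairs g)" "e = {u, v}"
        unfolding circuit_graph_alt by auto
      then have "(u, v) \<in> set dedges \<or> (v, u) \<in> set dedges" using face_pairs_dedges unfolding adj_def by blast
      then show "e \<in> ?R" using g(3) by (auto simp: image_iff insert_commute intro: bexI[of _ "(u, v)"] bexI[of _ "(v, u)"])
    qed
    show "?R \<subseteq> ?L"
    proof
      fix e assume "e \<in> ?R"
      then obtain i j where ij: "(i, j) \<in> set dedges" "e = {i, j}" by auto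
      obtain g where g: "g \<in> set dodecahedron_faces" "on_face (i, j) g" using *[OF ij(1)] by blast
      then have "e \<in> edges (circuit_graph g)"
        unfolding circuit_graph_alt on_face_def ij(2)
        by (auto simp: image_iff insert_commute intro: bexI[of _ "(i, j)"] bexI[of _ "(j, i)"])
      then show "e \<in> ?L" using g(1) by blast
    qed
  qed
  then show ?thesis by (simp add: dodecahedron_def labelled_graph_def)
qed

lemma graph_iso_gr:
  assumes "graph_iso \<phi> dodecahedron G"
  shows "G = labelled_graph \<phi> {..<20} (set dedges)" "inj_on \<phi> {..<20}"
proof -
  have *: "bij_betw \<phi> {..<20} (verts G)" "edges G = (\<lambda>e. \<phi> ` e) ` edges dodecahedron"
    using assms by (simp_all add: graph_iso_def dodecahedron_def)
  show "inj_on \<phi> {..<20}" using *(1) by (rule bij_betw_imp_inj_on)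
  have "verts G = \<phi> ` {..<20}" using *(1) by (simp add: bij_betw_imp_surj_on)
  moreover have "edges G = (\<lambda>(i, j). {\<phi> i, \<phi> j}) ` set dedges"
    unfolding *(2) dodecahedron_gr by (simp add: labelled_graph_def image_image case_prod_beta)
  ultimately show "G = labelled_graph \<phi> {..<20} (set dedges)" by (cases G) (simp add: labelled_graph_def)
qed

lemma gr_graph_iso:
  assumes "inj_on \<phi> {..<20}"
  shows "graph_iso \<phi> dodecahedron (labelled_graph \<phi> {..<20} (set dedges))"
proof -
  have "verts dodecahedron = {..<20}" "edges dodecahedron = (\<lambda>(i, j). {i, j}) ` set dedges"
    unfolding dodecahedron_gr by (simp_all add: labelled_graph_def)
  then show ?thesis
    using assms by (simp add: graph_iso_def labelled_graph_def bij_betw_def image_image case_prod_beta)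
qed

abbreviation dodeca :: "(nat \<Rightarrow> 'a) \<Rightarrow> 'a ugraph" where
  "dodeca \<phi> \<equiv> labelled_graph \<phi> {..<20} (set dedges)"

lemma dodeca_edge_iff:
  assumes "inj_on \<phi> {..<20}" "u < 20" "v < 20"
  shows "{\<phi> u, \<phi> v} \<in> edges (dodeca \<phi>) \<longleftrightarrow> adj (set dedges) u v"
proof
  assume "{\<phi> u, \<phi> v} \<in> edges (dodeca \<phi>)"
  then obtain i j where ij: "(i, j) \<in> set dedges" "{\<phi> u, \<phi> v} = {\<phi> i, \<phi> j}" by (auto simp: labelled_graph_def)
  then have "u = i \<and> v = j \<or> u = j \<and> v = i"
    using doubleton_inj_on[OF assms(1), of u v i j] dedges_bounds[of i j] assms(2,3) by auto
  then show "adj (set dedges) u v" using ij(1) by (auto simp: adj_def)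
next
  assume "adj (set dedges) u v"
  then show "{\<phi> u, \<phi> v} \<in> edges (dodeca \<phi>)"
    by (auto simp: adj_def labelled_graph_def image_iff insert_commute intro: bexI[of _ "(u, v)"] bexI[of _ "(v, u)"])
qed

lemma dodeca_pentagon:
  assumes inj: "inj_on \<phi> {..<20}" and C: "circuit_of_length C 5" "subgraph C (dodeca \<phi>)"
  shows "\<exists>g\<in>set dodecahedron_faces. C = circuit_graph (map \<phi> g)"
proof -
  obtain vs where vs: "distinct vs" "length vs = 5" "C = circuit_graph vs"
    using C(1) unfolding circuit_of_length_def by blast
  have sub: "set vs \<subseteq> \<phi> ` {..<20}" using C(2) unfolding vs(3) subgraph_def by (simp add: circuit_graph_def labelled_graph_def)
  define ws where "ws = map (inv_into {..<20} \<phi>) vs"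
  have "\<phi> (inv_into {..<20} \<phi> v) = v" "inv_into {..<20} \<phi> v \<in> {..<20}" if "v \<in> set vs" for v
    using sub that f_inv_into_f[of v \<phi> "{..<20}"] inv_into_into[of v \<phi> "{..<20}"] by blast+
  then have ws: "set ws \<subseteq> {..<20}" "vs = map \<phi> ws"
    unfolding ws_def by (auto simp: map_idI)
  have "length ws = 5" using vs(2) ws(2) by simp
  then obtain a b c d e where abcde: "ws = [a, b, c, d, e]"
    by (auto simp: numeral_eq_Suc length_Suc_conv)
  have dist: "distinct ws" using vs(1) ws(2) by (simp add: distinct_map)
  have lt: "a < 20" "b < 20" "c < 20" "d < 20" "e < 20" using ws(1) abcde by auto
  have "(u, v) \<in> set (face_pairs ws) \<Longrightarrow> {\<phi> u, \<phi> v} \<in> edges (dodeca \<phi>)" for u v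
    using C(2) unfolding vs(3) ws(2) subgraph_def edges_circuit_graph_map by auto
  then have "{\<phi> a, \<phi> b} \<in> edges (dodeca \<phi>)" "{\<phi> b, \<phi> c} \<in> edges (dodeca \<phi>)" "{\<phi> c, \<phi> d} \<in> edges (dodeca \<phi>)"
    "{\<phi> d, \<phi> e} \<in> edges (dodeca \<phi>)" "{\<phi> e, \<phi> a} \<in> edges (dodeca \<phi>)"
    unfolding abcde by (simp_all add: face_pairs_def)
  then have n: "b \<in> set (nbs a)" "c \<in> set (nbs b)" "d \<in> set (nbs c)" "e \<in> set (nbs d)" "a \<in> set (nbs e)"
    using dodeca_edge_iff[OF inj] nbs_iff lt by simp_all
  have "list_ex (same_circuit [a, b, c, d, e]) dodecahedron_faces"
    using pentagons_check[unfolded list_all_iff, rule_format, OF _ n(1-4)] n(5) lt(1) dist[unfolded abcde] by simp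
  then show ?thesis
    using same_circuit_sound[of "[a, b, c, d, e]" _ \<phi>] vs(3) ws(2) abcde unfolding list_ex_iff by auto
qed

text \<open>A face seen through another isomorphism is still a five-circuit of the same graph, hence
  a face of the present labelling. This takes the place of the uniqueness of the planar
  embedding.\<close>

lemma dodeca_regions:
  assumes inj: "inj_on \<phi> {..<20}" and R: "R \<in> dodecahedron_regions (dodeca \<phi>)"
  shows "\<exists>g\<in>set dodecahedron_faces. R = circuit_graph (map \<phi> g)"
proof -
  obtain \<psi> f where \<psi>: "R = circuit_graph (map \<psi> f)" "graph_iso \<psi> dodecahedron (dodeca \<phi>)" "f \<in> set dodecahedron_faces"
    using R unfolding dodecahedron_regions_def by blast
  note gi = graph_iso_gr[OF \<psi>(2)]
  have "list_all (\<lambda>f. length f = 5 \<and> distinct f \<and> list_all (\<lambda>i. i < 20) f) dodecahedron_faces" by code_simp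
  then have f: "length f = 5" "distinct f" "set f \<subseteq> {..<20}" using \<psi>(3) by (auto simp: list_all_iff)
  have "distinct (map \<psi> f)" using f gi(2) by (auto simp: distinct_map intro: inj_on_subset)
  then have 1: "circuit_of_length R 5" unfolding circuit_of_length_def \<psi>(1) using f(1) by (intro exI[of _ "map \<psi> f"]) simp
  have "subgraph R (dodeca \<psi>)"
    unfolding subgraph_def
  proof
    show "verts R \<subseteq> verts (dodeca \<psi>)" using f(3) by (auto simp: \<psi>(1) circuit_graph_def labelled_graph_def)
    show "edges R \<subseteq> edges (dodeca \<psi>)"
    proof
      fix e assume "e \<in> edges R"
      then obtain u v where uv: "(u, v) \<in> set (face_pairs f)" "e = {\<psi> u, \<psi> v}"
        unfolding \<psi>(1) edges_circuit_graph_map by auto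
      have "u < 20" "v < 20" using uv(1) f(3) set_face_pairs[of f] by force+
      then show "e \<in> edges (dodeca \<psi>)"
        using dodeca_edge_iff[OF gi(2)] face_pairs_dedges[OF \<psi>(3) uv(1)] uv(2) by blast
    qed
  qed
  then have "subgraph R (dodeca \<phi>)" using gi(1) by simp
  then show ?thesis by (rule dodeca_pentagon[OF inj 1])
qed

lemma faces_regions:
  assumes "inj_on \<phi> {..<20}" "g \<in> set dodecahedron_faces"
  shows "circuit_graph (map \<phi> g) \<in> dodecahedron_regions (dodeca \<phi>)"
  using assms(2) gr_graph_iso[OF assms(1)] unfolding dodecahedron_regions_def by blast

lemma act_automorphism:
  assumes "set w \<subseteq> {0, 1, 2}"
  shows "bij_betw (act w) {..<20} {..<20}" "\<And>i j. (i, j) \<in> set dedges \<Longrightarrow> adj (set dedges) (act w i) (act w j)"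
proof -
  have s: "list_all (\<lambda>g. length g = 20 \<and> distinct g \<and> list_all (\<lambda>i. i < 20) g) symmetries" "length symmetries = 3"
    by code_simp+
  have bij: "bij_betw (\<lambda>u. symmetries ! k ! u) {..<20} {..<20}" if "k \<in> {0, 1, 2}" for k
  proof -
    have "symmetries ! k \<in> set symmetries" using that s(2) by (intro nth_mem) auto
    then have g: "length (symmetries ! k) = 20" "distinct (symmetries ! k)" "set (symmetries ! k) \<subseteq> {..<20}"
      using s(1) by (auto simp: list_all_iff)
    have "card (set (symmetries ! k)) = 20" using g by (simp add: distinct_card)
    then have "set (symmetries ! k) = {..<20}" using g(3) by (intro card_subset_eq) auto
    then show ?thesis by (intro bij_betw_nth[OF g(2)]) (simp_all only: g(1))
  qed
  have edge: "adj (set dedges) (symmetries ! k ! i) (symmetries ! k ! j)"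
    if "k \<in> {0, 1, 2}" "adj (set dedges) i j" for k i j
  proof -
    have k: "symmetries ! k \<in> set symmetries" using that s(2) by (intro nth_mem) auto
    have "adj (set dedges) (symmetries ! k ! i) (symmetries ! k ! j)" if "(i, j) \<in> set dedges" for i j
    proof -
      have "symmetries ! k ! j \<in> set (nbs (symmetries ! k ! i))"
        using symmetries_edges k that by (auto simp: list_all_iff)
      moreover have "symmetries ! k ! i < 20"
        using bij[OF \<open>k \<in> {0, 1, 2}\<close>] dedges_bounds[OF that] by (auto simp: bij_betw_def)
      ultimately show ?thesis using nbs_iff by blast
    qed
    then show ?thesis using that(2) adj_sym unfolding adj_def by blast
  qed
  have "bij_betw (act w) {..<20} {..<20} \<and> (\<forall>i j. adj (set dedges) i j \<longrightarrow> adj (set dedges) (act w i) (act w j))"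
    using assms
  proof (induction w)
    case Nil
    then show ?case by (simp add: act_def bij_betw_def)
  next
    case (Cons k w)
    have a: "act (k # w) = (\<lambda>u. symmetries ! k ! u) \<circ> act w" by (simp add: act_def fun_eq_iff)
    have k: "k \<in> {0, 1, 2}" and w: "set w \<subseteq> {0, 1, 2}" using Cons.prems by simp_all
    have "bij_betw (act (k # w)) {..<20} {..<20}"
      unfolding a using Cons.IH[OF w] bij[OF k] by (blast intro: bij_betw_trans)
    moreover have "adj (set dedges) (act (k # w) i) (act (k # w) j)" if "adj (set dedges) i j" for i j
      unfolding a comp_apply using Cons.IH[OF w] edge[OF k] that by blast
    ultimately show ?case by blast
  qed
  then show "bij_betw (act w) {..<20} {..<20}" "\<And>i j. (i, j) \<in> set dedges \<Longrightarrow> adj (set dedges) (act w i) (act w j)"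
    by (auto simp: adj_def)
qed

lemma oriented_dedges: "oriented {..<20} (set dedges)"
  unfolding oriented_def
proof (intro allI impI)
  fix i j assume "(i, j) \<in> set dedges"
  then show "i \<in> {..<20} \<and> j \<in> {..<20} \<and> i \<noteq> j \<and> (j, i) \<notin> set dedges"
    using dedges_bounds[of i j] dedges_bounds[of j i] by auto
qed

text \<open>The labelling is composed with the symmetry that carries \<open>5, 0, 1\<close> to the
  labels of \<open>a\<close>, \<open>b\<close>, \<open>c\<close>. Symmetries send edges to edges,
  and as the numbers of edges agree, the relabelled graph is the same.\<close>

lemma dodeca_frame:
  assumes inj: "inj_on \<phi> {..<20}" and ab: "{a, b} \<in> edges (dodeca \<phi>)" and bc: "{b, c} \<in> edges (dodeca \<phi>)" and "a \<noteq> c"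
  shows "\<exists>\<psi>. inj_on \<psi> {..<20} \<and> dodeca \<psi> = dodeca \<phi> \<and> \<psi> 5 = a \<and> \<psi> 0 = b \<and> \<psi> 1 = c"
proof -
  have "e \<subseteq> \<phi> ` {..<20}" if "e \<in> edges (dodeca \<phi>)" for e using that dedges_bounds by (force simp: labelled_graph_def)
  from this[OF ab] this[OF bc] have "a \<in> \<phi> ` {..<20}" "b \<in> \<phi> ` {..<20}" "c \<in> \<phi> ` {..<20}" by simp_all
  then obtain i j k where ijk: "a = \<phi> i" "b = \<phi> j" "c = \<phi> k" "i < 20" "j < 20" "k < 20" by auto
  have "i \<in> set (nbs j)" "k \<in> set (nbs j)"
    using ab bc dodeca_edge_iff[OF inj] nbs_iff ijk adj_sym[of "set dedges" i j] by simp_all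
  moreover have "i \<noteq> k" "j \<in> {0..<20}" using ijk \<open>a \<noteq> c\<close> by auto
  ultimately have "(i, j, k) \<in> set two_paths"
    unfolding two_paths_def by (simp del: atLeastLessThan_iff) blast
  then obtain w where w: "w \<in> set symmetry_words" "act w 5 = i" "act w 0 = j" "act w 1 = k"
    unfolding symmetry_words_reach[symmetric] by auto
  have "list_all (\<lambda>w. list_all (\<lambda>k. k \<in> {0, 1, 2}) w) symmetry_words" by code_simp
  then have "set w \<subseteq> {0, 1, 2}" using w(1) by (auto simp: list_all_iff)
  note aut = act_automorphism[OF this]
  let ?\<psi> = "\<phi> \<circ> act w"
  have inj': "inj_on ?\<psi> {..<20}" using aut(1) inj by (auto simp: bij_betw_def intro: comp_inj_on)
  have sub: "edges (dodeca ?\<psi>) \<subseteq> edges (dodeca \<phi>)"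
  proof
    fix e assume "e \<in> edges (dodeca ?\<psi>)"
    then obtain i j where ij: "(i, j) \<in> set dedges" "e = {\<phi> (act w i), \<phi> (act w j)}" by (auto simp: labelled_graph_def)
    then have "adj (set dedges) (act w i) (act w j)" using aut(2) by blast
    then show "e \<in> edges (dodeca \<phi>)" using ij(2)
      by (auto simp: adj_def labelled_graph_def image_iff insert_commute intro: bexI[of _ "(act w i, act w j)"] bexI[of _ "(act w j, act w i)"])
  qed
  have card: "card (edges (dodeca \<psi>)) = card (set dedges)" if "inj_on \<psi> {..<20}" for \<psi> :: "nat \<Rightarrow> 'a"
  proof -
    have "inj_on (\<lambda>(i, j). {\<psi> i, \<psi> j}) (set dedges)"
    proof (rule inj_onI)
      fix p q assume pq: "p \<in> set dedges" "q \<in> set dedges" "(case p of (i, j) \<Rightarrow> {\<psi> i, \<psi> j}) = (case q of (i, j) \<Rightarrow> {\<psi> i, \<psi> j})"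
      obtain i j k l where "p = (i, j)" "q = (k, l)" by (metis surj_pair)
      then show "p = q"
        using oriented_unique[OF oriented_dedges that, of i j k l] pq by simp
    qed
    then show ?thesis by (simp add: labelled_graph_def card_image)
  qed
  have "edges (dodeca ?\<psi>) = edges (dodeca \<phi>)"
    by (rule card_subset_eq[OF _ sub]) (simp_all add: card[OF inj] card[OF inj'], simp add: labelled_graph_def)
  moreover have "verts (dodeca ?\<psi>) = verts (dodeca \<phi>)"
    using bij_betw_imp_surj_on[OF aut(1)] by (simp only: labelled_graph_def ugraph.select_convs image_comp[symmetric])
  ultimately have "dodeca ?\<psi> = dodeca \<phi>" by (simp add: labelled_graph_def)
  then show ?thesis using inj' w ijk by (intro exI[of _ ?\<psi>]) simp
qed

section \<open>From certificates to jump extensions\<close>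

lemma on_face_iff:
  assumes "inj_on \<phi> {..<20}" "g \<in> set dodecahedron_faces" "i < 20" "j < 20"
  shows "{\<phi> i, \<phi> j} \<in> edges (circuit_graph (map \<phi> g)) \<longleftrightarrow> on_face (i, j) g"
proof -
  have b: "u < 20" "v < 20" if "(u, v) \<in> set (face_pairs g)" for u v
    using face_pairs_dedges[OF assms(2) that] dedges_bounds[of u v] dedges_bounds[of v u] by (auto simp: adj_def)
  show ?thesis
  proof
    assume "{\<phi> i, \<phi> j} \<in> edges (circuit_graph (map \<phi> g))"
    then obtain u v where uv: "(u, v) \<in> set (face_pairs g)" "{\<phi> i, \<phi> j} = {\<phi> u, \<phi> v}"
      unfolding edges_circuit_graph_map by auto
    then have "i = u \<and> j = v \<or> i = v \<and> j = u"
      using doubleton_inj_on[OF assms(1), of i j u v] b[OF uv(1)] assms(3,4) by simp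
    then show "on_face (i, j) g" using uv(1) by (auto simp: on_face_def)
  next
    assume "on_face (i, j) g"
    then show "{\<phi> i, \<phi> j} \<in> edges (circuit_graph (map \<phi> g))"
      unfolding edges_circuit_graph_map on_face_def
      by (auto simp: image_iff insert_commute intro: bexI[of _ "(i, j)"] bexI[of _ "(j, i)"])
  qed
qed

lemma dodeca_plus_edges:
  assumes inj: "inj_on \<phi> {..<20}" and e: "(a, b) \<in> set dedges" "(c, d) \<in> set dedges"
    and xy: "x \<notin> \<phi> ` {..<20}" "y \<notin> \<phi> ` {..<20}" "x \<noteq> y"
  shows "plus_edges (dodeca \<phi>) {\<phi> a, \<phi> b} {\<phi> c, \<phi> d} x y =
      labelled_graph (\<phi>(20 := x, 21 := y)) {..<22} (set (plus_list (a, b) (c, d)))"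
    and "inj_on (\<phi>(20 := x, 21 := y)) {..<22}"
proof -
  let ?\<psi> = "\<phi>(20 := x, 21 := y)"
  have \<psi>: "?\<psi> i = \<phi> i" if "i < 20" for i using that by simp
  have V: "{..<22} = insert 20 (insert 21 {..<20 :: nat})" by auto
  have img: "?\<psi> ` {..<20} = \<phi> ` {..<20}" by (rule image_cong) (use \<psi> in auto)
  have "inj_on ?\<psi> {..<20}" using inj inj_on_cong[of "{..<20}" ?\<psi> \<phi>] \<psi> by simp
  then show "inj_on ?\<psi> {..<22}"
    unfolding V inj_on_insert using img xy by auto
  have b: "a < 20" "b < 20" "c < 20" "d < 20" using dedges_bounds[OF e(1)] dedges_bounds[OF e(2)] by simp_all
  have db: "i < 20" "j < 20" if "(i, j) \<in> set dedges" for i j using dedges_bounds[OF that] by auto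
  have eq: "{\<phi> i, \<phi> j} = {\<phi> k, \<phi> l} \<longleftrightarrow> (i, j) = (k, l)" if "(i, j) \<in> set dedges" "(k, l) \<in> set dedges" for i j k l
    using oriented_unique[OF oriented_dedges inj that] by auto
  have "edges (dodeca \<phi>) - {{\<phi> a, \<phi> b}, {\<phi> c, \<phi> d}} = (\<lambda>(i, j). {\<phi> i, \<phi> j}) ` (set dedges - {(a, b), (c, d)})"
    (is "?A = ?B")
  proof
    show "?A \<subseteq> ?B" by (auto simp: labelled_graph_def)
    show "?B \<subseteq> ?A" using eq e by (auto simp: labelled_graph_def)
  qed
  also have "\<dots> = (\<lambda>(i, j). {?\<psi> i, ?\<psi> j}) ` (set dedges - {(a, b), (c, d)})"
  proof (intro image_cong refl)
    fix p assume "p \<in> set dedges - {(a, b), (c, d)}"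
    moreover obtain i j where "p = (i, j)" by (metis surj_pair)
    ultimately show "(case p of (i, j) \<Rightarrow> {\<phi> i, \<phi> j}) = (case p of (i, j) \<Rightarrow> {?\<psi> i, ?\<psi> j})"
      using db[of i j] by simp
  qed
  finally have old: "?A = (\<lambda>(i, j). {?\<psi> i, ?\<psi> j}) ` (set dedges - {(a, b), (c, d)})" .
  have new: "{{x, v} |v. v \<in> {\<phi> a, \<phi> b}} \<union> {{y, v} |v. v \<in> {\<phi> c, \<phi> d}} \<union> {{x, y}} =
      (\<lambda>(i, j). {?\<psi> i, ?\<psi> j}) ` {(a, 20), (20, b), (c, 21), (21, d), (20, 21)}"
    using b by (auto simp: insert_commute)
  have s: "set (plus_list (a, b) (c, d)) = (set dedges - {(a, b), (c, d)}) \<union> {(a, 20), (20, b), (c, 21), (21, d), (20, 21)}"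
    by (auto simp: plus_list_def)
  have "edges (plus_edges (dodeca \<phi>) {\<phi> a, \<phi> b} {\<phi> c, \<phi> d} x y) = edges (labelled_graph ?\<psi> {..<22} (set (plus_list (a, b) (c, d))))"
    unfolding plus_edges_def labelled_graph_def[of ?\<psi>] s image_Un old[symmetric] new[symmetric] by (simp only: ugraph.select_convs Un_assoc)
  moreover have "verts (plus_edges (dodeca \<phi>) {\<phi> a, \<phi> b} {\<phi> c, \<phi> d} x y) = verts (labelled_graph ?\<psi> {..<22} (set (plus_list (a, b) (c, d))))"
  proof -
    have "?\<psi> ` {..<22} = insert x (insert y (\<phi> ` {..<20}))" unfolding V image_insert img by simp
    then show ?thesis by (auto simp: plus_edges_def labelled_graph_def)
  qed
  ultimately show "plus_edges (dodeca \<phi>) {\<phi> a, \<phi> b} {\<phi> c, \<phi> d} x y = labelled_graph ?\<psi> {..<22} (set (plus_list (a, b) (c, d)))"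
    by (simp add: plus_edges_def labelled_graph_def)
qed

lemma linked_iff: "linked L u v \<longleftrightarrow> adj (set L) u v"
  by (force simp: linked_def adj_def list_ex_iff)

lemma cert_hop:
  assumes inj: "inj_on \<phi> {..<20}" and g: "g \<in> set dodecahedron_faces" "F = circuit_graph (map \<phi> g)"
    and e: "(a, b) \<in> set dedges" "(c, d) \<in> set dedges" "(a, b) \<noteq> (c, d)"
    and j: "cert_jumps ((a, b), (c, d), rest)" and fx: "cert_fixes g ((a, b), (c, d), rest)"
  shows "hop_pair (dodeca \<phi>) F {\<phi> a, \<phi> b} {\<phi> c, \<phi> d}" "diverse (dodeca \<phi>) {\<phi> a, \<phi> b} {\<phi> c, \<phi> d}"
proof -
  obtain p ep q eq ov where rest: "rest = (p, ep, q, eq, ov)" by (cases rest)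
  have b: "a < 20" "b < 20" "c < 20" "d < 20" "a \<noteq> b" "c \<noteq> d"
    using dedges_bounds[OF e(1)] dedges_bounds[OF e(2)] by simp_all
  have nf: "\<not> on_face (a, b) g" "\<not> on_face (c, d) g"
    and nt: "\<not> ((a \<in> set g \<or> b \<in> set g) \<and> (c \<in> set g \<or> d \<in> set g))"
    using fx unfolding rest by simp_all
  have nr: "\<not> (on_face (a, b) g \<and> on_face (c, d) g)" if "g \<in> set dodecahedron_faces" for g
    using j that unfolding rest by (simp add: list_all_iff)
  have dv: "s \<noteq> t \<and> t \<notin> set (nbs s)" if "s \<in> {a, b}" "t \<in> {c, d}" for s t
    using j that unfolding rest by (auto simp: list_all_iff)
  have gb: "set g \<subseteq> {..<20}"
  proof
    fix u assume "u \<in> set g"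
    then obtain v where "(u, v) \<in> set (face_pairs g)" using set_face_pairs(1)[of g] by force
    then show "u \<in> {..<20}"
      using face_pairs_dedges[OF g(1), of u v] dedges_bounds[of u v] dedges_bounds[of v u] by (auto simp: adj_def)
  qed
  have in_G: "{\<phi> a, \<phi> b} \<in> edges (dodeca \<phi>)" "{\<phi> c, \<phi> d} \<in> edges (dodeca \<phi>)"
    using e dodeca_edge_iff[OF inj] b by (auto simp: adj_def)
  have not_F: "{\<phi> a, \<phi> b} \<notin> edges F" "{\<phi> c, \<phi> d} \<notin> edges F"
    using nf on_face_iff[OF inj g(1)] b g(2) by simp_all
  have ne: "{\<phi> a, \<phi> b} \<noteq> {\<phi> c, \<phi> d}"
    using oriented_unique[OF oriented_dedges inj e(1,2)] e(3) by auto
  have vF: "\<phi> s \<in> verts F \<longleftrightarrow> s \<in> set g" if "s < 20" for s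
    using that gb inj g(2) by (auto simp: circuit_graph_def inj_on_eq_iff subset_iff)
  have touch: "\<not> ({\<phi> a, \<phi> b} \<inter> verts F \<noteq> {} \<and> {\<phi> c, \<phi> d} \<inter> verts F \<noteq> {})"
    using nt vF b by auto
  have reg: "\<not> (\<exists>R\<in>dodecahedron_regions (dodeca \<phi>). {\<phi> a, \<phi> b} \<in> edges R \<and> {\<phi> c, \<phi> d} \<in> edges R)"
    using dodeca_regions[OF inj] nr on_face_iff[OF inj] b by blast
  show "hop_pair (dodeca \<phi>) F {\<phi> a, \<phi> b} {\<phi> c, \<phi> d}"
    unfolding hop_pair_def using in_G not_F ne touch reg by blast
  have "\<phi> s \<noteq> \<phi> t \<and> {\<phi> s, \<phi> t} \<notin> edges (dodeca \<phi>)" if "s \<in> {a, b}" "t \<in> {c, d}" for s t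
  proof -
    have "s < 20" "t < 20" using that b by auto
    then show ?thesis using dv[OF that] inj dodeca_edge_iff[OF inj, of s t] nbs_iff[of s t] by (auto simp: inj_on_eq_iff)
  qed
  moreover have "\<phi> a \<noteq> \<phi> b" "\<phi> c \<noteq> \<phi> d" using inj b by (simp_all add: inj_on_eq_iff)
  ultimately show "diverse (dodeca \<phi>) {\<phi> a, \<phi> b} {\<phi> c, \<phi> d}"
    unfolding diverse_def by (intro exI[of _ "\<phi> a"] exI[of _ "\<phi> b"] exI[of _ "\<phi> c"] exI[of _ "\<phi> d"]) simp
qed

text \<open>The jump extension has to be built over the given vertex type, which may be finite. The
  22 branch vertices found in \<open>H\<close> show that at least two elements lie outside the 20
  vertices of \<open>G\<close>.\<close>

lemma two_fresh:
  fixes A :: "'a set" and \<eta> :: "nat \<Rightarrow> 'a"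
  assumes "finite A" "inj_on \<eta> {..<22}" "card A = 20"
  shows "\<exists>x y. x \<notin> A \<and> y \<notin> A \<and> x \<noteq> y"
proof -
  have "card (\<eta> ` {..<22}) = 22" using assms(2) by (simp add: card_image)
  then have "2 \<le> card (\<eta> ` {..<22} - A)" using diff_card_le_card_Diff[OF assms(1), of "\<eta> ` {..<22}"] assms(3) by simp
  then obtain B where "B \<subseteq> \<eta> ` {..<22} - A" "card B = 2" using obtain_subset_with_card_n by metis
  then show ?thesis by (metis card_2_iff Diff_iff insert_subset)
qed

text \<open>The relabelled vertices are branch vertices of the jump extension, with
  \<open>ep\<close> routed through \<open>p\<close> and \<open>eq\<close> through \<open>q\<close>.
  Edges of \<open>F\<close> keep their trivial paths because the certificate keeps all four affected
  edges off the face and \<open>f\<close> is not on it either.\<close>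

lemma cert_contains:
  assumes inj: "inj_on \<phi> {..<20}" and g: "g \<in> set dodecahedron_faces" "F = circuit_graph (map \<phi> g)" "0 \<notin> set g" "1 \<notin> set g"
    and r: "r < 4" "f \<in> set core_edges" "\<not> on_face f g"
    and m: "model H {..<24} (set (pentagon_graph r f)) \<eta> I"
    and \<eta>: "\<And>i. i \<in> set g \<Longrightarrow> \<eta> i = \<phi> i"
    and I: "\<And>e. e \<in> set core_edges - {f} \<Longrightarrow> on_face e g \<Longrightarrow> I e = []"
    and cert: "cert_embeds (pentagon_graph r f) c" "cert_jumps c" "cert_fixes g c"
  shows "\<exists>G'. jump_extension (dodeca \<phi>) F G' \<and> F_contains H F G'"
proof -
  obtain e f' p ep q eq ov where c: "c = (e, f', p, ep, q, eq, ov)" by (cases c) auto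
  obtain a b where e: "e = (a, b)" by (cases e)
  obtain a' b' where f': "f' = (a', b')" by (cases f')
  let ?E = "set (pentagon_graph r f)" and ?E' = "set (plus_list e f')" and ?\<mu> = "relabel ov"
  define P where "P x = (if x = ep then Some p else if x = eq then Some q else None)" for x
  have ce: "e \<in> set dedges" "f' \<in> set dedges" "e \<noteq> f'"
    "distinct (map ?\<mu> [0..<22] @ [p, q])" "list_all (\<lambda>v. v < 24) (map ?\<mu> [0..<22] @ [p, q])"
    and links: "\<And>x. x \<in> ?E' \<Longrightarrow> let u = ?\<mu> (fst x); v = ?\<mu> (snd x) in
       if x = ep then adj ?E u p \<and> adj ?E p v
       else if x = eq then adj ?E u q \<and> adj ?E q v
       else adj ?E u v"
    using cert(1) unfolding c cert_embeds.simps list_all_iff[of _ "plus_list e f'"] linked_iff by blast+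
  have fx: "\<And>i. i \<in> set g \<Longrightarrow> ?\<mu> i = i" "\<not> on_face e g" "\<not> on_face f' g" "\<not> on_face ep g" "\<not> on_face eq g"
    using cert(3) unfolding c by (simp_all add: list_all_iff)
  have \<mu>: "inj_on ?\<mu> {..<22}" "?\<mu> ` {..<22} \<subseteq> {..<24}" "p < 24" "q < 24" "p \<notin> ?\<mu> ` {..<22}" "q \<notin> ?\<mu> ` {..<22}" "p \<noteq> q"
    using ce(4,5) by (auto simp: distinct_map list_all_iff lessThan_atLeast0)
  have ori': "oriented {..<22} ?E'" by (rule oriented_plus_list[OF ce(1,2)])
  have "\<exists>I'. model H {..<22} ?E' (\<eta> \<circ> ?\<mu>) I' \<and>
    (\<forall>i k. (i, k) \<in> ?E' \<longrightarrow> P (i, k) = None \<longrightarrow> I' (i, k) = seg ?E I (?\<mu> i) (?\<mu> k))"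
  proof (rule model_compose[OF m oriented_pentagon_graph[OF r(1,2)] ori' \<mu>(1,2)])
    fix i k assume ik: "(i, k) \<in> ?E'"
    show "adj ?E (?\<mu> i) (?\<mu> k)" if "P (i, k) = None"
      using links[OF ik] that by (auto simp: P_def Let_def split: if_splits)
    fix s assume "P (i, k) = Some s"
    then show "s \<in> {..<24} - ?\<mu> ` {..<22} \<and> adj ?E (?\<mu> i) s \<and> adj ?E s (?\<mu> k)"
      using links[OF ik] \<mu>(3-6) by (auto simp: P_def Let_def split: if_splits)
  next
    fix x x' s assume "P x = Some s" "P x' = Some s"
    then show "x = x'" using \<mu>(7) by (auto simp: P_def split: if_splits)
  qed
  then obtain I' where m': "model H {..<22} ?E' (\<eta> \<circ> ?\<mu>) I'"
    and I': "\<And>i k. (i, k) \<in> ?E' \<Longrightarrow> P (i, k) = None \<Longrightarrow> I' (i, k) = seg ?E I (?\<mu> i) (?\<mu> k)" by blast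
  have "inj_on (\<eta> \<circ> ?\<mu>) {..<22}" using m' by (simp add: model_def)
  moreover have "card (\<phi> ` {..<20}) = 20" using inj by (simp add: card_image)
  ultimately obtain x y where xy: "x \<notin> \<phi> ` {..<20}" "y \<notin> \<phi> ` {..<20}" "x \<noteq> y"
    using two_fresh[of "\<phi> ` {..<20}"] by blast
  let ?\<psi> = "\<phi>(20 := x, 21 := y)"
  let ?G' = "plus_edges (dodeca \<phi>) {\<phi> a, \<phi> b} {\<phi> a', \<phi> b'} x y"
  note pe = dodeca_plus_edges[OF inj ce(1,2)[unfolded e f'] xy]
  obtain \<eta>' \<pi> where h: "homeo_embedding \<eta>' \<pi> ?G' H"
    and \<eta>': "\<And>i. i < 22 \<Longrightarrow> \<eta>' (?\<psi> i) = \<eta> (?\<mu> i)"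
    and \<pi>: "\<And>i j. (i, j) \<in> ?E' \<Longrightarrow> \<pi> {?\<psi> i, ?\<psi> j} = path_graph (\<eta> (?\<mu> i) # I' (i, j) @ [\<eta> (?\<mu> j)])"
    using homeo_of_model[OF m' pe(2) ori'] unfolding pe(1) e f' by auto
  have pairs: "u < 20" "v < 20" "u \<in> set g" "v \<in> set g" "adj (set dedges) u v" if "(u, v) \<in> set (face_pairs g)" for u v
    using face_pairs_dedges[OF g(1) that] dedges_bounds[of u v] dedges_bounds[of v u] that set_face_pairs[of g]
    by (auto simp: adj_def image_iff) force+
  have gb: "i < 20" if "i \<in> set g" for i
    using that set_face_pairs(1)[of g] pairs(1) by force
  have "fixes_subgraph \<eta>' \<pi> F"
    unfolding fixes_subgraph_def
  proof (intro conjI ballI)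
    fix v assume "v \<in> verts F"
    then obtain i where i: "i \<in> set g" "v = \<phi> i" by (auto simp: g(2) circuit_graph_def)
    then show "\<eta>' v = v" using \<eta>'[of i] gb[OF i(1)] fx(1)[OF i(1)] \<eta>[OF i(1)] by simp
  next
    fix d assume "d \<in> edges F"
    then obtain u v where uv: "(u, v) \<in> set (face_pairs g)" "d = {\<phi> u, \<phi> v}"
      unfolding g(2) edges_circuit_graph_map by auto
    then obtain i j where ij: "(i, j) \<in> set dedges" "d = {\<phi> i, \<phi> j}" "on_face (i, j) g" "i \<in> set g" "j \<in> set g"
      using pairs(3-5)[OF uv(1)] by (auto simp: adj_def on_face_def insert_commute)
    have lt: "i < 20" "j < 20" using gb ij by blast+
    have ne: "(i, j) \<noteq> e" "(i, j) \<noteq> f'" "(i, j) \<noteq> ep" "(i, j) \<noteq> eq" "(i, j) \<noteq> f" using fx ij(3) r(3) by auto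
    have E': "(i, j) \<in> ?E'" using ij(1) ne by (simp add: plus_list_def)
    have "i \<noteq> 0" "i \<noteq> 1" using ij(4) g(3,4) by metis+
    then have k: "(i, j) \<in> set core_edges - {f}" using ij(1) ne by (simp add: core_edges_bounds)
    then have "(i, j) \<in> ?E" by (simp add: pentagon_graph_def)
    then have "I' (i, j) = []" using I'[OF E'] ne fx(1) ij I[OF k ij(3)] by (simp add: P_def seg_def)
    then have "\<pi> {?\<psi> i, ?\<psi> j} = path_graph [\<phi> i, \<phi> j]" using \<pi>[OF E'] fx(1) ij \<eta> by simp
    then show "\<pi> d = \<lparr>verts = d, edges = {d}\<rparr>" using lt ij(2) by (simp add: path_graph_def)
  qed
  then have "F_contains H F ?G'" using h unfolding F_contains_def by blast
  moreover have "jump_extension (dodeca \<phi>) F ?G'"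
    unfolding jump_extension_def
    using cert_hop[OF inj g(1,2) ce(1-3)[unfolded e f'] cert(2,3)[unfolded c e f']] xy
    by (intro exI[of _ "{\<phi> a, \<phi> b}"] exI[of _ "{\<phi> a', \<phi> b'}"] exI[of _ x] exI[of _ y]) (simp add: labelled_graph_def)
  ultimately show ?thesis by blast
qed

lemma cert_exists:
  assumes "r < 4" "f \<in> set core_edges" "g \<in> set dodecahedron_faces" "0 \<notin> set g" "1 \<notin> set g" "\<not> on_face f g"
  shows "\<exists>c. cert_embeds (pentagon_graph r f) c \<and> cert_jumps c \<and> cert_fixes g c"
proof -
  have "\<exists>rows. certs_ok r rows"
  proof -
    have "r = 0 \<or> r = 1 \<or> r = 2 \<or> r = 3" using assms(1) by auto
    then show ?thesis using certs_check by (elim disjE) blast+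
  qed
  then obtain rows where rows: "certs_ok r rows" by blast
  have "fst ` set rows = set core_edges" using rows unfolding certs_ok_def by (metis set_map)
  then have "f \<in> fst ` set rows" using assms(2) by simp
  then obtain cs where cs: "(f, cs) \<in> set rows" by auto
  from rows have all: "\<forall>x\<in>set rows. case x of (f, cs) \<Rightarrow> list_all (\<lambda>c. cert_embeds (pentagon_graph r f) c \<and> cert_jumps c) cs \<and>
       list_all (\<lambda>g. 0 \<in> set g \<or> 1 \<in> set g \<or> on_face f g \<or> list_ex (cert_fixes g) cs) dodecahedron_faces"
    unfolding certs_ok_def list_all_iff[of _ rows] by (rule conjunct2)
  have "list_all (\<lambda>c. cert_embeds (pentagon_graph r f) c \<and> cert_jumps c) cs"
    "list_all (\<lambda>g. 0 \<in> set g \<or> 1 \<in> set g \<or> on_face f g \<or> list_ex (cert_fixes g) cs) dodecahedron_faces"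
    using bspec[OF all cs] unfolding prod.case by blast+
  then have "\<forall>c\<in>set cs. cert_embeds (pentagon_graph r f) c \<and> cert_jumps c" "\<exists>c\<in>set cs. cert_fixes g c"
    using assms(3-6) unfolding list_all_iff list_ex_iff by blast+
  then show ?thesis by blast
qed

section \<open>Normal form of a hop that is not a jump\<close>

lemma dodeca_edgeE:
  assumes "e \<in> edges (dodeca \<phi>)"
  obtains i j where "i < 20" "j < 20" "adj (set dedges) i j" "e = {\<phi> i, \<phi> j}"
proof -
  obtain i j where ij: "(i, j) \<in> set dedges" "e = {\<phi> i, \<phi> j}" using assms by (auto simp: labelled_graph_def)
  show ?thesis by (rule that[of i j]) (use ij dedges_bounds[OF ij(1)] in \<open>simp_all add: adj_def\<close>)
qed

lemma common_region:
  assumes inj: "inj_on \<psi> {..<20}" and g: "g \<in> set dodecahedron_faces"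
    and "i < 20" "j < 20" "k < 20" "l < 20" "on_face (i, j) g" "on_face (k, l) g"
  shows "\<exists>R\<in>dodecahedron_regions (dodeca \<psi>). {\<psi> i, \<psi> j} \<in> edges R \<and> {\<psi> k, \<psi> l} \<in> edges R"
  using faces_regions[OF inj g] on_face_iff[OF inj g] assms(3-8) by blast

text \<open>The path \<open>a b c\<close> is placed at \<open>5, 0, 1\<close>. The other neighbours
  of 1 are 2 and 6, and \<open>d\<close> cannot be 6, since then the face
  \<open>0, 1, 6, 10, 5\<close> would contain both edges.\<close>

lemma adjacent_edges_frame:
  assumes inj: "inj_on \<phi> {..<20}"
    and e: "{a, b} \<in> edges (dodeca \<phi>)" "{c, d} \<in> edges (dodeca \<phi>)" "{b, c} \<in> edges (dodeca \<phi>)"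
    and dist: "a \<noteq> c" "b \<noteq> d"
    and reg: "\<not> (\<exists>R\<in>dodecahedron_regions (dodeca \<phi>). {a, b} \<in> edges R \<and> {c, d} \<in> edges R)"
  shows "\<exists>\<psi>. inj_on \<psi> {..<20} \<and> dodeca \<psi> = dodeca \<phi> \<and> {a, b} = {\<psi> 0, \<psi> 5} \<and> {c, d} = {\<psi> 1, \<psi> 2}"
proof -
  obtain \<psi> where \<psi>: "inj_on \<psi> {..<20}" "dodeca \<psi> = dodeca \<phi>" "\<psi> 5 = a" "\<psi> 0 = b" "\<psi> 1 = c"
    using dodeca_frame[OF inj e(1,3) dist(1)] by blast
  have "d \<in> verts (dodeca \<psi>)"
  proof -
    obtain i j where "i < 20" "j < 20" "{c, d} = {\<psi> i, \<psi> j}"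
      using e(2) unfolding \<psi>(2)[symmetric] by (rule dodeca_edgeE) blast
    then have "d \<in> {\<psi> i, \<psi> j}" "\<psi> i \<in> \<psi> ` {..<20}" "\<psi> j \<in> \<psi> ` {..<20}" by auto
    then show ?thesis by (auto simp: labelled_graph_def)
  qed
  then obtain k where k: "d = \<psi> k" "k < 20" by (auto simp: labelled_graph_def)
  have "{\<psi> 1, \<psi> k} \<in> edges (dodeca \<psi>)" using e(2) \<psi> k by simp
  then have "k \<in> set (nbs 1)" using dodeca_edge_iff[OF \<psi>(1), of 1 k] nbs_iff[of 1 k] k(2) by simp
  then have "k = 0 \<or> k = 2 \<or> k = 6" by (simp add: nbs_def)
  moreover have "k \<noteq> 0" using dist(2) \<psi>(4) k(1) by (intro notI) simp
  moreover have "k \<noteq> 6"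
  proof
    assume "k = 6"
    have f: "[0, 1, 6, 10, 5] \<in> set dodecahedron_faces" "on_face (5, 0) [0, 1, 6, 10, 5]" "on_face (1, 6) [0, 1, 6, 10, 5]"
      by code_simp+
    have "{\<psi> 5, \<psi> 0} = {a, b}" "{\<psi> 1, \<psi> 6} = {c, d}" using \<psi> k \<open>k = 6\<close> by simp_all
    then show False using common_region[OF \<psi>(1) f(1) _ _ _ _ f(2,3)] reg unfolding \<psi>(2) by simp
  qed
  ultimately show ?thesis using \<psi> k by (intro exI[of _ \<psi>]) auto
qed

text \<open>Two edges with a common end lie on a common face, because their union can be placed at
  \<open>5, 0, 1\<close>. So the edges of a hop are disjoint, and if they are not diverse, an edge
  joins an end of one to an end of the other.\<close>

lemma hop_frame:
  assumes inj: "inj_on \<phi> {..<20}" and e: "e \<in> edges (dodeca \<phi>)" "f \<in> edges (dodeca \<phi>)" "e \<noteq> f"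
    and reg: "\<not> (\<exists>R\<in>dodecahedron_regions (dodeca \<phi>). e \<in> edges R \<and> f \<in> edges R)"
    and nd: "\<not> diverse (dodeca \<phi>) e f"
  shows "\<exists>\<psi>. inj_on \<psi> {..<20} \<and> dodeca \<psi> = dodeca \<phi> \<and> e = {\<psi> 0, \<psi> 5} \<and> f = {\<psi> 1, \<psi> 2}"
proof -
  have card2: "\<exists>a b. d = {a, b} \<and> a \<noteq> b" if d: "d \<in> edges (dodeca \<phi>)" for d
    using d
  proof (rule dodeca_edgeE)
    fix i j assume "i < 20" "j < 20" "adj (set dedges) i j" "d = {\<phi> i, \<phi> j}"
    moreover have "i \<noteq> j" using \<open>adj (set dedges) i j\<close> dedges_bounds by (auto simp: adj_def)
    ultimately have "\<phi> i \<noteq> \<phi> j" using inj by (simp add: inj_on_eq_iff)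
    then show ?thesis using \<open>d = {\<phi> i, \<phi> j}\<close> by blast
  qed
  obtain a b where ab: "e = {a, b}" "a \<noteq> b" using card2[OF e(1)] by blast
  obtain c d where cd: "f = {c, d}" "c \<noteq> d" using card2[OF e(2)] by blast
  have disj: "e \<inter> f = {}"
  proof (rule ccontr)
    assume "e \<inter> f \<noteq> {}"
    then obtain s t u where stu: "e = {s, t}" "f = {t, u}" using ab cd by (auto simp: insert_commute)
    then have "s \<noteq> u" using e(3) by (auto simp: insert_commute)
    from dodeca_frame[OF inj e(1,2)[unfolded stu] this] obtain \<psi> where
      \<psi>: "inj_on \<psi> {..<20}" "dodeca \<psi> = dodeca \<phi>" "\<psi> 5 = s" "\<psi> 0 = t" "\<psi> 1 = u" by blast
    have g: "[0, 1, 6, 10, 5] \<in> set dodecahedron_faces" "on_face (5, 0) [0, 1, 6, 10, 5]" "on_face (0, 1) [0, 1, 6, 10, 5]"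
      by code_simp+
    have "{\<psi> 5, \<psi> 0} = e" "{\<psi> 0, \<psi> 1} = f" using \<psi> stu by simp_all
    then show False using common_region[OF \<psi>(1) g(1) _ _ _ _ g(2,3)] reg unfolding \<psi>(2) by simp
  qed
  then have dist: "a \<noteq> c" "a \<noteq> d" "b \<noteq> c" "b \<noteq> d" using ab cd by auto
  have "diverse (dodeca \<phi>) e f"
    if "{a, c} \<notin> edges (dodeca \<phi>)" "{a, d} \<notin> edges (dodeca \<phi>)" "{b, c} \<notin> edges (dodeca \<phi>)" "{b, d} \<notin> edges (dodeca \<phi>)"
    unfolding diverse_def by (intro exI[of _ a] exI[of _ b] exI[of _ c] exI[of _ d]) (use that ab cd dist in simp)
  then consider "{a, c} \<in> edges (dodeca \<phi>)" | "{a, d} \<in> edges (dodeca \<phi>)" | "{b, c} \<in> edges (dodeca \<phi>)" | "{b, d} \<in> edges (dodeca \<phi>)"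
    using nd by blast
  moreover have ?thesis if "e = {s, t}" "f = {u, v}" "{t, u} \<in> edges (dodeca \<phi>)" "s \<noteq> u" "t \<noteq> v" for s t u v
    using adjacent_edges_frame[OF inj e(1)[unfolded that] e(2)[unfolded that] that(3-5) reg[unfolded that]] that by simp
  note frame = this
  ultimately show ?thesis
  proof cases
    case 1 then show ?thesis by (intro frame[of b a c d]) (use ab cd dist in auto)
  next
    case 2 then show ?thesis by (intro frame[of b a d c]) (use ab cd dist in auto)
  next
    case 3 then show ?thesis by (intro frame[of a b c d]) (use ab cd dist in auto)
  next
    case 4 then show ?thesis by (intro frame[of a b d c]) (use ab cd dist in auto)
  qed
qed

section \<open>The cut bound and the edges leaving the core\<close>

lemma circuit_of_walk:
  assumes "simple_graph H" "distinct vs" "3 \<le> length vs" "walk H (vs @ [hd vs])" "set vs \<subseteq> verts H"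
  shows "circuit (circuit_graph vs)" "subgraph (circuit_graph vs) H" "verts (circuit_graph vs) = set vs"
proof -
  show "circuit (circuit_graph vs)"
    unfolding circuit_def circuit_of_length_def using assms(2,3) by blast
  show v: "verts (circuit_graph vs) = set vs" by (simp add: circuit_graph_def)
  obtain x xs where vs: "vs = x # xs" using assms(3) by (cases vs) auto
  have "zip (x # xs @ [x]) (xs @ [x]) = zip (x # xs) (xs @ [x])"
    using zip_append1[of "x # xs" "[x]" "xs @ [x]"] by simp
  then have "edges (circuit_graph vs) = edges (path_graph (vs @ [hd vs]))"
    by (simp add: circuit_graph_def path_graph_def vs)
  then show "subgraph (circuit_graph vs) H"
    using assms(4,5) v by (simp add: subgraph_def walk_iff_edges)
qed

text \<open>Going once around the four-cycle gives a circuit inside \<open>X\<close>, and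
  \<open>F\<close> is a circuit in the complement.\<close>

lemma four_cycle_cut:
  assumes H: "simple_graph H" "cyclically_connected 5 H"
    and fc: "four_cycle H KV a Sa Ra ka b Sb Rb kb c Sc Rc kc d Sd Rd kd"
    and F: "circuit F" "subgraph F H" "verts F \<subseteq> KV"
    and X: "set ((a # Sa) @ (b # Sb) @ (c # Sc) @ (d # Sd)) \<subseteq> X" "X \<subseteq> verts H - KV"
  shows "5 \<le> card (edge_cut H X)"
proof -
  let ?vs = "(a # Sa) @ (b # Sb) @ (c # Sc) @ (d # Sd)"
  have "distinct (?vs @ Ra @ Rb @ Rc @ Rd)" using fc unfolding four_cycle_def append_assoc by blast
  then have d: "distinct ?vs" unfolding distinct_append[of ?vs] by blast
  have W: "walk H (a # Sa @ [b])" "walk H (b # Sb @ [c])" "walk H (c # Sc @ [d])" "walk H (d # Sd @ [a])"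
    using fc by (simp_all add: four_cycle_def)
  have w3: "walk H ((c # Sc) @ d # Sd @ [a])" by (rule walk_join_hd) (use W in simp_all)
  have w2: "walk H ((b # Sb) @ (c # Sc) @ d # Sd @ [a])" by (rule walk_join_hd) (use W w3 in simp_all)
  have "walk H ((a # Sa) @ (b # Sb) @ (c # Sc) @ d # Sd @ [a])" by (rule walk_join_hd) (use W w2 in simp_all)
  then have w: "walk H (?vs @ [hd ?vs])" by simp
  have V: "set ?vs \<subseteq> verts H" using X by blast
  have "3 \<le> length ?vs" by simp
  note C = circuit_of_walk[OF H(1) d this w V]
  have "X \<subseteq> verts H" using X(2) by blast
  moreover have "verts (circuit_graph ?vs) \<subseteq> X" unfolding C(3) by (rule X(1))
  moreover have "verts F \<subseteq> verts H - X" using F(2,3) X(2) by (auto simp: subgraph_def)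
  ultimately show ?thesis using H(2) C(1,2) F(1,2) unfolding cyclically_connected_def by blast
qed

lemma pent_at_mem: "pent_at H B a b c d v \<Longrightarrow> {a, b, c, d, v} \<subseteq> B"
proof -
  have "{s1, s2, s3, s4, s5} \<subseteq> B" if "pent H B s1 s2 s3 s4 s5" for s1 s2 s3 s4 s5
    using that by (rule pentE) (auto simp: pent_on_def dest!: last_in_set)
  then show "pent_at H B a b c d v \<Longrightarrow> {a, b, c, d, v} \<subseteq> B" unfolding pent_at_def by fastforce
qed

text \<open>Each attachment in the core, paired with its neighbour on the four-cycle in the hop
  extension.\<close>

definition core_exits :: "(nat \<times> nat) list" where
  "core_exits = [(4, 0), (5, 20), (2, 21), (6, 1)]"

text \<open>The three edges of the hop extension at \<open>i\<close> account for all neighbours of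
  \<open>\<eta> i\<close>. Paths of core edges stay in the core, so \<open>w\<close> must begin one
  of the four paths towards the four-cycle.\<close>

lemma core_exit:
  assumes H: "cubic H" and m: "model H {..<22} (set (plus_list (0, 5) (1, 2))) \<eta> I"
    and i: "i \<in> {2..<20}" and w: "{\<eta> i, w} \<in> edges H" "w \<notin> core \<eta> I"
  shows "\<exists>h. (i, h) \<in> set core_exits \<and> w = hd (seg (set (plus_list (0, 5) (1, 2))) I i h @ [\<eta> h])"
proof -
  let ?L = "plus_list (0, 5) (1, 2)"
  \<comment> \<open>Neighbours in the hop extension: the subdivisions replace the neighbour 0 of 5
    by 20, and the neighbour 1 of 2 by 21.\<close>
  define N where "N i = map (\<lambda>j. if i = 5 \<and> j = 0 then 20 else if i = 2 \<and> j = 1 then 21 else j) (nbs i)" for i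
  have "list_all (\<lambda>i. length (N i) = 3 \<and> distinct (N i) \<and>
      list_all (\<lambda>j. linked ?L i j \<and> (1 < j \<and> j < 20 \<and> linked core_edges i j \<or> (i, j) \<in> set core_exits)) (N i)) [2..<20]"
    unfolding N_def by code_simp
  moreover have "i \<in> set [2..<20]" using i unfolding set_upt .
  ultimately have N: "length (N i) = 3 \<and> distinct (N i) \<and>
      list_all (\<lambda>j. linked ?L i j \<and> (1 < j \<and> j < 20 \<and> linked core_edges i j \<or> (i, j) \<in> set core_exits)) (N i)"
    unfolding list_all_iff[of _ "[2..<20]"] by (rule bspec)
  then obtain j k l where jkl: "N i = [j, k, l]" by (auto simp: numeral_eq_Suc length_Suc_conv)
  have d: "j \<noteq> k" "j \<noteq> l" "k \<noteq> l" using N unfolding jkl by auto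
  have nb: "linked ?L i h" "1 < h \<and> h < 20 \<and> linked core_edges i h \<or> (i, h) \<in> set core_exits" if "h \<in> {j, k, l}" for h
    using N that unfolding jkl list_all_iff by auto
  have a: "adj (set ?L) i h" if "h \<in> {j, k, l}" for h using nb(1)[OF that] unfolding linked_iff .
  have e: "(0, 5) \<in> set dedges" "(1, 2) \<in> set dedges" by code_simp+
  have ori: "oriented {..<22} (set ?L)" by (rule oriented_plus_list[OF e])
  obtain h where h: "h \<in> {j, k, l}" "w = hd (seg (set ?L) I i h @ [\<eta> h])"
    using model_neighbour[OF H m ori a[of j] a[of k] a[of l] d w(1)] by blast
  have "\<not> (1 < h \<and> h < 20 \<and> linked core_edges i h)"
  proof
    assume *: "1 < h \<and> h < 20 \<and> linked core_edges i h"
    have "set (seg (set ?L) I i h) \<subseteq> core \<eta> I"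
    proof (cases "(i, h) \<in> set core_edges")
      case True
      then show ?thesis using core_edges_sub by (auto simp: seg_def image_of_def)
    next
      case False
      then have hi: "(h, i) \<in> set core_edges" using * by (auto simp: linked_iff adj_def)
      then have "(i, h) \<notin> set ?L" using ori core_edges_sub unfolding oriented_def by blast
      then show ?thesis using hi by (auto simp: seg_def image_of_def)
    qed
    moreover have "\<eta> h \<in> core \<eta> I" using * by (auto simp: image_of_def)
    moreover have "w \<in> set (seg (set ?L) I i h) \<union> {\<eta> h}"
      unfolding h(2) by (cases "seg (set ?L) I i h") auto
    ultimately show False using w(2) by blast
  qed
  then show ?thesis using nb(2)[OF h(1)] h(2) by blast
qed

theorem theorem9p4:
  fixes G F H :: "'a ugraph"
  assumes "dodecahedron_graph G"
    and "circuit_of_length F 5" and "subgraph F G"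
    and "simple_graph H" and "cubic H" and "cyclically_connected 5 H"
    and "subgraph F H"
    and "\<not> (\<exists>G'. jump_extension G F G' \<and> F_contains H F G')"
    and "\<And>X. \<lbrakk>X \<subseteq> verts H - verts F; card (edge_cut H X) = 5; X \<noteq> verts H - verts F\<rbrakk> \<Longrightarrow>
           \<not> (\<exists>\<eta> \<pi>. homeo_embedding \<eta> \<pi> G H \<and> fixes_subgraph \<eta> \<pi> F \<and>
                 (\<forall>v\<in>verts G - verts F. \<eta> v \<in> X))"
  shows "\<not> (\<exists>G'. hop_extension G F G' \<and> F_contains H F G')"
proof
  assume "\<exists>G'. hop_extension G F G' \<and> F_contains H F G'"
  then obtain G' where G': "hop_extension G F G'" "F_contains H F G'" by blast
  obtain e1 e2 x y where hop: "hop_pair G F e1 e2" and xy: "x \<notin> verts G" "y \<notin> verts G" "x \<noteq> y"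
    and G'_eq: "G' = plus_edges G e1 e2 x y"
    using G'(1) unfolding hop_extension_def by blast
  have "\<not> diverse G e1 e2" using assms(8) G'(2) hop xy G'_eq unfolding jump_extension_def by blast
  obtain \<phi> where "graph_iso \<phi> dodecahedron G" using assms(1) unfolding dodecahedron_graph_def by blast
  note \<phi> = graph_iso_gr[OF this]
  obtain \<psi> where \<psi>: "inj_on \<psi> {..<20}" "dodeca \<psi> = G" "e1 = {\<psi> 0, \<psi> 5}" "e2 = {\<psi> 1, \<psi> 2}"
    using hop_frame[OF \<phi>(2), of e1 e2] hop \<open>\<not> diverse G e1 e2\<close> unfolding hop_pair_def \<phi>(1)[symmetric] by blast
  obtain g where g: "g \<in> set dodecahedron_faces" "F = circuit_graph (map \<psi> g)"
    using dodeca_pentagon[OF \<psi>(1) assms(2)] assms(3) \<psi>(2) by blast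
  have vF: "verts F = \<psi> ` set g" by (simp add: g(2) circuit_graph_def)
  have "\<not> on_face (0, 5) g" "\<not> on_face (1, 2) g"
    using hop on_face_iff[OF \<psi>(1) g(1)] unfolding hop_pair_def \<psi>(3,4) g(2)[symmetric] by auto
  moreover have "\<not> (0 \<in> set g \<and> 1 \<in> set g)"
    using hop unfolding hop_pair_def \<psi>(3,4) vF by auto
  \<comment> \<open>Every face through 0 or 1 contains \<open>(0, 5)\<close>, or
    \<open>(1, 2)\<close>, or both 0 and 1. For the face \<open>F\<close> the hop condition rules
    out all three.\<close>
  moreover have "list_all (\<lambda>g. on_face (0, 5) g \<or> on_face (1, 2) g \<or> 0 \<in> set g \<and> 1 \<in> set g \<or> 0 \<notin> set g \<and> 1 \<notin> set g)
      dodecahedron_faces" by code_simp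
  ultimately have g01: "0 \<notin> set g" "1 \<notin> set g" using g(1) by (auto simp: list_all_iff)
  have "list_all (\<lambda>g. list_all (\<lambda>i. i < 20) g) dodecahedron_faces" by code_simp
  then have "i < 20" if "i \<in> set g" for i using g(1) that by (auto simp: list_all_iff)
  moreover have "2 \<le> i" if "i \<in> set g" for i
    using that g01 by (cases "i = 0"; cases "i = 1") auto
  ultimately have gb: "i \<in> {2..<20}" if "i \<in> set g" for i using that by simp

  let ?L = "plus_list (0, 5) (1, 2)"
  have de: "(0, 5) \<in> set dedges" "(1, 2) \<in> set dedges" by code_simp+
  have xy': "x \<notin> \<psi> ` {..<20}" "y \<notin> \<psi> ` {..<20}" using xy unfolding \<psi>(2)[symmetric] by (simp_all add: labelled_graph_def)
  let ?\<psi> = "\<psi>(20 := x, 21 := y)"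
  note pe = dodeca_plus_edges[OF \<psi>(1) de xy' xy(3)]
  have G'_gr: "G' = labelled_graph ?\<psi> {..<22} (set ?L)" unfolding G'_eq \<psi>(2)[symmetric] \<psi>(3,4) by (rule pe(1))
  obtain \<eta> \<pi> where emb: "homeo_embedding \<eta> \<pi> G' H" "fixes_subgraph \<eta> \<pi> F"
    using G'(2) unfolding F_contains_def by blast
  have ori: "oriented {..<22} (set ?L)" by (rule oriented_plus_list[OF de])
  obtain I where m: "model H {..<22} (set ?L) (\<eta> \<circ> ?\<psi>) I"
    and Iv: "\<And>i j. (i, j) \<in> set ?L \<Longrightarrow> verts (\<pi> {?\<psi> i, ?\<psi> j}) = {\<eta> (?\<psi> i), \<eta> (?\<psi> j)} \<union> set (I (i, j))"
    using model_of_homeo[OF assms(4) emb(1)[unfolded G'_gr] pe(2) ori] by blast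
  define h where "h = \<eta> \<circ> ?\<psi>"
  note m = m[folded h_def]
  have hF: "h i = \<psi> i" if "i \<in> set g" for i
    using emb(2) that gb[OF that] unfolding fixes_subgraph_def vF by (simp add: h_def)
  \<comment> \<open>The path of an edge of \<open>F\<close> is the edge itself, so it has no
    vertices besides its two ends, and these are branch vertices.\<close>
  have IF: "I (i, j) = []" if k: "(i, j) \<in> set core_edges" and o: "on_face (i, j) g" for i j
  proof -
    have b: "i < 20" "j < 20" using k dedges_bounds[of i j] by (auto simp: core_edges_bounds)
    have ij: "i \<in> set g" "j \<in> set g" using o set_face_pairs[of g] unfolding on_face_def by force+
    have "{\<psi> i, \<psi> j} \<in> edges F" using on_face_iff[OF \<psi>(1) g(1) b] o unfolding g(2) by simp
    then have "\<pi> {\<psi> i, \<psi> j} = \<lparr>verts = {\<psi> i, \<psi> j}, edges = {{\<psi> i, \<psi> j}}\<rparr>"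
      using emb(2) unfolding fixes_subgraph_def by blast
    moreover have kL: "(i, j) \<in> set ?L" using k core_edges_sub by blast
    ultimately have "{\<psi> i, \<psi> j} = {h i, h j} \<union> set (I (i, j))" using Iv[OF kL] b by (simp add: h_def)
    then have "set (I (i, j)) \<subseteq> {h i, h j}" using hF ij by auto
    moreover have "h i \<notin> set (I (i, j))" "h j \<notin> set (I (i, j))" using model_avoid[OF m kL] b by simp_all
    ultimately have "set (I (i, j)) = {}" by - (rule equals0I, drule (1) subsetD, erule insertE, simp_all)
    then show ?thesis by simp
  qed
  let ?K = "core h I"
  note fc = four_cycle_of_model[OF m]
  have "circuit F" using assms(2) unfolding circuit_def by blast
  moreover have "verts F \<subseteq> ?K"
  proof
    fix v assume "v \<in> verts F"
    then obtain i where "i \<in> set g" "v = h i" using hF vF by auto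
    then show "v \<in> ?K" using gb by (auto simp: image_of_def)
  qed
  ultimately obtain v u wa wb wc wd where u: "u \<in> ?K" and vu: "{v, u} \<in> edges H"
    and w: "{wa, h 4} \<in> edges H" "{wb, h 5} \<in> edges H" "{wc, h 2} \<in> edges H" "{wd, h 6} \<in> edges H"
    and pent_at: "pent_at H (verts H - ?K) wa wb wc wd v"
    using four_cycle_escape[OF assms(4,5) fc four_cycle_cut[OF assms(4,6) fc _ assms(7)]] by blast
  have out: "wa \<notin> ?K" "wb \<notin> ?K" "wc \<notin> ?K" "wd \<notin> ?K" "v \<notin> ?K" using pent_at_mem[OF pent_at] by auto
  \<comment> \<open>A branch vertex with a neighbour outside the core is one of the four
    attachments, and it has just one such neighbour, the end of an old leg. Then \<open>v\<close>
    would end two legs of the same pentagon.\<close>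
  have "u \<notin> h ` {2..<20}"
  proof
    assume "u \<in> h ` {2..<20}"
    then obtain i where i: "i \<in> {2..<20}" "u = h i" by blast
    note exit = core_exit[OF assms(5) m]
    have step: "\<exists>s. (i, s) \<in> set core_exits \<and> z = hd (seg (set ?L) I i s @ [h s])"
      if "i \<in> {2..<20}" "{z, h i} \<in> edges H" "z \<notin> ?K" for z i
      using exit[OF that(1), of z] that(2,3) by (simp add: insert_commute)
    obtain s where s: "(i, s) \<in> set core_exits" "v = hd (seg (set ?L) I i s @ [h s])"
      using step[OF i(1), of v] vu out(5) i(2) by auto
    have "v \<in> {wa, wb, wc, wd}"
      using s step[of 4 wa] step[of 5 wb] step[of 2 wc] step[of 6 wd] w out by (auto simp: core_exits_def)
    then show False using pent_at_distinct[OF pent_at] by blast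
  qed
  then obtain f where f: "f \<in> set core_edges" "u \<in> set (I f)" using u unfolding image_of_def by blast
  \<comment> \<open>The path of \<open>f\<close> has the inner vertex \<open>u\<close>, while edges
    of \<open>F\<close> have none.\<close>
  have nf: "\<not> on_face f g" using IF[of "fst f" "snd f"] f by auto
  \<comment> \<open>The gap occupied by \<open>v\<close> determines \<open>r\<close>; the ends
    \<open>wa\<close>, \<open>wb\<close>, \<open>wc\<close>, \<open>wd\<close> belong to the
    vertices 0, 20, 21, 1 in this order.\<close>
  have "\<exists>r<4. \<exists>\<eta>' I'. model H {..<24} (set (pentagon_graph r f)) \<eta>' I' \<and> (\<forall>i\<in>{2..<20}. \<eta>' i = h i) \<and>
    (\<forall>e\<in>set core_edges - {f}. I' e = I e)"
  proof -
    note aux = model_pentagon_graph[OF m f vu]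
    from pent_at consider "pent H (verts H - ?K) v wa wb wc wd" | "pent H (verts H - ?K) v wb wc wd wa"
      | "pent H (verts H - ?K) v wc wd wa wb" | "pent H (verts H - ?K) v wd wa wb wc"
      unfolding pent_at_def by blast
    then show ?thesis
    proof cases
      case 1
      show ?thesis by (rule exI[of _ 0], rule conjI, simp, rule aux[OF 1, of 0 20 21 1]) (use w in \<open>simp_all add: attachment_def\<close>)
    next
      case 2
      show ?thesis by (rule exI[of _ 1], rule conjI, simp, rule aux[OF 2, of 20 21 1 0]) (use w in \<open>simp_all add: attachment_def\<close>)
    next
      case 3
      show ?thesis
        by (rule exI[of _ 2], rule conjI, simp, rule aux[OF 3, of 21 1 0 20]) (use w in \<open>simp_all add: attachment_def numeral_2_eq_2\<close>)
    next
      case 4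
      show ?thesis
        by (rule exI[of _ 3], rule conjI, simp, rule aux[OF 4, of 1 0 20 21]) (use w in \<open>simp_all add: attachment_def numeral_3_eq_3\<close>)
    qed
  qed
  then obtain r \<eta>' I' where r: "r < 4" and m': "model H {..<24} (set (pentagon_graph r f)) \<eta>' I'"
    and \<eta>': "\<And>i. i \<in> {2..<20} \<Longrightarrow> \<eta>' i = h i" and I': "\<And>e. e \<in> set core_edges - {f} \<Longrightarrow> I' e = I e" by blast
  obtain c where c: "cert_embeds (pentagon_graph r f) c" "cert_jumps c" "cert_fixes g c"
    using cert_exists[OF r f(1) g(1) g01 nf] by blast
  have "\<exists>G'. jump_extension (dodeca \<psi>) F G' \<and> F_contains H F G'"
  proof (rule cert_contains[OF \<psi>(1) g g01 r f(1) nf m' _ _ c])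
    show "\<eta>' i = \<psi> i" if "i \<in> set g" for i using \<eta>' gb hF that by simp
    show "I' e = []" if "e \<in> set core_edges - {f}" "on_face e g" for e
      using I'[OF that(1)] IF[of "fst e" "snd e"] that by simp
  qed
  then show False using assms(8) \<psi>(2) by simp
qed

end
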